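(* Let $\mathcal D=\langle\mathcal D_1,\mathcal D_2\rangle$ be a semiorthogonal decomposition of a triangulated category $\mathcal D$. Suppose $\sigma_1=(Z_1,P_1)$ and $\sigma_2=(Z_2,P_2)$ are reasonable stability conditions on $\mathcal D_1$ and $\mathcal D_2$ respectively, and let $a$ be a real number in $(0,1)$. Assume that (1) $\operatorname{Hom}_{\mathcal D}^{\le 0}(P_1(0,1],P_2(0,1])=0$; (2) $\operatorname{Hom}_{\mathcal D}^{\le 0}(P_1(a,a+1],P_2(a,a+1])=0$. Then there exists a stability condition $\sigma$ on $\mathcal D$ glued from $\sigma_1$ and $\sigma_2$. Furthermore, $\sigma$ is reasonable.
   Context: $\operatorname{Hom}^i(A,B)=\operatorname{Hom}(A,B[i])$; $\operatorname{Hom}^{\le m}(\mathcal A,\mathcal B)=0$ means $\operatorname{Hom}^i(A,B)=0$ for all $A\in\mathcal A$, $B\in\mathcal B$, $i\le m$. Stability conditions. A stability condition $\sigma=(Z,P)$ on a triangulated category $\mathcal D$ is a homomorphism $Z:K_0(\mathcal D)\to\mathbb C$ and a slicing $P$: full additive subcategories $P(\phi)\subset\mathcal D$, $\phi\in\mathbb R$ (semistable objects of phase $\phi$), with $P(\phi)[1]=P(\phi+1)$, $\operatorname{Hom}(P(\phi_1),P(\phi_2))=0$ for $\phi_1>\phi_2$, $Z(E)\in\mathbb R_{>0}e^{i\pi\phi}$ for $0\ne E\in P(\phi)$, and such that every nonzero object has a finite Harder-Narasimhan filtration by exact triangles with semistable factors of decreasing phases. For an interval $I\subset\mathbb R$,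 $PI$ (e.g. $P(0,1]$) is the extension-closed full subcategory generated by the $P(\phi)$, $\phi\in I$. The heart of $\sigma$ is $P(0,1]$, the heart of a bounded $t$-structure. $\sigma$ is called reasonable if $\inf|Z(E)|>0$, the infimum being over all nonzero $\sigma$-semistable objects $E$. Gluing. $\mathcal D=\langle\mathcal D_1,\mathcal D_2\rangle$ is a semiorthogonal decomposition if $\mathcal D_1,\mathcal D_2$ are triangulated subcategories, $\operatorname{Hom}(E_2,E_1)=0$ for $E_i\in\mathcal D_i$, and each $E\in\mathcal D$ fits into an exact triangle $E_2\to E\to E_1\to E_2[1]$ with $E_i\in\mathcal D_i$. Then $E_1=\lambda_1(E)$, $E_2=\rho_2(E)$, where $\lambda_1$ is left adjoint to $\mathcal D_1\hookrightarrow\mathcal D$ and $\rho_2$ is right adjoint to $\mathcal D_2\hookrightarrow\mathcal D$. A stability condition $\sigma=(Z,P)$ on $\mathcal D$ is glued from $\sigma_1=(Z_1,P_1)$ on $\mathcal D_1$ and $\sigma_2=(Z_2,P_2)$ on $\mathcal D_2$ if the hearts $H_i=P_i(0,1]$ satisfy $\operatorname{Hom}^{\le 0}(H_1,H_2)=0$, the heart of $\sigma$ is $P(0,1]=\{E\in\mathcal D:\lambda_1(E)\in H_1,\ \rho_2(E)\in H_2\}$, and $Z(E)=Z_1(\lambda_1(E))+Z_2(\rho_2(E))$ for all $E$. *)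

theory Defs
  imports Complex_Main
    "HOL-Library.Extended_Real"
    "HOL-Algebra.Coset"
    "HOL-Algebra.Free_Abelian_Groups"
begin

section \<open>Triangulated categories\<close>

text \<open>
  The carrier data of a category with zero morphisms, addition of parallel morphisms, shifts and a
  class of exact triangles. Objects and morphisms are carved out of ambient types by \<open>Obj\<close> and
  \<open>Arr\<close>; \<open>g \<cdot> f\<close> is meaningful only if \<open>Tgt f = Src g\<close>. The family \<open>Sh n\<close>, \<open>ShA n\<close> is the
  shift \<open>[n]\<close> on objects and morphisms: an automorphism \<open>[1]\<close> of the category together with all its
  powers. A triangle \<open>A \<rightarrow> B \<rightarrow> C \<rightarrow> A[1]\<close> is recorded as its triple of morphisms.
\<close>

record ('o, 'm) tricat =
  Obj :: "'o set"
  Arr :: "'m set"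
  Src :: "'m \<Rightarrow> 'o"
  Tgt :: "'m \<Rightarrow> 'o"
  Idt :: "'o \<Rightarrow> 'm"
  Cmp :: "'m \<Rightarrow> 'm \<Rightarrow> 'm"  (infixr "\<cdot>\<index>" 70)
  Add :: "'m \<Rightarrow> 'm \<Rightarrow> 'm"  (infixl "\<boxplus>\<index>" 65)
  Zro :: "'o \<Rightarrow> 'o \<Rightarrow> 'm"
  Sh :: "int \<Rightarrow> 'o \<Rightarrow> 'o"
  ShA :: "int \<Rightarrow> 'm \<Rightarrow> 'm"
  Tri :: "('m \<times> 'm \<times> 'm) set"

definition Hom :: "('o, 'm) tricat \<Rightarrow> 'o \<Rightarrow> 'o \<Rightarrow> 'm set" where
  "Hom D A B = {f \<in> Arr D. Src D f = A \<and> Tgt D f = B}"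

definition hom_group :: "('o, 'm) tricat \<Rightarrow> 'o \<Rightarrow> 'o \<Rightarrow> 'm monoid" where
  "hom_group D A B = \<lparr>carrier = Hom D A B, monoid.mult = Add D, one = Zro D A B\<rparr>"

definition Neg :: "('o, 'm) tricat \<Rightarrow> 'm \<Rightarrow> 'm" where
  "Neg D f = inv\<^bsub>hom_group D (Src D f) (Tgt D f)\<^esub> f"

definition hom_zero :: "('o, 'm) tricat \<Rightarrow> 'o \<Rightarrow> 'o \<Rightarrow> bool" where
  "hom_zero D A B \<longleftrightarrow> Hom D A B = {Zro D A B}"

definition zero_object :: "('o, 'm) tricat \<Rightarrow> 'o \<Rightarrow> bool" where
  "zero_object D X \<longleftrightarrow> X \<in> Obj D \<and> (\<forall>A\<in>Obj D. hom_zero D A X \<and> hom_zero D X A)"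

definition iso_arr :: "('o, 'm) tricat \<Rightarrow> 'o \<Rightarrow> 'o \<Rightarrow> 'm \<Rightarrow> bool" where
  "iso_arr D A B f \<longleftrightarrow> f \<in> Hom D A B \<and>
     (\<exists>g\<in>Hom D B A. g \<cdot>\<^bsub>D\<^esub> f = Idt D A \<and> f \<cdot>\<^bsub>D\<^esub> g = Idt D B)"

definition isomorphic :: "('o, 'm) tricat \<Rightarrow> 'o \<Rightarrow> 'o \<Rightarrow> bool" where
  "isomorphic D A B \<longleftrightarrow> (\<exists>f. iso_arr D A B f)"

definition biproduct :: "('o, 'm) tricat \<Rightarrow> 'o \<Rightarrow> 'o \<Rightarrow> 'o \<Rightarrow> bool" where
  "biproduct D A B X \<longleftrightarrow> X \<in> Obj D \<and>
     (\<exists>i\<in>Hom D A X. \<exists>j\<in>Hom D B X. \<exists>p\<in>Hom D X A. \<exists>q\<in>Hom D X B.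
        p \<cdot>\<^bsub>D\<^esub> i = Idt D A \<and> q \<cdot>\<^bsub>D\<^esub> j = Idt D B \<and>
        p \<cdot>\<^bsub>D\<^esub> j = Zro D B A \<and> q \<cdot>\<^bsub>D\<^esub> i = Zro D A B \<and>
        (i \<cdot>\<^bsub>D\<^esub> p) \<boxplus>\<^bsub>D\<^esub> (j \<cdot>\<^bsub>D\<^esub> q) = Idt D X)"

text \<open>Not necessarily exact: only sources and targets are constrained.\<close>

definition triangle :: "('o, 'm) tricat \<Rightarrow> 'o \<Rightarrow> 'o \<Rightarrow> 'o \<Rightarrow> 'm \<Rightarrow> 'm \<Rightarrow> 'm \<Rightarrow> bool" where
  "triangle D A B C f g h \<longleftrightarrow> A \<in> Obj D \<and> B \<in> Obj D \<and> C \<in> Obj D \<and>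
     f \<in> Hom D A B \<and> g \<in> Hom D B C \<and> h \<in> Hom D C (Sh D 1 A)"

definition exact_triangle :: "('o, 'm) tricat \<Rightarrow> 'o \<Rightarrow> 'o \<Rightarrow> 'o \<Rightarrow> 'm \<Rightarrow> 'm \<Rightarrow> 'm \<Rightarrow> bool" where
  "exact_triangle D A B C f g h \<longleftrightarrow> triangle D A B C f g h \<and> (f, g, h) \<in> Tri D"

definition fits_triangle :: "('o, 'm) tricat \<Rightarrow> 'o \<Rightarrow> 'o \<Rightarrow> 'o \<Rightarrow> bool" where
  "fits_triangle D A B C \<longleftrightarrow> (\<exists>f g h. exact_triangle D A B C f g h)"

locale category =
  fixes D :: "('o, 'm) tricat" (structure)
  assumes Src_in: "f \<in> Arr D \<Longrightarrow> Src D f \<in> Obj D"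
    and Tgt_in: "f \<in> Arr D \<Longrightarrow> Tgt D f \<in> Obj D"
    and Idt_in: "A \<in> Obj D \<Longrightarrow> Idt D A \<in> Hom D A A"
    and Cmp_in: "f \<in> Hom D A B \<Longrightarrow> g \<in> Hom D B C \<Longrightarrow> g \<cdot> f \<in> Hom D A C"
    and Cmp_Idt: "f \<in> Hom D A B \<Longrightarrow> f \<cdot> Idt D A = f"
    and Idt_Cmp: "f \<in> Hom D A B \<Longrightarrow> Idt D B \<cdot> f = f"
    and Cmp_assoc: "f \<in> Hom D A B \<Longrightarrow> g \<in> Hom D B C \<Longrightarrow> h \<in> Hom D C E \<Longrightarrow>
      (h \<cdot> g) \<cdot> f = h \<cdot> (g \<cdot> f)"

locale additive_category = category +
  assumes hom_comm_group: "A \<in> Obj D \<Longrightarrow> B \<in> Obj D \<Longrightarrow> comm_group (hom_group D A B)"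
    and Cmp_Add_left: "f \<in> Hom D A B \<Longrightarrow> g \<in> Hom D B C \<Longrightarrow> g' \<in> Hom D B C \<Longrightarrow>
      (g \<boxplus> g') \<cdot> f = (g \<cdot> f) \<boxplus> (g' \<cdot> f)"
    and Cmp_Add_right: "f \<in> Hom D A B \<Longrightarrow> f' \<in> Hom D A B \<Longrightarrow> g \<in> Hom D B C \<Longrightarrow>
      g \<cdot> (f \<boxplus> f') = (g \<cdot> f) \<boxplus> (g \<cdot> f')"
    and zero_object_exists: "\<exists>X. zero_object D X"
    and biproduct_exists: "A \<in> Obj D \<Longrightarrow> B \<in> Obj D \<Longrightarrow> \<exists>X. biproduct D A B X"

text \<open>Verdier's axioms, the octahedral axiom included.\<close>

locale triangulated_category = additive_category +
  assumes Sh_in: "A \<in> Obj D \<Longrightarrow> Sh D n A \<in> Obj D"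
    and ShA_in: "f \<in> Hom D A B \<Longrightarrow> ShA D n f \<in> Hom D (Sh D n A) (Sh D n B)"
    and ShA_Idt: "A \<in> Obj D \<Longrightarrow> ShA D n (Idt D A) = Idt D (Sh D n A)"
    and ShA_Cmp: "f \<in> Hom D A B \<Longrightarrow> g \<in> Hom D B C \<Longrightarrow>
      ShA D n (g \<cdot> f) = ShA D n g \<cdot> ShA D n f"
    and ShA_Add: "f \<in> Hom D A B \<Longrightarrow> g \<in> Hom D A B \<Longrightarrow>
      ShA D n (f \<boxplus> g) = ShA D n f \<boxplus> ShA D n g"
    and Sh_0: "A \<in> Obj D \<Longrightarrow> Sh D 0 A = A"
    and ShA_0: "f \<in> Arr D \<Longrightarrow> ShA D 0 f = f"
    and Sh_plus: "A \<in> Obj D \<Longrightarrow> Sh D (m + n) A = Sh D m (Sh D n A)"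
    and ShA_plus: "f \<in> Arr D \<Longrightarrow> ShA D (m + n) f = ShA D m (ShA D n f)"
    and Tri_triangle: "(f, g, h) \<in> Tri D \<Longrightarrow> \<exists>A B C. triangle D A B C f g h"
    and TR1_Idt: "A \<in> Obj D \<Longrightarrow> zero_object D X \<Longrightarrow>
      (Idt D A, Zro D A X, Zro D X (Sh D 1 A)) \<in> Tri D"
    and TR1_iso: "exact_triangle D A B C f g h \<Longrightarrow> triangle D A' B' C' f' g' h' \<Longrightarrow>
      iso_arr D A A' a \<Longrightarrow> iso_arr D B B' b \<Longrightarrow> iso_arr D C C' c \<Longrightarrow>
      b \<cdot> f = f' \<cdot> a \<Longrightarrow> c \<cdot> g = g' \<cdot> b \<Longrightarrow> ShA D 1 a \<cdot> h = h' \<cdot> c \<Longrightarrow>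
      (f', g', h') \<in> Tri D"
    and TR1_cone: "f \<in> Arr D \<Longrightarrow> \<exists>g h. (f, g, h) \<in> Tri D"
    and TR2: "triangle D A B C f g h \<Longrightarrow>
      (f, g, h) \<in> Tri D \<longleftrightarrow> (g, h, Neg D (ShA D 1 f)) \<in> Tri D"
    and TR3: "exact_triangle D A B C f g h \<Longrightarrow> exact_triangle D A' B' C' f' g' h' \<Longrightarrow>
      a \<in> Hom D A A' \<Longrightarrow> b \<in> Hom D B B' \<Longrightarrow> b \<cdot> f = f' \<cdot> a \<Longrightarrow>
      \<exists>c\<in>Hom D C C'. c \<cdot> g = g' \<cdot> b \<and> ShA D 1 a \<cdot> h = h' \<cdot> c"
    and TR4: "exact_triangle D A B X f i i' \<Longrightarrow> exact_triangle D B C W g k k' \<Longrightarrow>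
      exact_triangle D A C Y (g \<cdot> f) j j' \<Longrightarrow>
      \<exists>u v. exact_triangle D X Y W u v (ShA D 1 i \<cdot> k') \<and>
        u \<cdot> i = j \<cdot> g \<and> j' \<cdot> u = i' \<and> v \<cdot> j = k \<and> k' \<cdot> v = ShA D 1 f \<cdot> j'"

section \<open>Full subcategories\<close>

text \<open>Full subcategories are given by their sets of objects, and are closed under isomorphism.\<close>

definition replete :: "('o, 'm) tricat \<Rightarrow> 'o set \<Rightarrow> bool" where
  "replete D S \<longleftrightarrow> S \<subseteq> Obj D \<and> (\<forall>A\<in>S. \<forall>B\<in>Obj D. isomorphic D A B \<longrightarrow> B \<in> S)"

definition additive_subcategory :: "('o, 'm) tricat \<Rightarrow> 'o set \<Rightarrow> bool" where
  "additive_subcategory D S \<longleftrightarrow> replete D S \<and> (\<exists>X\<in>S. zero_object D X) \<and>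
     (\<forall>A\<in>S. \<forall>B\<in>S. \<forall>X. biproduct D A B X \<longrightarrow> X \<in> S)"

definition triangulated_subcategory :: "('o, 'm) tricat \<Rightarrow> 'o set \<Rightarrow> bool" where
  "triangulated_subcategory D S \<longleftrightarrow> replete D S \<and> (\<exists>X\<in>S. zero_object D X) \<and>
     (\<forall>A\<in>S. \<forall>n. Sh D n A \<in> S) \<and>
     (\<forall>A\<in>S. \<forall>B\<in>S. \<forall>C. fits_triangle D A B C \<longrightarrow> C \<in> S)"

definition full_subcat :: "('o, 'm) tricat \<Rightarrow> 'o set \<Rightarrow> ('o, 'm) tricat" where
  "full_subcat D S = D\<lparr>Obj := S,
     Arr := {f \<in> Arr D. Src D f \<in> S \<and> Tgt D f \<in> S},
     Tri := {(f, g, h) \<in> Tri D. Src D f \<in> S \<and> Tgt D f \<in> S \<and> Tgt D g \<in> S}\<rparr>"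

text \<open>\<open>Hom\<^sup>\<le>\<^sup>m(\<A>, \<B>) = 0\<close>, where \<open>Hom\<^sup>i(A, B) = Hom(A, B[i])\<close> and \<open>m\<close> may be negative.\<close>

definition hom_le_zero :: "('o, 'm) tricat \<Rightarrow> int \<Rightarrow> 'o set \<Rightarrow> 'o set \<Rightarrow> bool" where
  "hom_le_zero D m \<A> \<B> \<longleftrightarrow> (\<forall>A\<in>\<A>. \<forall>B\<in>\<B>. \<forall>i\<le>m. hom_zero D A (Sh D i B))"

inductive_set ext_closure :: "('o, 'm) tricat \<Rightarrow> 'o set \<Rightarrow> 'o set"
  for D :: "('o, 'm) tricat" and S :: "'o set" where
  base: "A \<in> S \<Longrightarrow> A \<in> ext_closure D S"
| ext: "A \<in> ext_closure D S \<Longrightarrow> C \<in> ext_closure D S \<Longrightarrow> fits_triangle D A B C \<Longrightarrow>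
    B \<in> ext_closure D S"

section \<open>The Grothendieck group\<close>

text \<open>
  The free abelian group on the objects modulo \<open>[B] = [A] + [C]\<close> for exact triangles
  \<open>A \<rightarrow> B \<rightarrow> C \<rightarrow> A[1]\<close>. These relations already identify isomorphic objects.
\<close>

definition K0_relations :: "('o, 'm) tricat \<Rightarrow> ('o \<Rightarrow>\<^sub>0 int) set" where
  "K0_relations D = generate (free_Abelian_group (Obj D))
     {frag_of B - frag_of A - frag_of C | A B C. fits_triangle D A B C}"

definition K0 :: "('o, 'm) tricat \<Rightarrow> ('o \<Rightarrow>\<^sub>0 int) set monoid" where
  "K0 D = free_Abelian_group (Obj D) Mod K0_relations D"

definition K0_class :: "('o, 'm) tricat \<Rightarrow> 'o \<Rightarrow> ('o \<Rightarrow>\<^sub>0 int) set" where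
  "K0_class D E = K0_relations D #>\<^bsub>free_Abelian_group (Obj D)\<^esub> frag_of E"

definition complex_group :: "complex monoid" where
  "complex_group = \<lparr>carrier = UNIV, monoid.mult = (+), one = 0\<rparr>"

section \<open>Stability conditions\<close>

text \<open>
  A pair \<open>(Z, P)\<close>; \<open>charge\<close> is \<open>Z\<close>, relevant only on the carrier of \<open>K0\<close>, and \<open>slice\<close> is \<open>P\<close>.
\<close>

record 'o stab =
  charge :: "('o \<Rightarrow>\<^sub>0 int) set \<Rightarrow> complex"
  slice :: "real \<Rightarrow> 'o set"

definition Z_of :: "('o, 'm) tricat \<Rightarrow> 'o stab \<Rightarrow> 'o \<Rightarrow> complex" where
  "Z_of D \<sigma> E = charge \<sigma> (K0_class D E)"

text \<open>
  \<open>0 = F 0 \<rightarrow> F 1 \<rightarrow> \<dots> \<rightarrow> F n = E\<close>, where the cone \<open>A i\<close> of \<open>F i \<rightarrow> F (i + 1)\<close> is semistable of phase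
  \<open>\<phi> i\<close>, for \<open>i < n\<close>.
\<close>

definition HN_filtration ::
  "('o, 'm) tricat \<Rightarrow> (real \<Rightarrow> 'o set) \<Rightarrow> 'o \<Rightarrow> nat \<Rightarrow> (nat \<Rightarrow> 'o) \<Rightarrow> (nat \<Rightarrow> 'o) \<Rightarrow> (nat \<Rightarrow> real) \<Rightarrow> bool"
where
  "HN_filtration D P E n F A \<phi> \<longleftrightarrow> zero_object D (F 0) \<and> F n = E \<and>
     (\<forall>i<n. A i \<in> P (\<phi> i) \<and> fits_triangle D (F i) (F (Suc i)) (A i)) \<and>
     (\<forall>i j. i < j \<longrightarrow> j < n \<longrightarrow> \<phi> i > \<phi> j)"

definition stability_condition :: "('o, 'm) tricat \<Rightarrow> 'o stab \<Rightarrow> bool" where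
  "stability_condition D \<sigma> \<longleftrightarrow>
     charge \<sigma> \<in> hom (K0 D) complex_group \<and>
     (\<forall>\<phi>. additive_subcategory D (slice \<sigma> \<phi>)) \<and>
     (\<forall>\<phi>. Sh D 1 ` slice \<sigma> \<phi> = slice \<sigma> (\<phi> + 1)) \<and>
     (\<forall>\<phi>\<^sub>1 \<phi>\<^sub>2. \<phi>\<^sub>1 > \<phi>\<^sub>2 \<longrightarrow> (\<forall>A\<in>slice \<sigma> \<phi>\<^sub>1. \<forall>B\<in>slice \<sigma> \<phi>\<^sub>2. hom_zero D A B)) \<and>
     (\<forall>\<phi>. \<forall>E\<in>slice \<sigma> \<phi>. \<not> zero_object D E \<longrightarrow>
        (\<exists>m::real. m > 0 \<and> Z_of D \<sigma> E = of_real m * exp (\<i> * of_real pi * of_real \<phi>))) \<and>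
     (\<forall>E\<in>Obj D. \<not> zero_object D E \<longrightarrow> (\<exists>n F A \<phi>. HN_filtration D (slice \<sigma>) E n F A \<phi>))"

definition P_interval :: "('o, 'm) tricat \<Rightarrow> 'o stab \<Rightarrow> real set \<Rightarrow> 'o set" where
  "P_interval D \<sigma> I = ext_closure D (\<Union>\<phi>\<in>I. slice \<sigma> \<phi>)"

definition heart :: "('o, 'm) tricat \<Rightarrow> 'o stab \<Rightarrow> 'o set" where
  "heart D \<sigma> = P_interval D \<sigma> {0<..1}"

text \<open>
  The infimum is taken in the extended reals, so that it is \<open>\<infinity>\<close> if all objects are zero.
\<close>

definition reasonable :: "('o, 'm) tricat \<Rightarrow> 'o stab \<Rightarrow> bool" where
  "reasonable D \<sigma> \<longleftrightarrow>
     0 < (INF E\<in>{E. \<not> zero_object D E \<and> (\<exists>\<phi>. E \<in> slice \<sigma> \<phi>)}. ereal (cmod (Z_of D \<sigma> E)))"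

section \<open>Gluing\<close>

definition semiorthogonal_decomposition :: "('o, 'm) tricat \<Rightarrow> 'o set \<Rightarrow> 'o set \<Rightarrow> bool" where
  "semiorthogonal_decomposition D D\<^sub>1 D\<^sub>2 \<longleftrightarrow>
     triangulated_subcategory D D\<^sub>1 \<and> triangulated_subcategory D D\<^sub>2 \<and>
     (\<forall>E\<^sub>2\<in>D\<^sub>2. \<forall>E\<^sub>1\<in>D\<^sub>1. hom_zero D E\<^sub>2 E\<^sub>1) \<and>
     (\<forall>E\<in>Obj D. \<exists>E\<^sub>1\<in>D\<^sub>1. \<exists>E\<^sub>2\<in>D\<^sub>2. fits_triangle D E\<^sub>2 E E\<^sub>1)"

text \<open>
  The object parts of the left adjoint of \<open>D\<^sub>1 \<rightarrow> D\<close> and the right adjoint of \<open>D\<^sub>2 \<rightarrow> D\<close>: the outer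
  terms of the decomposition triangle \<open>E\<^sub>2 \<rightarrow> E \<rightarrow> E\<^sub>1 \<rightarrow> E\<^sub>2[1]\<close>, which is unique up to isomorphism.
\<close>

definition lam\<^sub>1 :: "('o, 'm) tricat \<Rightarrow> 'o set \<Rightarrow> 'o set \<Rightarrow> 'o \<Rightarrow> 'o" where
  "lam\<^sub>1 D D\<^sub>1 D\<^sub>2 E = (SOME E\<^sub>1. E\<^sub>1 \<in> D\<^sub>1 \<and> (\<exists>E\<^sub>2\<in>D\<^sub>2. fits_triangle D E\<^sub>2 E E\<^sub>1))"

definition rho\<^sub>2 :: "('o, 'm) tricat \<Rightarrow> 'o set \<Rightarrow> 'o set \<Rightarrow> 'o \<Rightarrow> 'o" where
  "rho\<^sub>2 D D\<^sub>1 D\<^sub>2 E = (SOME E\<^sub>2. E\<^sub>2 \<in> D\<^sub>2 \<and> (\<exists>E\<^sub>1\<in>D\<^sub>1. fits_triangle D E\<^sub>2 E E\<^sub>1))"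

definition glued :: "('o, 'm) tricat \<Rightarrow> 'o set \<Rightarrow> 'o set \<Rightarrow> 'o stab \<Rightarrow> 'o stab \<Rightarrow> 'o stab \<Rightarrow> bool" where
  "glued D D\<^sub>1 D\<^sub>2 \<sigma>\<^sub>1 \<sigma>\<^sub>2 \<sigma> \<longleftrightarrow>
     (let H\<^sub>1 = heart (full_subcat D D\<^sub>1) \<sigma>\<^sub>1; H\<^sub>2 = heart (full_subcat D D\<^sub>2) \<sigma>\<^sub>2 in
      hom_le_zero D 0 H\<^sub>1 H\<^sub>2 \<and>
      heart D \<sigma> = {E \<in> Obj D. lam\<^sub>1 D D\<^sub>1 D\<^sub>2 E \<in> H\<^sub>1 \<and> rho\<^sub>2 D D\<^sub>1 D\<^sub>2 E \<in> H\<^sub>2} \<and>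
      (\<forall>E\<in>Obj D. Z_of D \<sigma> E =
         Z_of (full_subcat D D\<^sub>1) \<sigma>\<^sub>1 (lam\<^sub>1 D D\<^sub>1 D\<^sub>2 E) +
         Z_of (full_subcat D D\<^sub>2) \<sigma>\<^sub>2 (rho\<^sub>2 D D\<^sub>1 D\<^sub>2 E)))"

end

theory Submission
  imports Defs
begin

text \<open>
  Let \<open>H\<close> be the glued heart. Condition (1) makes \<open>H\<close> the heart of a bounded t-structure and
  \<open>Z = Z\<^sub>1 \<circ> \<lambda>\<^sub>1 + Z\<^sub>2 \<circ> \<rho>\<^sub>2\<close> a stability function on it; the difficulty is the existence of
  Harder-Narasimhan filtrations, since \<open>H\<close> need not have finite length and the values of \<open>Z\<close> need not
  be discrete. Condition (2) is used to cut \<open>H\<close> into two pieces, each of which has finite length.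

  Call the elements of \<open>\<int> \<union> (a + \<int>)\<close> cuts. By shifting, the two conditions say that for each cut \<open>t\<close>
  there are no morphisms from \<open>P\<^sub>1(t, \<infinity>)\<close> to \<open>P\<^sub>2(-\<infinity>, t + 1]\<close>
  (\<open>hom_zero_from_hearts\<close>). Given the decomposition \<open>E\<^sub>2 \<rightarrow> E \<rightarrow> E\<^sub>1\<close> of an object, truncate \<open>E\<^sub>2\<close> and
  \<open>E\<^sub>1\<close> at \<open>t\<close>. The obstruction to merging the two truncations into one of \<open>E\<close> is a morphism from the
  upper part of \<open>E\<^sub>1\<close> to the shifted lower part of \<open>E\<^sub>2\<close>, hence zero (\<open>fits_merge\<close>). So every cut defines
  a t-structure on \<open>D\<close>, whose two classes consist of the objects \<open>E\<close> such that both \<open>E\<^sub>1\<close> and \<open>E\<^sub>2\<close> have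
  phases above \<open>t\<close>, respectively at most \<open>t\<close>.

  A block consists of the objects between two consecutive cuts \<open>s < t\<close>. Both components of an object of
  a block have phases in \<open>(s, t]\<close>, so its charge is a sum of charges of semistable objects lying in a
  sector of angle \<open>\<pi>(t - s) < \<pi>\<close>. As \<open>\<sigma>\<^sub>1\<close> and \<open>\<sigma>\<^sub>2\<close> are reasonable, there is a linear functional which is
  bounded below on the charges of nonzero objects of the block by a positive constant
  (\<open>gap_le_height\<close>). This bounds the number of factors of any filtration inside the block and is the
  induction measure for the construction of destabilizing subobjects, of torsion pairs, and finally of
  Harder-Narasimhan filtrations in the block. It also shows that the result is reasonable.

  Instead of the abelian category \<open>H\<close>, the proofs use exact triangles with all three terms in the
  block. Kernels are needed in a single place, the vanishing of morphisms from objects all of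
  whose quotients have phase above \<open>\<phi>\<close> to objects all of whose subobjects have phase at most \<open>\<phi>\<close>
  (\<open>above_below_hom\<close>). There the kernel may leave the block, but only downwards, and the charge of the
  part that is lost has the sign that the argument needs. Filtrations of the blocks and the
  t-structures at the cuts together give a slicing of \<open>D\<close>.
\<close>

section \<open>Triangles in a triangulated category\<close>

context triangulated_category
begin

subsection \<open>Morphism groups\<close>

lemma Hom_Obj:
  assumes "f \<in> Hom D A B" shows "A \<in> Obj D" "B \<in> Obj D"
  using assms Src_in Tgt_in unfolding Hom_def by auto

lemma Hom_Arr: "f \<in> Hom D A B \<Longrightarrow> f \<in> Arr D"
  by (simp add: Hom_def)

lemma Zro_in: "A \<in> Obj D \<Longrightarrow> B \<in> Obj D \<Longrightarrow> Zro D A B \<in> Hom D A B"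
  using comm_group.axioms(2)[OF hom_comm_group, of A B] group.is_monoid monoid.one_closed
  by (fastforce simp: hom_group_def)

lemma Add_in: "f \<in> Hom D A B \<Longrightarrow> g \<in> Hom D A B \<Longrightarrow> f \<boxplus> g \<in> Hom D A B"
  using monoid.m_closed[of "hom_group D A B" f g]
    comm_group.axioms(2)[OF hom_comm_group[OF Hom_Obj[of f A B]]] group.is_monoid
  by (fastforce simp: hom_group_def)

lemma Add_commute: "f \<in> Hom D A B \<Longrightarrow> g \<in> Hom D A B \<Longrightarrow> f \<boxplus> g = g \<boxplus> f"
  using comm_monoid.m_comm[of "hom_group D A B" f g]
    comm_group.axioms(1)[OF hom_comm_group[OF Hom_Obj[of f A B]]]
  by (fastforce simp: hom_group_def)

lemma Add_assoc:
  "f \<in> Hom D A B \<Longrightarrow> g \<in> Hom D A B \<Longrightarrow> h \<in> Hom D A B \<Longrightarrow> (f \<boxplus> g) \<boxplus> h = f \<boxplus> (g \<boxplus> h)"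
  using monoid.m_assoc[of "hom_group D A B" f g h]
    comm_group.axioms(2)[OF hom_comm_group[OF Hom_Obj[of f A B]]] group.is_monoid
  by (fastforce simp: hom_group_def)

lemma Add_Zro: "f \<in> Hom D A B \<Longrightarrow> f \<boxplus> Zro D A B = f"
  using monoid.r_one[of "hom_group D A B" f]
    comm_group.axioms(2)[OF hom_comm_group[OF Hom_Obj[of f A B]]] group.is_monoid
  by (fastforce simp: hom_group_def)

lemma Zro_Add: "f \<in> Hom D A B \<Longrightarrow> Zro D A B \<boxplus> f = f"
  using Add_Zro Add_commute Zro_in Hom_Obj by metis

lemma Neg_props:
  assumes f: "f \<in> Hom D A B"
  shows "Neg D f \<in> Hom D A B" "f \<boxplus> Neg D f = Zro D A B"
proof -
  have [simp]: "Src D f = A" "Tgt D f = B" using f by (auto simp: Hom_def)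
  have g: "group (hom_group D A B)"
    using comm_group.axioms(2)[OF hom_comm_group[OF Hom_Obj[OF f]]] .
  have c: "f \<in> carrier (hom_group D A B)" using f by (simp add: hom_group_def)
  show "Neg D f \<in> Hom D A B" using group.inv_closed[OF g c] by (simp add: Neg_def hom_group_def)
  show "f \<boxplus> Neg D f = Zro D A B" using group.r_inv[OF g c] by (simp add: Neg_def hom_group_def)
qed

lemmas Neg_in = Neg_props(1)
lemmas Add_Neg = Neg_props(2)

lemma Add_cancel:
  assumes "f \<in> Hom D A B" "g \<in> Hom D A B" "h \<in> Hom D A B" "f \<boxplus> h = g \<boxplus> h"
  shows "f = g"
proof -
  have "(f \<boxplus> h) \<boxplus> Neg D h = (g \<boxplus> h) \<boxplus> Neg D h" using assms(4) by simp
  thus ?thesis using assms(1-3) by (simp add: Add_assoc[where A=A and B=B] Neg_in Add_Neg Add_Zro)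
qed

lemma Neg_unique:
  assumes "f \<in> Hom D A B" "g \<in> Hom D A B" "f \<boxplus> g = Zro D A B"
  shows "g = Neg D f"
  using Add_cancel[of g A B "Neg D f" f] assms Add_Neg[OF assms(1)] Neg_in[OF assms(1)]
  by (metis Add_commute)

lemma Neg_Neg: "f \<in> Hom D A B \<Longrightarrow> Neg D (Neg D f) = f"
  by (metis Add_Neg Add_commute Neg_in Neg_unique)

lemma Sub_eq_Zro:
  assumes "f \<in> Hom D A B" "g \<in> Hom D A B" "f \<boxplus> Neg D g = Zro D A B"
  shows "f = g"
  using Add_cancel[of f A B g "Neg D g"] assms Add_Neg Neg_in by metis

lemma idem_Add_Zro:
  assumes "f \<in> Hom D A B" "f \<boxplus> f = f" shows "f = Zro D A B"
  using Add_cancel[of f A B "Zro D A B" f] assms Zro_Add Zro_in Hom_Obj[OF assms(1)] by simp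

lemma Cmp_Zro:
  assumes "f \<in> Hom D B C" "A \<in> Obj D" shows "f \<cdot> Zro D A B = Zro D A C"
proof (rule idem_Add_Zro)
  have z: "Zro D A B \<in> Hom D A B" using assms Hom_Obj Zro_in by blast
  show "f \<cdot> Zro D A B \<in> Hom D A C" using z assms Cmp_in by blast
  show "(f \<cdot> Zro D A B) \<boxplus> (f \<cdot> Zro D A B) = f \<cdot> Zro D A B"
    using Cmp_Add_right[OF z z assms(1)] Add_Zro[OF z] by simp
qed

lemma Zro_Cmp:
  assumes "f \<in> Hom D A B" "C \<in> Obj D" shows "Zro D B C \<cdot> f = Zro D A C"
proof (rule idem_Add_Zro)
  have z: "Zro D B C \<in> Hom D B C" using assms Hom_Obj Zro_in by blast
  show "Zro D B C \<cdot> f \<in> Hom D A C" using z assms Cmp_in by blast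
  show "(Zro D B C \<cdot> f) \<boxplus> (Zro D B C \<cdot> f) = Zro D B C \<cdot> f"
    using Cmp_Add_left[OF assms(1) z z] Add_Zro[OF z] by simp
qed

lemma Cmp_Neg:
  assumes "f \<in> Hom D A B" "g \<in> Hom D B C" shows "g \<cdot> Neg D f = Neg D (g \<cdot> f)"
proof (rule Neg_unique)
  show "g \<cdot> f \<in> Hom D A C" "g \<cdot> Neg D f \<in> Hom D A C" using assms Cmp_in Neg_in by blast+
  show "(g \<cdot> f) \<boxplus> (g \<cdot> Neg D f) = Zro D A C"
    using Cmp_Add_right[OF assms(1) Neg_in[OF assms(1)] assms(2)] Add_Neg[OF assms(1)]
      Cmp_Zro[OF assms(2)] Hom_Obj[OF assms(1)] by simp
qed

lemma Neg_Cmp: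
  assumes "f \<in> Hom D A B" "g \<in> Hom D B C" shows "Neg D g \<cdot> f = Neg D (g \<cdot> f)"
proof (rule Neg_unique)
  show "g \<cdot> f \<in> Hom D A C" "Neg D g \<cdot> f \<in> Hom D A C" using assms Cmp_in Neg_in by blast+
  show "(g \<cdot> f) \<boxplus> (Neg D g \<cdot> f) = Zro D A C"
    using Cmp_Add_left[OF assms(1) assms(2) Neg_in[OF assms(2)]] Add_Neg[OF assms(2)]
      Zro_Cmp[OF assms(1)] Hom_Obj[OF assms(2)] by simp
qed

lemma ShA_Zro:
  assumes "A \<in> Obj D" "B \<in> Obj D" shows "ShA D n (Zro D A B) = Zro D (Sh D n A) (Sh D n B)"
  using idem_Add_Zro[OF ShA_in[OF Zro_in[OF assms]]] ShA_Add[OF Zro_in[OF assms] Zro_in[OF assms]]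
    Add_Zro[OF Zro_in[OF assms]] by metis

lemma ShA_Neg:
  assumes "f \<in> Hom D A B" shows "ShA D n (Neg D f) = Neg D (ShA D n f)"
  by (rule Neg_unique[OF ShA_in[OF assms] ShA_in[OF Neg_in[OF assms]]])
     (metis ShA_Add ShA_Zro Add_Neg Neg_in Hom_Obj assms)

lemma Sh_Sh_inv [simp]:
  "A \<in> Obj D \<Longrightarrow> Sh D 1 (Sh D (-1) A) = A" "A \<in> Obj D \<Longrightarrow> Sh D (-1) (Sh D 1 A) = A"
  using Sh_plus[of A 1 "-1"] Sh_plus[of A "-1" 1] Sh_0 by simp_all

lemma ShA_ShA_inv:
  "f \<in> Hom D A B \<Longrightarrow> ShA D 1 (ShA D (-1) f) = f" "f \<in> Hom D A B \<Longrightarrow> ShA D (-1) (ShA D 1 f) = f"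
  using ShA_plus[of f 1 "-1"] ShA_plus[of f "-1" 1] ShA_0[of f] Hom_Arr[of f A B] by simp_all

lemma Sh_Obj [simp]: "A \<in> Obj D \<Longrightarrow> Sh D n A \<in> Obj D"
  by (rule Sh_in)

subsection \<open>Vanishing of morphism groups\<close>

lemma hom_zeroD: "hom_zero D A B \<Longrightarrow> f \<in> Hom D A B \<Longrightarrow> f = Zro D A B"
  by (auto simp: hom_zero_def)

lemma hom_zeroI:
  assumes "A \<in> Obj D" "B \<in> Obj D" "\<And>f. f \<in> Hom D A B \<Longrightarrow> f = Zro D A B"
  shows "hom_zero D A B"
  using assms Zro_in unfolding hom_zero_def by blast

lemma hom_zero_Obj:
  assumes "hom_zero D A B" shows "A \<in> Obj D" "B \<in> Obj D"
  using assms Hom_Obj unfolding hom_zero_def by blast+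

lemma hom_zero_Sh:
  assumes "hom_zero D A B" shows "hom_zero D (Sh D n A) (Sh D n B)"
proof (rule hom_zeroI)
  note ob = hom_zero_Obj[OF assms]
  show "Sh D n A \<in> Obj D" "Sh D n B \<in> Obj D" using ob by auto
  fix f assume f: "f \<in> Hom D (Sh D n A) (Sh D n B)"
  have "Sh D (-n) (Sh D n X) = X" if "X \<in> Obj D" for X
    using Sh_plus[OF that, of "-n" n] Sh_0 that by simp
  then have "ShA D (-n) f \<in> Hom D A B" using ShA_in[OF f, of "-n"] ob by simp
  then have "ShA D (-n) f = Zro D A B" using hom_zeroD[OF assms] by blast
  then have "ShA D n (ShA D (-n) f) = Zro D (Sh D n A) (Sh D n B)" using ShA_Zro ob by simp
  moreover have "ShA D n (ShA D (-n) f) = f"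
    using ShA_plus[OF Hom_Arr[OF f], of n "-n"] ShA_0 Hom_Arr[OF f] by simp
  ultimately show "f = Zro D (Sh D n A) (Sh D n B)" by simp
qed

lemma zero_object_iff: "zero_object D X \<longleftrightarrow> hom_zero D X X"
proof
  assume "zero_object D X" then show "hom_zero D X X" by (auto simp: zero_object_def)
next
  assume h: "hom_zero D X X"
  have X: "X \<in> Obj D" using hom_zero_Obj[OF h] by simp
  have id: "Idt D X = Zro D X X" using hom_zeroD[OF h] Idt_in[OF X] by blast
  have "hom_zero D A X" if A: "A \<in> Obj D" for A
  proof (rule hom_zeroI[OF A X])
    fix f assume f: "f \<in> Hom D A X"
    show "f = Zro D A X" using Idt_Cmp[OF f] id Zro_Cmp[OF f X] by simp
  qed
  moreover have "hom_zero D X A" if A: "A \<in> Obj D" for A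
  proof (rule hom_zeroI[OF X A])
    fix f assume f: "f \<in> Hom D X A"
    show "f = Zro D X A" using Cmp_Idt[OF f] id Cmp_Zro[OF f X] by simp
  qed
  ultimately show "zero_object D X" using X by (simp add: zero_object_def)
qed

lemma zero_object_Idt:
  assumes "X \<in> Obj D" "Idt D X = Zro D X X" shows "zero_object D X"
  unfolding zero_object_iff
  by (rule hom_zeroI) (use assms Cmp_Idt Cmp_Zro in metis)+

lemma zero_Obj: "zero_object D X \<Longrightarrow> X \<in> Obj D"
  by (simp add: zero_object_def)

lemma zero_object_Sh: "zero_object D X \<Longrightarrow> zero_object D (Sh D n X)"
  using hom_zero_Sh zero_object_iff by blast

lemma zero_hom_zero:
  assumes "zero_object D X" "A \<in> Obj D" shows "hom_zero D A X" "hom_zero D X A"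
  using assms by (auto simp: zero_object_def)

subsection \<open>Isomorphisms\<close>

lemma isomorphic_Obj: assumes "isomorphic D A B" shows "A \<in> Obj D" "B \<in> Obj D"
  using assms Hom_Obj by (auto simp: isomorphic_def iso_arr_def)

lemma isomorphic_refl: "A \<in> Obj D \<Longrightarrow> isomorphic D A A"
  unfolding isomorphic_def iso_arr_def using Idt_in Cmp_Idt by blast

lemma isomorphic_sym: "isomorphic D A B \<Longrightarrow> isomorphic D B A"
  unfolding isomorphic_def iso_arr_def by blast

lemma isomorphicI:
  "f \<in> Hom D A B \<Longrightarrow> g \<in> Hom D B A \<Longrightarrow> g \<cdot> f = Idt D A \<Longrightarrow> f \<cdot> g = Idt D B \<Longrightarrow> isomorphic D A B"
  unfolding isomorphic_def iso_arr_def by blast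

lemma zero_objects_isomorphic:
  assumes "zero_object D X" "zero_object D Y" shows "isomorphic D X Y"
proof (rule isomorphicI)
  have ob: "X \<in> Obj D" "Y \<in> Obj D" using assms zero_Obj by auto
  show xy: "Zro D X Y \<in> Hom D X Y" and yx: "Zro D Y X \<in> Hom D Y X" using Zro_in ob by auto
  have "f = g" if "zero_object D Z" "f \<in> Hom D Z Z" "g \<in> Hom D Z Z" for f g Z
    using hom_zeroD that zero_object_iff by metis
  then show "Zro D Y X \<cdot> Zro D X Y = Idt D X" "Zro D X Y \<cdot> Zro D Y X = Idt D Y"
    using Cmp_in[OF xy yx] Cmp_in[OF yx xy] Idt_in ob assms by blast+
qed

lemma zero_object_iso:
  assumes "zero_object D X" "isomorphic D X Y" shows "zero_object D Y"
proof -
  obtain f g where f: "f \<in> Hom D X Y" "g \<in> Hom D Y X" "f \<cdot> g = Idt D Y"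
    using assms(2) by (auto simp: isomorphic_def iso_arr_def)
  have "f = Zro D X Y" using assms(1) f(1) hom_zeroD zero_hom_zero Hom_Obj by metis
  then have "Idt D Y = Zro D Y Y" using f Zro_Cmp Hom_Obj by metis
  then show ?thesis using zero_object_Idt Hom_Obj(2)[OF f(1)] by blast
qed

lemma replete_mem: "replete D S \<Longrightarrow> A \<in> S \<Longrightarrow> isomorphic D A B \<Longrightarrow> B \<in> S"
  using isomorphic_Obj unfolding replete_def by blast

lemma replete_zero:
  "replete D S \<Longrightarrow> \<exists>X\<in>S. zero_object D X \<Longrightarrow> zero_object D Y \<Longrightarrow> Y \<in> S"
  using replete_mem zero_objects_isomorphic by blast

subsection \<open>Exactness\<close>

lemma et_Hom:
  assumes "exact_triangle D A B C f g h"
  shows "A \<in> Obj D" "B \<in> Obj D" "C \<in> Obj D"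
    "f \<in> Hom D A B" "g \<in> Hom D B C" "h \<in> Hom D C (Sh D 1 A)"
  using assms by (auto simp: exact_triangle_def triangle_def)

lemma et_Idt:
  assumes "A \<in> Obj D" "zero_object D X"
  shows "exact_triangle D A A X (Idt D A) (Zro D A X) (Zro D X (Sh D 1 A))"
  using assms TR1_Idt Idt_in Zro_in zero_Obj unfolding exact_triangle_def triangle_def by auto

lemma et_rotate:
  assumes "exact_triangle D A B C f g h"
  shows "exact_triangle D B C (Sh D 1 A) g h (Neg D (ShA D 1 f))"
  using assms TR2[of A B C f g h] et_Hom[OF assms] Neg_in[OF ShA_in[of f A B 1]]
  unfolding exact_triangle_def triangle_def by auto

lemma et_rotate_back:
  assumes "exact_triangle D A B C f g h"
  obtains k where "exact_triangle D (Sh D (-1) C) A B k f g"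
proof -
  note H = et_Hom[OF assms]
  define k where "k = Neg D (ShA D (-1) h)"
  have h1: "ShA D (-1) h \<in> Hom D (Sh D (-1) C) A" using ShA_in[OF H(6), of "-1"] H(1) by simp
  then have k: "k \<in> Hom D (Sh D (-1) C) A" using Neg_in k_def by simp
  have "Neg D (ShA D 1 k) = h"
    unfolding k_def ShA_Neg[OF h1] ShA_ShA_inv[OF H(6)] using Neg_Neg[OF H(6)] .
  moreover have "triangle D (Sh D (-1) C) A B k f g" using H k by (simp add: triangle_def)
  ultimately have "exact_triangle D (Sh D (-1) C) A B k f g"
    using TR2 assms unfolding exact_triangle_def by metis
  then show thesis using that by blast
qed

lemma et_comp_zero:
  assumes "exact_triangle D A B C f g h" shows "g \<cdot> f = Zro D A C"
proof -
  note H = et_Hom[OF assms]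
  obtain X where X: "zero_object D X" using zero_object_exists by blast
  obtain c where c: "c \<in> Hom D X C" "c \<cdot> Zro D A X = g \<cdot> f"
    using TR3[OF et_Idt[OF H(1) X] assms Idt_in[OF H(1)] H(4)] by blast
  then show ?thesis using Cmp_Zro[OF c(1) H(1)] by simp
qed

text \<open>
  The functors \<open>Hom(-, X)\<close> and \<open>Hom(X, -)\<close> are exact at the middle term: the triangle maps to, or
  receives a map from, a rotation of the trivial triangle on \<open>X\<close>, and the third component of the
  morphism of triangles is the factorization.
\<close>

lemma et_factor:
  assumes "exact_triangle D A B C f g h" "u \<in> Hom D B X" "u \<cdot> f = Zro D A X"
  obtains v where "v \<in> Hom D C X" "v \<cdot> g = u"
proof -
  note H = et_Hom[OF assms(1)]
  have X: "X \<in> Obj D" using assms(2) Hom_Obj by blast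
  obtain Z where Z: "zero_object D Z" using zero_object_exists by blast
  obtain k where k: "exact_triangle D (Sh D (-1) Z) X X k (Idt D X) (Zro D X Z)"
    using et_rotate_back[OF et_Idt[OF X Z]] .
  note K = et_Hom[OF k]
  have "u \<cdot> f = k \<cdot> Zro D A (Sh D (-1) Z)" using assms(3) Cmp_Zro[OF K(4) H(1)] by simp
  then obtain c where "c \<in> Hom D C X" "c \<cdot> g = Idt D X \<cdot> u"
    using TR3[OF assms(1) k Zro_in[OF H(1) K(1)] assms(2)] by blast
  then show thesis using that Idt_Cmp[OF assms(2)] by simp
qed

lemma et_lift:
  assumes "exact_triangle D A B C f g h" "u \<in> Hom D X B" "g \<cdot> u = Zro D X C"
  obtains v where "v \<in> Hom D X A" "f \<cdot> v = u"
proof -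
  note H = et_Hom[OF assms(1)]
  have X: "X \<in> Obj D" using assms(2) Hom_Obj by blast
  obtain Z where Z: "zero_object D Z" using zero_object_exists by blast
  note id1 = ShA_in[OF Idt_in[OF X], of 1]
  have e: "Zro D Z C \<cdot> Zro D X Z = g \<cdot> u"
    using assms(3) Zro_Cmp[OF Zro_in[OF X zero_Obj[OF Z]] H(3)] by simp
  obtain c where c: "c \<in> Hom D (Sh D 1 X) (Sh D 1 A)"
      "ShA D 1 u \<cdot> Neg D (ShA D 1 (Idt D X)) = Neg D (ShA D 1 f) \<cdot> c"
    using TR3[OF et_rotate[OF et_Idt[OF X Z]] et_rotate[OF assms(1)] assms(2)
        Zro_in[OF zero_Obj[OF Z] H(3)] e] by blast
  note u1 = ShA_in[OF assms(2), of 1]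
  have "Neg D (ShA D 1 u) = Neg D (ShA D 1 f \<cdot> c)"
    using c(2) Cmp_Neg[OF id1 u1] Neg_Cmp[OF c(1) ShA_in[OF H(4)]] ShA_Idt[OF X] Cmp_Idt[OF u1]
    by simp
  then have "ShA D 1 u = ShA D 1 f \<cdot> c"
    using Neg_Neg[OF u1] Neg_Neg[OF Cmp_in[OF c(1) ShA_in[OF H(4)]]] by metis
  then have "u = ShA D (-1) (ShA D 1 f \<cdot> c)" using ShA_ShA_inv(2)[OF assms(2)] by simp
  also have "\<dots> = f \<cdot> ShA D (-1) c"
    using ShA_Cmp[OF c(1) ShA_in[OF H(4)], of "-1"] ShA_ShA_inv(2)[OF H(4)] by simp
  finally show thesis using that[of "ShA D (-1) c"] ShA_in[OF c(1), of "-1"] X H(1) by simp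
qed

text \<open>
  By exactness of the rotated triangle, a morphism killed by \<open>f\<close> factors through \<open>C[-1]\<close>.
\<close>

lemma et_mono:
  assumes "exact_triangle D A B C f g h" "u \<in> Hom D X A" "f \<cdot> u = Zro D X B"
    "hom_zero D X (Sh D (-1) C)"
  shows "u = Zro D X A"
proof -
  note H = et_Hom[OF assms(1)]
  have X: "X \<in> Obj D" using assms(2) Hom_Obj by blast
  obtain k where k: "exact_triangle D (Sh D (-1) C) A B k f g"
    using et_rotate_back[OF assms(1)] .
  obtain v where v: "v \<in> Hom D X (Sh D (-1) C)" "k \<cdot> v = u"
    using et_lift[OF k assms(2,3)] .
  then show ?thesis using hom_zeroD[OF assms(4) v(1)] Cmp_Zro[OF et_Hom(4)[OF k] X] by simp
qed

lemma et_epi: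
  assumes "exact_triangle D A B C f g h" "u \<in> Hom D C X" "u \<cdot> g = Zro D B X"
    "hom_zero D (Sh D 1 A) X"
  shows "u = Zro D C X"
proof -
  note H = et_Hom[OF assms(1)]
  have X: "X \<in> Obj D" using assms(2) Hom_Obj by blast
  obtain v where v: "v \<in> Hom D (Sh D 1 A) X" "v \<cdot> h = u"
    using et_factor[OF et_rotate[OF assms(1)] assms(2,3)] .
  then show ?thesis using hom_zeroD[OF assms(4) v(1)] Zro_Cmp[OF H(6) X] by simp
qed

lemma Sub_mono:
  assumes "exact_triangle D A B C f g h" "u \<in> Hom D X A" "v \<in> Hom D X A" "f \<cdot> u = f \<cdot> v"
    "hom_zero D X (Sh D (-1) C)"
  shows "u = v"
proof -
  note H = et_Hom[OF assms(1)]
  have "f \<cdot> (u \<boxplus> Neg D v) = Zro D X B"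
    using Cmp_Add_right[OF assms(2) Neg_in[OF assms(3)] H(4)] Cmp_Neg[OF assms(3) H(4)]
      Add_Neg[OF Cmp_in[OF assms(3) H(4)]] assms(4) by simp
  then have "u \<boxplus> Neg D v = Zro D X A"
    using et_mono[OF assms(1) Add_in[OF assms(2) Neg_in[OF assms(3)]] _ assms(5)] by blast
  then show ?thesis using Sub_eq_Zro assms by blast
qed

lemma Sub_epi:
  assumes "exact_triangle D A B C f g h" "u \<in> Hom D C X" "v \<in> Hom D C X" "u \<cdot> g = v \<cdot> g"
    "hom_zero D (Sh D 1 A) X"
  shows "u = v"
proof -
  note H = et_Hom[OF assms(1)]
  have "(u \<boxplus> Neg D v) \<cdot> g = Zro D B X"
    using Cmp_Add_left[OF H(5) assms(2) Neg_in[OF assms(3)]] Neg_Cmp[OF H(5) assms(3)]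
      Add_Neg[OF Cmp_in[OF H(5) assms(3)]] assms(4) by simp
  then have "u \<boxplus> Neg D v = Zro D C X"
    using et_epi[OF assms(1) Add_in[OF assms(2) Neg_in[OF assms(3)]] _ assms(5)] by blast
  then show ?thesis using Sub_eq_Zro assms by blast
qed

subsection \<open>Extensions up to isomorphism\<close>

text \<open>
  Most arguments only use that \<open>B\<close> is an extension of \<open>C\<close> by \<open>A\<close>, for some choice of morphisms. In these
  terms the octahedral axiom is the associativity of extensions.
\<close>

lemma fits_Obj:
  assumes "fits_triangle D A B C" shows "A \<in> Obj D" "B \<in> Obj D" "C \<in> Obj D"
  using assms et_Hom unfolding fits_triangle_def by blast+

lemma fitsI: "exact_triangle D A B C f g h \<Longrightarrow> fits_triangle D A B C"
  by (auto simp: fits_triangle_def)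

lemma fits_rotate: "fits_triangle D A B C \<Longrightarrow> fits_triangle D B C (Sh D 1 A)"
  using et_rotate unfolding fits_triangle_def by blast

lemma fits_rotate_back: "fits_triangle D A B C \<Longrightarrow> fits_triangle D (Sh D (-1) C) A B"
  using et_rotate_back unfolding fits_triangle_def by metis

lemma fits_Sh: "fits_triangle D A B C \<Longrightarrow> fits_triangle D (Sh D 1 A) (Sh D 1 B) (Sh D 1 C)"
  by (intro fits_rotate)

lemma fits_Sh_back:
  "fits_triangle D A B C \<Longrightarrow> fits_triangle D (Sh D (-1) A) (Sh D (-1) B) (Sh D (-1) C)"
  by (intro fits_rotate_back)

lemma fits_iso:
  assumes "fits_triangle D A B C" "isomorphic D A A'" "isomorphic D B B'" "isomorphic D C C'"
  shows "fits_triangle D A' B' C'"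
proof -
  obtain f g h where e: "exact_triangle D A B C f g h" using assms(1) by (auto simp: fits_triangle_def)
  note H = et_Hom[OF e]
  obtain a where a0: "iso_arr D A A' a" using assms(2) by (auto simp: isomorphic_def)
  obtain b where b0: "iso_arr D B B' b" using assms(3) by (auto simp: isomorphic_def)
  obtain c where c0: "iso_arr D C C' c" using assms(4) by (auto simp: isomorphic_def)
  obtain a' where a: "a \<in> Hom D A A'" "a' \<in> Hom D A' A" "a' \<cdot> a = Idt D A" using a0 by (auto simp: iso_arr_def)
  obtain b' where b: "b \<in> Hom D B B'" "b' \<in> Hom D B' B" "b' \<cdot> b = Idt D B" using b0 by (auto simp: iso_arr_def)
  obtain c' where c: "c \<in> Hom D C C'" "c' \<in> Hom D C' C" "c' \<cdot> c = Idt D C" using c0 by (auto simp: iso_arr_def)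
  note a1 = ShA_in[OF a(1), of 1]
  let ?f = "(b \<cdot> f) \<cdot> a'" and ?g = "(c \<cdot> g) \<cdot> b'" and ?h = "(ShA D 1 a \<cdot> h) \<cdot> c'"
  have bf: "b \<cdot> f \<in> Hom D A B'" and cg: "c \<cdot> g \<in> Hom D B C'" and ah: "ShA D 1 a \<cdot> h \<in> Hom D C (Sh D 1 A')"
    using Cmp_in H a1 b c by blast+
  have t: "triangle D A' B' C' ?f ?g ?h"
    using Cmp_in[OF a(2) bf] Cmp_in[OF b(2) cg] Cmp_in[OF c(2) ah] Hom_Obj a b c
    unfolding triangle_def by blast
  have "b \<cdot> f = ?f \<cdot> a" using Cmp_assoc[OF a(1,2) bf] a(3) Cmp_Idt[OF bf] by simp
  moreover have "c \<cdot> g = ?g \<cdot> b" using Cmp_assoc[OF b(1,2) cg] b(3) Cmp_Idt[OF cg] by simp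
  moreover have "ShA D 1 a \<cdot> h = ?h \<cdot> c" using Cmp_assoc[OF c(1,2) ah] c(3) Cmp_Idt[OF ah] by simp
  ultimately have "(?f, ?g, ?h) \<in> Tri D" using TR1_iso[OF e t a0 b0 c0] by blast
  then show ?thesis using t unfolding fits_triangle_def exact_triangle_def by blast
qed

lemma fits_zero_right:
  assumes "isomorphic D A B" "zero_object D X" shows "fits_triangle D A B X"
proof -
  have A: "A \<in> Obj D" using assms isomorphic_Obj by blast
  show ?thesis
    using fits_iso[OF fitsI[OF et_Idt[OF A assms(2)]] isomorphic_refl[OF A] assms(1)
        isomorphic_refl[OF zero_Obj[OF assms(2)]]] .
qed

lemma fits_zero_left:
  assumes "isomorphic D A B" "zero_object D X" shows "fits_triangle D X A B"
  using fits_iso[OF fits_rotate_back[OF fits_zero_right[OF assms]]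
      zero_objects_isomorphic[OF zero_object_Sh[OF assms(2)] assms(2)]
      isomorphic_refl isomorphic_refl] isomorphic_Obj[OF assms(1)] by blast

lemma zero_right_iso:
  assumes "fits_triangle D A B C" "zero_object D C" shows "isomorphic D A B"
proof -
  obtain f g h where e: "exact_triangle D A B C f g h" using assms(1) by (auto simp: fits_triangle_def)
  note H = et_Hom[OF e]
  have "g \<cdot> Idt D B = Zro D B C" using Cmp_Idt[OF H(5)] hom_zeroD[OF zero_hom_zero(1)[OF assms(2) H(2)] H(5)] by simp
  then obtain r where r: "r \<in> Hom D B A" "f \<cdot> r = Idt D B" using et_lift[OF e Idt_in[OF H(2)]] by blast
  have "f \<cdot> (r \<cdot> f) = f \<cdot> Idt D A"
    using Cmp_assoc[OF H(4) r(1) H(4)] r(2) Idt_Cmp[OF H(4)] Cmp_Idt[OF H(4)] by simp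
  then have "r \<cdot> f = Idt D A"
    using Sub_mono[OF e Cmp_in[OF H(4) r(1)] Idt_in[OF H(1)]] zero_hom_zero(1)[OF zero_object_Sh[OF assms(2)] H(1)]
    by blast
  then show ?thesis using isomorphicI H(4) r by blast
qed

lemma zero_left_iso:
  assumes "fits_triangle D A B C" "zero_object D A" shows "isomorphic D B C"
  using zero_right_iso[OF fits_rotate[OF assms(1)] zero_object_Sh[OF assms(2)]] .

lemma fits_hom_zero_right:
  assumes "fits_triangle D A E C" "hom_zero D X A" "hom_zero D X C" shows "hom_zero D X E"
proof (rule hom_zeroI)
  obtain f g h where e: "exact_triangle D A E C f g h" using assms(1) by (auto simp: fits_triangle_def)
  note H = et_Hom[OF e]
  show X: "X \<in> Obj D" using hom_zero_Obj assms by blast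
  show "E \<in> Obj D" using H by blast
  fix u assume u: "u \<in> Hom D X E"
  have "g \<cdot> u = Zro D X C" using hom_zeroD[OF assms(3)] Cmp_in[OF u H(5)] by blast
  then obtain v where v: "v \<in> Hom D X A" "f \<cdot> v = u" using et_lift[OF e u] by blast
  then show "u = Zro D X E" using hom_zeroD[OF assms(2)] Cmp_Zro[OF H(4) X] by metis
qed

lemma fits_hom_zero_left:
  assumes "fits_triangle D A E C" "hom_zero D A X" "hom_zero D C X" shows "hom_zero D E X"
proof (rule hom_zeroI)
  obtain f g h where e: "exact_triangle D A E C f g h" using assms(1) by (auto simp: fits_triangle_def)
  note H = et_Hom[OF e]
  show X: "X \<in> Obj D" using hom_zero_Obj assms by blast
  show "E \<in> Obj D" using H by blast
  fix u assume u: "u \<in> Hom D E X"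
  have "u \<cdot> f = Zro D A X" using hom_zeroD[OF assms(2)] Cmp_in[OF H(4) u] by blast
  then obtain v where v: "v \<in> Hom D C X" "v \<cdot> g = u" using et_factor[OF e u] by blast
  then show "u = Zro D E X" using hom_zeroD[OF assms(3)] Zro_Cmp[OF H(5) X] by metis
qed

lemma cone_exists:
  assumes "f \<in> Hom D A B" obtains C g h where "exact_triangle D A B C f g h"
proof -
  obtain g h where t: "(f, g, h) \<in> Tri D" using TR1_cone[OF Hom_Arr[OF assms]] by blast
  then obtain A' B' C' where tr: "triangle D A' B' C' f g h" using Tri_triangle by blast
  then have "A' = A" "B' = B" using assms by (auto simp: triangle_def Hom_def)
  then show thesis using that t tr unfolding exact_triangle_def by blast
qed

text \<open>
  The octahedral axiom with the subobject \<open>A\<close> of the subobject \<open>X\<close> of \<open>E\<close>: \<open>W\<close> plays the role of \<open>E / A\<close>.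
\<close>

lemma fits_assoc_left:
  assumes "fits_triangle D A X C" "fits_triangle D X E Y"
  obtains W where "fits_triangle D A E W" "fits_triangle D C W Y"
proof -
  obtain f g h where e: "exact_triangle D A X C f g h" using assms(1) by (auto simp: fits_triangle_def)
  obtain f' g' h' where e': "exact_triangle D X E Y f' g' h'" using assms(2) by (auto simp: fits_triangle_def)
  have c: "f' \<cdot> f \<in> Hom D A E" using Cmp_in et_Hom(4) e e' by blast
  obtain W j j' where w: "exact_triangle D A E W (f' \<cdot> f) j j'" using cone_exists[OF c] .
  show thesis using that fitsI w TR4[OF e e' w] by metis
qed

text \<open>
  The same axiom, rotated: \<open>W\<close> plays the role of the preimage in \<open>E\<close> of the subobject \<open>F\<close> of \<open>Y\<close>.
\<close>

lemma fits_assoc_right: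
  assumes "fits_triangle D X E Y" "fits_triangle D F Y A"
  obtains W where "fits_triangle D W E A" "fits_triangle D X W F"
proof -
  obtain Z where Z: "fits_triangle D E A Z" "fits_triangle D (Sh D 1 X) Z (Sh D 1 F)"
    using fits_assoc_left[OF fits_rotate[OF assms(1)] fits_rotate[OF assms(2)]] .
  have "fits_triangle D X (Sh D (-1) Z) F"
    using fits_Sh_back[OF Z(2)] fits_Obj assms by simp
  then show thesis using that fits_rotate_back[OF Z(1)] by blast
qed

text \<open>
  Image factorization: if \<open>Y \<rightarrow> C \<rightarrow> Q\<close> truncates the cone of \<open>f : X \<rightarrow> E\<close>, then the fibre \<open>I\<close> of
  \<open>E \<rightarrow> C \<rightarrow> Q\<close> is an image of \<open>f\<close>, with cokernel \<open>Q\<close> and kernel \<open>Y[-1]\<close>. That \<open>f\<close> factors through \<open>I\<close> is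
  recorded in the only form in which it is used.
\<close>

lemma fits_factor:
  assumes "exact_triangle D X E C f g h" "fits_triangle D Y C Q"
  obtains I where "fits_triangle D X I Y" "fits_triangle D I E Q"
    "zero_object D I \<Longrightarrow> f = Zro D X E"
proof -
  note H = et_Hom[OF assms(1)]
  obtain a b b' where e2: "exact_triangle D Y C Q a b b'" using assms(2) by (auto simp: fits_triangle_def)
  note H2 = et_Hom[OF e2]
  have bg: "b \<cdot> g \<in> Hom D E Q" using Cmp_in[OF H(5) H2(5)] .
  obtain W j j' where w: "exact_triangle D E Q W (b \<cdot> g) j j'" using cone_exists[OF bg] .
  have W: "fits_triangle D (Sh D 1 X) W (Sh D 1 Y)"
    using TR4[OF et_rotate[OF assms(1)] et_rotate[OF e2] w] fitsI by blast
  obtain k where k: "exact_triangle D (Sh D (-1) W) E Q k (b \<cdot> g) j" using et_rotate_back[OF w] .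
  have 1: "fits_triangle D X (Sh D (-1) W) Y" using fits_Sh_back[OF W] H(1) H2(1) by simp
  have "(b \<cdot> g) \<cdot> f = Zro D X Q"
    using Cmp_assoc[OF H(4,5) H2(5)] et_comp_zero[OF assms(1)] Cmp_Zro[OF H2(5) H(1)] by simp
  then obtain v where v: "v \<in> Hom D X (Sh D (-1) W)" "k \<cdot> v = f" using et_lift[OF k H(4)] by blast
  have "f = Zro D X E" if "zero_object D (Sh D (-1) W)"
    using hom_zeroD[OF zero_hom_zero(1)[OF that H(1)] v(1)] v(2) Cmp_Zro[OF et_Hom(4)[OF k] H(1)] by simp
  then show thesis using that[OF 1 fitsI[OF k]] by blast
qed

subsection \<open>Split extensions\<close>

lemma biproduct_sym:
  assumes "biproduct D A B X" "A \<in> Obj D" "B \<in> Obj D" shows "biproduct D B A X"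
proof -
  obtain i j p q where "i\<in>Hom D A X" "j\<in>Hom D B X" "p\<in>Hom D X A" "q\<in>Hom D X B"
        "p \<cdot> i = Idt D A" "q \<cdot> j = Idt D B" "p \<cdot> j = Zro D B A" "q \<cdot> i = Zro D A B"
        "(i \<cdot> p) \<boxplus> (j \<cdot> q) = Idt D X" using assms(1) unfolding biproduct_def by blast
  moreover then have "(j \<cdot> q) \<boxplus> (i \<cdot> p) = Idt D X" using Add_commute Cmp_in by metis
  ultimately show ?thesis using assms(1) unfolding biproduct_def by blast
qed

lemma biproduct_fits:
  assumes "biproduct D A B X" shows "fits_triangle D A X B"
proof -
  obtain i j p q where H: "i\<in>Hom D A X" "j\<in>Hom D B X" "p\<in>Hom D X A" "q\<in>Hom D X B"
      and E: "p \<cdot> i = Idt D A" "q \<cdot> j = Idt D B" "q \<cdot> i = Zro D A B"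
        "(i \<cdot> p) \<boxplus> (j \<cdot> q) = Idt D X" using assms(1) unfolding biproduct_def by blast
  have ob: "A \<in> Obj D" "B \<in> Obj D" "X \<in> Obj D" using H Hom_Obj by blast+
  obtain C g h where e: "exact_triangle D A X C i g h" using cone_exists[OF H(1)] .
  note T = et_Hom[OF e]
  \<comment> \<open>the connecting morphism of a split monomorphism vanishes\<close>
  have "Neg D (ShA D 1 i) \<cdot> h = Zro D C (Sh D 1 X)" using et_comp_zero[OF et_rotate[OF et_rotate[OF e]]] .
  then have ih: "ShA D 1 i \<cdot> h = Zro D C (Sh D 1 X)"
    using Neg_Cmp[OF T(6) ShA_in[OF H(1)]] Neg_Neg[OF Cmp_in[OF T(6) ShA_in[OF H(1)]]]
      Add_Neg[OF Cmp_in[OF T(6) ShA_in[OF H(1)]]] Add_Zro[OF Cmp_in[OF T(6) ShA_in[OF H(1)]]]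
    by simp
  have "h = (ShA D 1 p \<cdot> ShA D 1 i) \<cdot> h"
    using ShA_Cmp[OF H(1,3), of 1] E(1) ShA_Idt[OF ob(1)] Idt_Cmp[OF T(6)] by simp
  also have "\<dots> = Zro D C (Sh D 1 A)"
    using Cmp_assoc[OF T(6) ShA_in[OF H(1)] ShA_in[OF H(3)]] ih Cmp_Zro[OF ShA_in[OF H(3)] T(3)] by simp
  finally have h0: "h = Zro D C (Sh D 1 A)" .
  obtain w where w: "w \<in> Hom D C B" "w \<cdot> g = q" using et_factor[OF e H(4) E(3)] .
  have gj: "g \<cdot> j \<in> Hom D B C" using Cmp_in H T by blast
  have wgj: "w \<cdot> (g \<cdot> j) = Idt D B" using Cmp_assoc[OF H(2) T(5) w(1)] w(2) E(2) by simp
  have "g = g \<cdot> ((i \<cdot> p) \<boxplus> (j \<cdot> q))" using E(4) Cmp_Idt[OF T(5)] by simp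
  also have "\<dots> = (g \<cdot> (i \<cdot> p)) \<boxplus> (g \<cdot> (j \<cdot> q))"
    using Cmp_Add_right[OF Cmp_in[OF H(3) H(1)] Cmp_in[OF H(4) H(2)] T(5)] .
  also have "g \<cdot> (i \<cdot> p) = Zro D X C"
    using Cmp_assoc[OF H(3) H(1) T(5)] et_comp_zero[OF e] Zro_Cmp[OF H(3) T(3)] by simp
  also have "Zro D X C \<boxplus> (g \<cdot> (j \<cdot> q)) = g \<cdot> (j \<cdot> q)"
    using Zro_Add Cmp_in H T by blast
  also have "\<dots> = (g \<cdot> j) \<cdot> (w \<cdot> g)" using Cmp_assoc[OF H(4) H(2) T(5)] w(2) by simp
  also have "\<dots> = ((g \<cdot> j) \<cdot> w) \<cdot> g" using Cmp_assoc[OF T(5) w(1) gj] by simp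
  finally have g: "((g \<cdot> j) \<cdot> w) \<cdot> g = g" by simp
  have gw: "(g \<cdot> j) \<cdot> w \<in> Hom D C C" using Cmp_in gj w by blast
  let ?u = "((g \<cdot> j) \<cdot> w) \<boxplus> Neg D (Idt D C)"
  have u: "?u \<in> Hom D C C" using Add_in[OF gw Neg_in[OF Idt_in[OF T(3)]]] .
  have "?u \<cdot> g = Zro D X C"
    using Cmp_Add_left[OF T(5) gw Neg_in[OF Idt_in[OF T(3)]]] g Neg_Cmp[OF T(5) Idt_in[OF T(3)]]
      Idt_Cmp[OF T(5)] Add_Neg[OF T(5)] by simp
  then obtain v where v: "v \<in> Hom D (Sh D 1 A) C" "v \<cdot> h = ?u"
    using et_factor[OF et_rotate[OF e] u] by blast
  then have "?u = Zro D C C" using h0 Cmp_Zro[OF v(1) T(3)] by simp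
  then have "(g \<cdot> j) \<cdot> w = Idt D C" using Sub_eq_Zro[OF gw Idt_in[OF T(3)]] by blast
  then have "isomorphic D C B" using isomorphicI w(1) gj wgj by blast
  then show ?thesis
    using fits_iso[OF fitsI[OF e]] isomorphic_refl ob by blast
qed

text \<open>
  An extension whose connecting morphism lies in a vanishing group is split, so that its outer terms
  may be exchanged.
\<close>

lemma fits_swap:
  assumes "fits_triangle D A E C" "hom_zero D C (Sh D 1 A)" shows "fits_triangle D C E A"
proof -
  obtain f g h where e: "exact_triangle D A E C f g h" using assms(1) by (auto simp: fits_triangle_def)
  note H = et_Hom[OF e]
  have h0: "h = Zro D C (Sh D 1 A)" using hom_zeroD[OF assms(2) H(6)] .
  have "h \<cdot> Idt D C = Zro D C (Sh D 1 A)" using Cmp_Idt[OF H(6)] h0 by simp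
  then obtain s where s: "s \<in> Hom D C E" "g \<cdot> s = Idt D C"
    using et_lift[OF et_rotate[OF e] Idt_in[OF H(3)]] by blast
  have sg: "s \<cdot> g \<in> Hom D E E" using Cmp_in s H by blast
  let ?r = "Idt D E \<boxplus> Neg D (s \<cdot> g)"
  note idE = Idt_in[OF H(2)]
  have r: "?r \<in> Hom D E E" using Add_in[OF idE Neg_in[OF sg]] .
  have "g \<cdot> ?r = Zro D E C"
    using Cmp_Add_right[OF idE Neg_in[OF sg] H(5)] Cmp_Neg[OF sg H(5)]
      Cmp_assoc[OF H(5) s(1) H(5)] s(2) Idt_Cmp[OF H(5)] Cmp_Idt[OF H(5)] Add_Neg[OF H(5)] by simp
  then obtain p where p: "p \<in> Hom D E A" "f \<cdot> p = ?r" using et_lift[OF e r] by blast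
  \<comment> \<open>\<open>f\<close> is a monomorphism because the connecting morphism \<open>C[-1] \<rightarrow> A\<close> vanishes\<close>
  have f_inj: "u = v" if "u \<in> Hom D X A" "v \<in> Hom D X A" "f \<cdot> u = f \<cdot> v" for u v X
  proof -
    have X: "X \<in> Obj D" using that Hom_Obj by blast
    let ?d = "u \<boxplus> Neg D v"
    have d: "?d \<in> Hom D X A" using Add_in Neg_in that by blast
    have fd: "f \<cdot> ?d = Zro D X E"
      using Cmp_Add_right[OF that(1) Neg_in[OF that(2)] H(4)] Cmp_Neg[OF that(2) H(4)] that(3)
        Add_Neg[OF Cmp_in[OF that(2) H(4)]] by simp
    obtain k where k: "exact_triangle D (Sh D (-1) C) A E k f g" using et_rotate_back[OF e] .
    have "hom_zero D (Sh D (-1) C) A" using hom_zero_Sh[OF assms(2), of "-1"] H(1) by simp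
    then have "k = Zro D (Sh D (-1) C) A" using hom_zeroD et_Hom(4)[OF k] by blast
    moreover obtain w where "w \<in> Hom D X (Sh D (-1) C)" "k \<cdot> w = ?d" using et_lift[OF k d fd] .
    ultimately have "?d = Zro D X A" using Zro_Cmp H(1) by metis
    then show ?thesis using Sub_eq_Zro that by blast
  qed
  have gf: "g \<cdot> f = Zro D A C" using et_comp_zero[OF e] .
  have fpf: "f \<cdot> (p \<cdot> f) = f"
    using Cmp_assoc[OF H(4) p(1) H(4)] p(2) Cmp_Add_left[OF H(4) idE Neg_in[OF sg]]
      Neg_Cmp[OF H(4) sg] Cmp_assoc[OF H(4) H(5) s(1)] gf Cmp_Zro[OF s(1) H(1)] Idt_Cmp[OF H(4)]
      Add_Neg[OF Zro_in[OF H(1,2)]] Zro_Add[OF Neg_in[OF Zro_in[OF H(1,2)]]] Add_Zro[OF H(4)]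
    by simp
  have pf: "p \<cdot> f = Idt D A"
    using f_inj[OF Cmp_in[OF H(4) p(1)] Idt_in[OF H(1)]] fpf Cmp_Idt[OF H(4)] by simp
  have "f \<cdot> (p \<cdot> s) = Zro D C E"
    using Cmp_assoc[OF s(1) p(1) H(4)] p(2) Cmp_Add_left[OF s(1) idE Neg_in[OF sg]]
      Neg_Cmp[OF s(1) sg] Cmp_assoc[OF s(1) H(5) s(1)] s(2) Cmp_Idt[OF s(1)] Idt_Cmp[OF s(1)]
      Add_Neg[OF s(1)] by simp
  then have ps: "p \<cdot> s = Zro D C A"
    using f_inj[OF Cmp_in[OF s(1) p(1)] Zro_in[OF H(3,1)]] Cmp_Zro[OF H(4,3)] by simp
  have "(f \<cdot> p) \<boxplus> (s \<cdot> g) = Idt D E"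
    using p(2) Add_assoc[OF idE Neg_in[OF sg] sg] Add_commute[OF Neg_in[OF sg] sg] Add_Neg[OF sg]
      Add_Zro[OF idE] by simp
  then have "biproduct D A C E"
    unfolding biproduct_def using H(2) H(4) s p(1) H(5) pf ps gf by blast
  then show ?thesis using biproduct_fits biproduct_sym H(1,3) by blast
qed

text \<open>
  Extensions of extensions: reassociating \<open>(A\<^sub>2 * A\<^sub>1) * (C\<^sub>2 * C\<^sub>1)\<close> brings \<open>A\<^sub>1\<close> and \<open>C\<^sub>2\<close> together. Their
  extension splits, so they can be exchanged, and regrouping gives \<open>(A\<^sub>2 * C\<^sub>2) * (A\<^sub>1 * C\<^sub>1)\<close>. This gives
  both the exactness of \<open>\<lambda>\<^sub>1\<close> and \<open>\<rho>\<^sub>2\<close> on objects and the truncations of the glued t-structures.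
\<close>

lemma fits_merge:
  assumes "fits_triangle D A B C" "fits_triangle D A\<^sub>2 A A\<^sub>1" "fits_triangle D C\<^sub>2 C C\<^sub>1"
    "hom_zero D C\<^sub>2 (Sh D 1 A\<^sub>1)"
  obtains B\<^sub>2 B\<^sub>1 where "fits_triangle D B\<^sub>2 B B\<^sub>1" "fits_triangle D A\<^sub>2 B\<^sub>2 C\<^sub>2" "fits_triangle D A\<^sub>1 B\<^sub>1 C\<^sub>1"
proof -
  obtain W where W: "fits_triangle D W B C\<^sub>1" "fits_triangle D A W C\<^sub>2"
    using fits_assoc_right[OF assms(1,3)] .
  obtain W' where W': "fits_triangle D A\<^sub>2 W W'" "fits_triangle D A\<^sub>1 W' C\<^sub>2"
    using fits_assoc_left[OF assms(2) W(2)] .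
  obtain B\<^sub>2 where B2: "fits_triangle D B\<^sub>2 W A\<^sub>1" "fits_triangle D A\<^sub>2 B\<^sub>2 C\<^sub>2"
    using fits_assoc_right[OF W'(1) fits_swap[OF W'(2) assms(4)]] .
  show thesis using fits_assoc_left[OF B2(1) W(1)] that B2(2) by blast
qed

lemma truncation_unique:
  assumes "fits_triangle D A E C" "fits_triangle D A' E C'"
    "hom_zero D A C'" "hom_zero D A' C"
    "hom_zero D A (Sh D (-1) C)" "hom_zero D A' (Sh D (-1) C')"
  shows "isomorphic D A A'" "isomorphic D C C'"
proof -
  obtain f g h where e: "exact_triangle D A E C f g h" using assms(1) by (auto simp: fits_triangle_def)
  obtain f' g' h' where e': "exact_triangle D A' E C' f' g' h'" using assms(2) by (auto simp: fits_triangle_def)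
  note H = et_Hom[OF e] and H' = et_Hom[OF e']
  have "g' \<cdot> f = Zro D A C'" using hom_zeroD[OF assms(3)] Cmp_in[OF H(4) H'(5)] by blast
  then obtain u c where u: "u \<in> Hom D A A'" "f' \<cdot> u = f" and c: "c \<in> Hom D C C'" "c \<cdot> g = g'"
    using et_lift[OF e' H(4)] et_factor[OF e H'(5)] by metis
  have "g \<cdot> f' = Zro D A' C" using hom_zeroD[OF assms(4)] Cmp_in[OF H'(4) H(5)] by blast
  then obtain u' c' where u': "u' \<in> Hom D A' A" "f \<cdot> u' = f'" and c': "c' \<in> Hom D C' C" "c' \<cdot> g' = g"
    using et_lift[OF e H'(4)] et_factor[OF e' H(5)] by metis
  have "f \<cdot> (u' \<cdot> u) = f \<cdot> Idt D A" "f' \<cdot> (u \<cdot> u') = f' \<cdot> Idt D A'"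
    using Cmp_assoc[OF u(1) u'(1) H(4)] Cmp_assoc[OF u'(1) u(1) H'(4)] u u' Cmp_Idt H(4) H'(4) by simp_all
  then have "u' \<cdot> u = Idt D A" "u \<cdot> u' = Idt D A'"
    using Sub_mono[OF e Cmp_in[OF u(1) u'(1)] Idt_in[OF H(1)] _ assms(5)]
      Sub_mono[OF e' Cmp_in[OF u'(1) u(1)] Idt_in[OF H'(1)] _ assms(6)] by auto
  then show "isomorphic D A A'" using isomorphicI u u' by blast
  have hz: "hom_zero D (Sh D 1 A) C" "hom_zero D (Sh D 1 A') C'"
    using hom_zero_Sh[OF assms(5), of 1] hom_zero_Sh[OF assms(6), of 1] H(3) H'(3) by simp_all
  have "(c' \<cdot> c) \<cdot> g = Idt D C \<cdot> g" "(c \<cdot> c') \<cdot> g' = Idt D C' \<cdot> g'"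
    using Cmp_assoc[OF H(5) c(1) c'(1)] Cmp_assoc[OF H'(5) c'(1) c(1)] c c' Idt_Cmp H(5) H'(5) by simp_all
  then have "c' \<cdot> c = Idt D C" "c \<cdot> c' = Idt D C'"
    using Sub_epi[OF e Cmp_in[OF c(1) c'(1)] Idt_in[OF H(3)] _ hz(1)]
      Sub_epi[OF e' Cmp_in[OF c'(1) c(1)] Idt_in[OF H'(3)] _ hz(2)] by auto
  then show "isomorphic D C C'" using isomorphicI c c' by blast
qed

end

section \<open>Extension closures, filtrations and full subcategories\<close>

subsection \<open>Extension closures\<close>

lemma ext_closure_minimal:
  assumes "S \<subseteq> T" "\<And>A B C. A \<in> T \<Longrightarrow> C \<in> T \<Longrightarrow> fits_triangle D A B C \<Longrightarrow> B \<in> T"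
  shows "ext_closure D S \<subseteq> T"
proof
  fix E assume "E \<in> ext_closure D S" then show "E \<in> T"
  proof induct
    case (base A) then show ?case using assms(1) by blast
  next
    case (ext A C B) then show ?case using assms(2) by blast
  qed
qed

lemma ext_closure_mono: "S \<subseteq> T \<Longrightarrow> ext_closure D S \<subseteq> ext_closure D T"
  by (rule ext_closure_minimal) (auto intro: ext_closure.intros)

context triangulated_category
begin

lemma ext_closure_Obj: "S \<subseteq> Obj D \<Longrightarrow> ext_closure D S \<subseteq> Obj D"
  by (rule ext_closure_minimal) (auto dest: fits_Obj)

lemma ext_closure_replete:
  assumes "S \<subseteq> Obj D" "\<exists>X\<in>S. zero_object D X"
  shows "replete D (ext_closure D S)"
  unfolding replete_def using ext_closure_Obj[OF assms(1)] assms(2) fits_zero_right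
  by (meson ext_closure.base ext_closure.ext)

lemma ext_closure_hom_zero:
  assumes "\<And>A B. A \<in> S \<Longrightarrow> B \<in> T \<Longrightarrow> hom_zero D A B"
    and "A \<in> ext_closure D S" "B \<in> ext_closure D T"
  shows "hom_zero D A B"
  using assms(3)
proof induct
  case (base B)
  show ?case using assms(2)
  proof induct
    case (ext A C E) then show ?case using fits_hom_zero_left by blast
  qed (use assms(1) base in blast)
next
  case (ext A C E) then show ?case using fits_hom_zero_right by blast
qed

lemma ext_closure_Sh:
  assumes "E \<in> ext_closure D S" "\<And>A. A \<in> S \<Longrightarrow> Sh D 1 A \<in> T"
  shows "Sh D 1 E \<in> ext_closure D T"
  using assms(1) by induct (use assms(2) fits_Sh ext_closure.intros in metis)+

lemma ext_closure_Sh_back: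
  assumes "E \<in> ext_closure D S" "\<And>A. A \<in> S \<Longrightarrow> Sh D (-1) A \<in> T"
  shows "Sh D (-1) E \<in> ext_closure D T"
  using assms(1) by induct (use assms(2) fits_Sh_back ext_closure.intros in metis)+

end

subsection \<open>Filtrations with prescribed phases\<close>

text \<open>
  The list holds the phases of the factors from the last one to the first one, so that it is
  increasing for a Harder-Narasimhan filtration; recursion then follows the length of the filtration.
\<close>

fun filtered :: "('o, 'm) tricat \<Rightarrow> (real \<Rightarrow> 'o set) \<Rightarrow> real list \<Rightarrow> 'o \<Rightarrow> bool" where
  "filtered D P [] E \<longleftrightarrow> zero_object D E"
| "filtered D P (\<phi> # l) E \<longleftrightarrow> (\<exists>F A. filtered D P l F \<and> A \<in> P \<phi> \<and> fits_triangle D F E A)"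

lemma HN_filtration_filtered:
  assumes "HN_filtration D P E n F A \<phi>"
  shows "filtered D P (rev (map \<phi> [0..<n])) E" "sorted_wrt (<) (rev (map \<phi> [0..<n]))"
proof -
  have "i \<le> n \<Longrightarrow> filtered D P (rev (map \<phi> [0..<i])) (F i)" for i
  proof (induct i)
    case 0 then show ?case using assms by (simp add: HN_filtration_def)
  next
    case (Suc i)
    then have "A i \<in> P (\<phi> i)" "fits_triangle D (F i) (F (Suc i)) (A i)"
      using assms by (auto simp: HN_filtration_def)
    then show ?case using Suc by auto
  qed
  then show "filtered D P (rev (map \<phi> [0..<n])) E" using assms by (auto simp: HN_filtration_def)
  show "sorted_wrt (<) (rev (map \<phi> [0..<n]))"
    using assms by (auto simp: HN_filtration_def sorted_wrt_rev sorted_wrt_map sorted_wrt_upt intro!: sorted_wrt_mono_rel[OF _ sorted_wrt_upt])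
qed

lemma filtered_HN_filtration:
  assumes "filtered D P l E" "sorted_wrt (<) l"
  shows "\<exists>F A \<phi>. HN_filtration D P E (length l) F A \<phi> \<and> (\<forall>i<length l. \<phi> i \<in> set l)"
  using assms
proof (induct l arbitrary: E)
  case Nil
  then show ?case by (intro exI[of _ "\<lambda>_. E"]) (auto simp: HN_filtration_def)
next
  case (Cons \<psi> l)
  obtain G B where G: "filtered D P l G" "B \<in> P \<psi>" "fits_triangle D G E B" using Cons.prems by auto
  obtain F A \<phi> where H: "HN_filtration D P G (length l) F A \<phi>" "\<forall>i<length l. \<phi> i \<in> set l"
    using Cons.hyps[OF G(1)] Cons.prems(2) by force
  let ?n = "length l"
  have "HN_filtration D P E (Suc ?n) (F(Suc ?n := E)) (A(?n := B)) (\<phi>(?n := \<psi>))"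
    using H G Cons.prems(2) unfolding HN_filtration_def by (auto simp: less_Suc_eq)
  moreover have "\<forall>i<Suc ?n. (\<phi>(?n := \<psi>)) i \<in> set (\<psi> # l)" using H(2) by (auto simp: less_Suc_eq)
  ultimately show ?case by (metis length_Cons)
qed

context triangulated_category
begin

lemma filtered_Obj: "filtered D P l E \<Longrightarrow> E \<in> Obj D"
  by (cases l) (auto simp: zero_Obj dest: fits_Obj)

lemma filtered_iso:
  assumes "filtered D P l E" "isomorphic D E E'" shows "filtered D P l E'"
proof (cases l)
  case Nil then show ?thesis using assms zero_object_iso by simp
next
  case (Cons \<phi> l')
  then obtain F A where F: "filtered D P l' F" "A \<in> P \<phi>" "fits_triangle D F E A"
    using assms(1) by auto
  have "fits_triangle D F E' A"
    using fits_iso[OF F(3) isomorphic_refl assms(2) isomorphic_refl] fits_Obj[OF F(3)] by blast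
  then show ?thesis using F Cons by auto
qed

text \<open>
  Filtrations of the outer terms of an extension concatenate, and conversely a filtration may be cut at
  any place.
\<close>

lemma filtered_append:
  assumes "filtered D P l Y" "filtered D P k X" "fits_triangle D X E Y"
  shows "filtered D P (l @ k) E"
  using assms
proof (induct l arbitrary: E Y)
  case Nil
  then show ?case using zero_right_iso filtered_iso by auto
next
  case (Cons \<phi> l)
  obtain F A where F: "filtered D P l F" "A \<in> P \<phi>" "fits_triangle D F Y A" using Cons.prems(1) by auto
  obtain W where "fits_triangle D W E A" "fits_triangle D X W F"
    using fits_assoc_right[OF Cons.prems(3) F(3)] .
  then show ?case using Cons.hyps[OF F(1) Cons.prems(2)] F(2) by auto
qed

lemma filtered_split:
  assumes "filtered D P (l @ k) E"
  obtains X Y where "fits_triangle D X E Y" "filtered D P l Y" "filtered D P k X"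
  using assms
proof (induct l arbitrary: E thesis)
  case Nil
  obtain Z where Z: "zero_object D Z" using zero_object_exists by blast
  have "E \<in> Obj D" using Nil filtered_Obj by simp
  then have "fits_triangle D E E Z" using fits_zero_right isomorphic_refl Z by blast
  then show ?case using Nil Z by auto
next
  case (Cons \<phi> l)
  obtain F A where F: "filtered D P (l @ k) F" "A \<in> P \<phi>" "fits_triangle D F E A"
    using Cons.prems(2) by auto
  obtain X Y where XY: "fits_triangle D X F Y" "filtered D P l Y" "filtered D P k X"
    using Cons.hyps[OF _ F(1)] by metis
  obtain W where W: "fits_triangle D X E W" "fits_triangle D Y W A"
    using fits_assoc_left[OF XY(1) F(3)] .
  show ?case using Cons.prems(1)[OF W(1) _ XY(3)] W(2) XY(2) F(2) by auto
qed

lemma filtered_ext_closure: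
  assumes "filtered D P l E" "set l \<subseteq> I" "I \<noteq> {}" "\<And>\<phi> X. zero_object D X \<Longrightarrow> X \<in> P \<phi>"
  shows "E \<in> ext_closure D (\<Union>\<phi>\<in>I. P \<phi>)"
  using assms(1,2)
proof (induct l arbitrary: E)
  case Nil
  then show ?case using assms(3,4) by (auto intro!: ext_closure.base)
next
  case (Cons \<phi> l)
  then obtain F A where F: "filtered D P l F" "A \<in> P \<phi>" "fits_triangle D F E A" by auto
  then have "A \<in> ext_closure D (\<Union>\<phi>\<in>I. P \<phi>)" using Cons by (auto intro: ext_closure.base)
  then show ?case using Cons F ext_closure.ext by (metis insert_subset list.simps(15))
qed

subsection \<open>Full triangulated subcategories\<close>

text \<open>
  Notions of a full subcategory \<open>S\<close> are translated to the ambient category \<open>D\<close>, so that all triangles are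
  formed in \<open>D\<close>.
\<close>

lemma sub_ext_closed:
  assumes "triangulated_subcategory D S" "A \<in> S" "C \<in> S" "fits_triangle D A B C"
  shows "B \<in> S"
  using assms fits_rotate_back[OF assms(4)] unfolding triangulated_subcategory_def by meson

lemma sub_Sh: "triangulated_subcategory D S \<Longrightarrow> A \<in> S \<Longrightarrow> Sh D n A \<in> S"
  unfolding triangulated_subcategory_def by blast

lemma sub_Obj: "triangulated_subcategory D S \<Longrightarrow> S \<subseteq> Obj D"
  unfolding triangulated_subcategory_def replete_def by blast

lemma full_subcat_simps [simp]:
  "Obj (full_subcat D S) = S" "Sh (full_subcat D S) = Sh D" "Zro (full_subcat D S) = Zro D"
  "Cmp (full_subcat D S) = Cmp D" "Idt (full_subcat D S) = Idt D"
  by (simp_all add: full_subcat_def)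

lemma Hom_full_subcat: "A \<in> S \<Longrightarrow> B \<in> S \<Longrightarrow> Hom (full_subcat D S) A B = Hom D A B"
  by (auto simp: Hom_def full_subcat_def)

lemma hom_zero_full_subcat:
  "A \<in> S \<Longrightarrow> B \<in> S \<Longrightarrow> hom_zero (full_subcat D S) A B \<longleftrightarrow> hom_zero D A B"
  by (simp add: hom_zero_def Hom_full_subcat)

lemma zero_object_full_subcat:
  assumes "S \<subseteq> Obj D" shows "zero_object (full_subcat D S) X \<longleftrightarrow> X \<in> S \<and> zero_object D X"
proof
  assume z: "zero_object (full_subcat D S) X"
  then have X: "X \<in> S" by (simp add: zero_object_def)
  then have "hom_zero D X X"
    using z hom_zero_full_subcat[of X S X] unfolding zero_object_def by simp
  then show "X \<in> S \<and> zero_object D X" using X zero_object_iff by blast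
next
  assume X: "X \<in> S \<and> zero_object D X"
  then have "hom_zero D A X \<and> hom_zero D X A" if "A \<in> S" for A
    using that assms zero_hom_zero by blast
  then show "zero_object (full_subcat D S) X"
    using X hom_zero_full_subcat[of X S] hom_zero_full_subcat[of _ S X]
    unfolding zero_object_def by simp
qed

lemma fits_full_subcat:
  assumes "S \<subseteq> Obj D" "\<And>A. A \<in> S \<Longrightarrow> Sh D 1 A \<in> S"
  shows "fits_triangle (full_subcat D S) A B C \<longleftrightarrow> A \<in> S \<and> B \<in> S \<and> C \<in> S \<and> fits_triangle D A B C"
proof -
  have "exact_triangle (full_subcat D S) A B C f g h \<longleftrightarrow>
      A \<in> S \<and> B \<in> S \<and> C \<in> S \<and> exact_triangle D A B C f g h" for f g h
  proof (cases "A \<in> S \<and> B \<in> S \<and> C \<in> S")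
    case True
    then have "A \<in> Obj D" "B \<in> Obj D" "C \<in> Obj D" "Sh D 1 A \<in> S" using assms by blast+
    moreover have "(f, g, h) \<in> Tri (full_subcat D S) \<longleftrightarrow> (f, g, h) \<in> Tri D"
      if "f \<in> Hom D A B" "g \<in> Hom D B C"
      using that True by (simp add: full_subcat_def Hom_def)
    ultimately show ?thesis
      using True unfolding exact_triangle_def triangle_def by (simp add: Hom_full_subcat) blast
  qed (simp add: exact_triangle_def triangle_def, blast)
  then show ?thesis unfolding fits_triangle_def by blast
qed

lemma replete_full_subcat:
  assumes "replete D S" "replete (full_subcat D S) T" shows "replete D T"
proof -
  have T: "T \<subseteq> S" using assms(2) by (simp add: replete_def)
  then have o: "T \<subseteq> Obj D" using assms(1) by (auto simp: replete_def)
  have "B \<in> T" if A: "A \<in> T" and i: "isomorphic D A B" for A B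
  proof -
    have AS: "A \<in> S" using A T by blast
    then have B: "B \<in> S" using replete_mem[OF assms(1) _ i] by blast
    then have "isomorphic (full_subcat D S) A B"
      using i AS by (auto simp: isomorphic_def iso_arr_def Hom_full_subcat)
    then show ?thesis using assms(2) A B by (auto simp: replete_def)
  qed
  then show ?thesis using o by (auto simp: replete_def)
qed

lemma ext_closure_full_subcat:
  assumes "triangulated_subcategory D S" "X \<subseteq> S"
  shows "ext_closure (full_subcat D S) X = ext_closure D X"
proof -
  have f: "fits_triangle (full_subcat D S) A B C \<longleftrightarrow> A \<in> S \<and> B \<in> S \<and> C \<in> S \<and> fits_triangle D A B C" for A B C
    using fits_full_subcat[OF sub_Obj[OF assms(1)]] sub_Sh[OF assms(1)] by blast
  have sub: "ext_closure D X \<subseteq> S"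
    by (rule ext_closure_minimal) (use assms sub_ext_closed in blast)+
  show ?thesis
  proof
    show "ext_closure (full_subcat D S) X \<subseteq> ext_closure D X"
      by (rule ext_closure_minimal) (auto intro: ext_closure.intros simp: f)
    have "ext_closure D X \<subseteq> ext_closure (full_subcat D S) X \<inter> S"
    proof (rule ext_closure_minimal)
      show "X \<subseteq> ext_closure (full_subcat D S) X \<inter> S"
        using assms(2) by (auto intro: ext_closure.base)
      fix A B C
      assume A: "A \<in> ext_closure (full_subcat D S) X \<inter> S" and C: "C \<in> ext_closure (full_subcat D S) X \<inter> S"
        and t: "fits_triangle D A B C"
      have B: "B \<in> S" using sub_ext_closed[OF assms(1) _ _ t] A C by blast
      then have "fits_triangle (full_subcat D S) A B C" using f t A C by simp
      then show "B \<in> ext_closure (full_subcat D S) X \<inter> S"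
        using ext_closure.ext[OF IntD1[OF A] IntD1[OF C]] B by simp
    qed
    then show "ext_closure D X \<subseteq> ext_closure (full_subcat D S) X" by blast
  qed
qed

lemma filtered_full_subcat:
  assumes "triangulated_subcategory D S" "filtered (full_subcat D S) P l E"
  shows "filtered D P l E"
proof -
  have f: "fits_triangle (full_subcat D S) A B C \<longleftrightarrow> A \<in> S \<and> B \<in> S \<and> C \<in> S \<and> fits_triangle D A B C"
     "zero_object (full_subcat D S) X \<longleftrightarrow> X \<in> S \<and> zero_object D X" for A B C X
    using fits_full_subcat[OF sub_Obj[OF assms(1)]] sub_Sh[OF assms(1)]
      zero_object_full_subcat[OF sub_Obj[OF assms(1)]] by blast+
  show ?thesis using assms(2) by (induct l arbitrary: E) (auto simp: f)
qed

end

section \<open>Additive functions and the Grothendieck group\<close>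

lemma comm_group_complex_group: "comm_group complex_group"
proof (rule comm_groupI)
  fix x assume "x \<in> carrier complex_group"
  show "\<exists>y\<in>carrier complex_group. y \<otimes>\<^bsub>complex_group\<^esub> x = \<one>\<^bsub>complex_group\<^esub>"
    by (rule bexI[of _ "- x"]) (auto simp: complex_group_def)
qed (auto simp: complex_group_def)

lemma K0_generators_carrier:
  "{frag_of B - frag_of A - frag_of C | A B C. fits_triangle D A B C} \<subseteq> carrier (free_Abelian_group (Obj D))"
proof -
  have "Poly_Mapping.keys (frag_of B - frag_of A - frag_of C) \<subseteq> Obj D"
    if "A \<in> Obj D" "B \<in> Obj D" "C \<in> Obj D" for A B C
    using that keys_diff[of "frag_of B - frag_of A" "frag_of C"] keys_diff[of "frag_of B" "frag_of A"]
    by fastforce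
  then show ?thesis
    by (auto simp: fits_triangle_def exact_triangle_def triangle_def simp del: carrier_free_Abelian_group_iff
        simp add: free_Abelian_group_def)
qed

lemma K0_relations_normal: "K0_relations D \<lhd> free_Abelian_group (Obj D)"
  unfolding K0_relations_def
  using comm_group.normal_iff_subgroup[OF abelian_free_Abelian_group]
    group.generate_is_subgroup[OF group_free_Abelian_group K0_generators_carrier] by blast

lemma Z_of_additive:
  assumes "charge \<sigma> \<in> hom (K0 D) complex_group" "fits_triangle D A B C"
  shows "Z_of D \<sigma> B = Z_of D \<sigma> A + Z_of D \<sigma> C"
proof -
  let ?G = "free_Abelian_group (Obj D)"
  have ob: "A \<in> Obj D" "B \<in> Obj D" "C \<in> Obj D"
    using assms(2) by (auto simp: fits_triangle_def exact_triangle_def triangle_def)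
  have car: "frag_of X \<in> carrier ?G" if "X \<in> Obj D" for X using that by simp
  have sub: "subgroup (K0_relations D) ?G" using K0_relations_normal normal_imp_subgroup by blast
  let ?r = "frag_of B - frag_of A - frag_of C"
  have r: "?r \<in> K0_relations D" unfolding K0_relations_def
    by (rule generate.incl) (use assms(2) in blast)
  have AC: "frag_of A + frag_of C \<in> carrier ?G"
    using monoid.m_closed[OF group.is_monoid[OF group_free_Abelian_group] car car, OF ob(1,3)]
    unfolding mult_free_Abelian_group .
  have "frag_of B = ?r \<otimes>\<^bsub>?G\<^esub> (frag_of A + frag_of C)" by simp
  then have "frag_of B \<in> K0_relations D #>\<^bsub>?G\<^esub> (frag_of A + frag_of C)"
    using r unfolding r_coset_def by blast
  then have "K0_relations D #>\<^bsub>?G\<^esub> (frag_of A + frag_of C) = K0_class D B"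
    unfolding K0_class_def using group.repr_independence[OF group_free_Abelian_group _ AC sub] by blast
  moreover have "K0_class D A \<otimes>\<^bsub>K0 D\<^esub> K0_class D C = K0_relations D #>\<^bsub>?G\<^esub> (frag_of A + frag_of C)"
    unfolding K0_def K0_class_def FactGroup_def
    using normal.rcos_sum[OF K0_relations_normal car[OF ob(1)] car[OF ob(3)]] by simp
  moreover have "K0_class D X \<in> carrier (K0 D)" if "X \<in> Obj D" for X
    unfolding K0_def K0_class_def FactGroup_def RCOSETS_def using car[OF that] by auto
  ultimately have "Z_of D \<sigma> B = charge \<sigma> (K0_class D A) \<otimes>\<^bsub>complex_group\<^esub> charge \<sigma> (K0_class D C)"
    using hom_mult[OF assms(1)] ob unfolding Z_of_def by metis
  then show ?thesis by (simp add: Z_of_def complex_group_def)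
qed

text \<open>
  The universal property of the Grothendieck group, for functions with values in the complex numbers.
\<close>

lemma additive_charge_exists:
  assumes "\<And>A B C. fits_triangle D A B C \<Longrightarrow> z B = z A + z C"
  obtains ch where "ch \<in> hom (K0 D) complex_group" "\<And>E. E \<in> Obj D \<Longrightarrow> ch (K0_class D E) = z E"
proof -
  let ?G = "free_Abelian_group (Obj D)"
  have "z ` Obj D \<subseteq> carrier complex_group" by (simp add: complex_group_def)
  then obtain h where h: "h \<in> hom ?G complex_group" "\<And>x. x \<in> Obj D \<Longrightarrow> h (frag_of x) = z x"
    using comm_group.free_Abelian_group_universal[OF comm_group_complex_group] by metis
  interpret gh: group_hom ?G complex_group h
    using h(1) comm_group.axioms(2)[OF comm_group_complex_group] by (simp add: group_hom_def group_hom_axioms_def)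
  have hadd: "h (x + y) = h x + h y" if "x \<in> carrier ?G" "y \<in> carrier ?G" for x y
    using hom_mult[OF h(1) that] by (simp add: complex_group_def)
  have car: "frag_of X \<in> carrier ?G" if "X \<in> Obj D" for X using that by simp
  have "h r = 0" if "r \<in> K0_relations D" for r
  proof -
    have "{frag_of B - frag_of A - frag_of C | A B C. fits_triangle D A B C} \<subseteq> kernel ?G complex_group h"
    proof clarify
      fix A B C assume f: "fits_triangle D A B C"
      have ob: "A \<in> Obj D" "B \<in> Obj D" "C \<in> Obj D"
        using f by (auto simp: fits_triangle_def exact_triangle_def triangle_def)
      let ?r = "frag_of B - frag_of A - frag_of C"
      have r: "?r \<in> carrier ?G" by (rule subsetD[OF K0_generators_carrier]) (use f in blast)
      have AC: "frag_of A + frag_of C \<in> carrier ?G"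
        using monoid.m_closed[OF group.is_monoid[OF group_free_Abelian_group] car car, OF ob(1,3)]
        unfolding mult_free_Abelian_group .
      have "h (?r + (frag_of A + frag_of C)) = h ?r + h (frag_of A + frag_of C)" using hadd[OF r AC] .
      then have "z B = h ?r + (z A + z C)"
        using hadd[OF car car] ob h(2) by simp
      then have "h ?r = 0" using assms[OF f] by simp
      then show "?r \<in> kernel ?G complex_group h" using r by (simp add: kernel_def complex_group_def)
    qed
    then have "K0_relations D \<subseteq> kernel ?G complex_group h"
      unfolding K0_relations_def using gh.subgroup_kernel group.generate_subgroup_incl[OF group_free_Abelian_group] by blast
    then show ?thesis using that by (auto simp: kernel_def complex_group_def)
  qed
  note hr = this
  have const: "h x = h y" if xy: "x \<in> carrier ?G" "y \<in> carrier ?G"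
    and e: "K0_relations D #>\<^bsub>?G\<^esub> x = K0_relations D #>\<^bsub>?G\<^esub> y" for x y
  proof -
    have sub: "subgroup (K0_relations D) ?G" using K0_relations_normal normal_imp_subgroup by blast
    have "x \<in> K0_relations D #>\<^bsub>?G\<^esub> y"
      using e group.rcos_self[OF group_free_Abelian_group xy(1) sub] by simp
    then obtain r where r: "r \<in> K0_relations D" "x = r + y" by (auto simp: r_coset_def)
    then have "h x = h r + h y" using hadd xy(2) subgroup.mem_carrier[OF sub] by blast
    then show ?thesis using hr r by simp
  qed
  obtain g where "g \<in> hom (?G Mod K0_relations D) complex_group"
      "\<And>x. x \<in> carrier ?G \<Longrightarrow> g (K0_relations D #>\<^bsub>?G\<^esub> x) = h x"
    using FactGroup_universal[OF h(1) K0_relations_normal const] by blast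
  then show thesis using that[of g] h(2) car unfolding K0_def K0_class_def by simp
qed

section \<open>Heights above a ray\<close>

text \<open>
  The imaginary part of \<open>w e\<^sup>-\<^sup>i\<^sup>\<pi>\<^sup>\<theta>\<close>, the signed distance of \<open>w\<close> from the line through the ray of phase
  \<open>\<theta>\<close>. Heights are additive in \<open>w\<close>, and for vectors in a sector of angle less than \<open>\<pi>\<close> their signs
  compare phases.
\<close>

definition height :: "real \<Rightarrow> complex \<Rightarrow> real" where
  "height \<theta> w = Im w * cos (pi * \<theta>) - Re w * sin (pi * \<theta>)"

definition ray :: "real \<Rightarrow> real \<Rightarrow> complex" where
  "ray m \<phi> = of_real m * exp (\<i> * of_real pi * of_real \<phi>)"

lemma Re_ray: "Re (ray m \<phi>) = m * cos (pi * \<phi>)" and Im_ray: "Im (ray m \<phi>) = m * sin (pi * \<phi>)"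
  by (simp_all add: ray_def Re_exp Im_exp)

lemma cmod_ray: "cmod (ray m \<phi>) = \<bar>m\<bar>"
  by (simp add: ray_def norm_mult norm_exp_eq_Re)

lemma height_ray: "height \<theta> (ray m \<phi>) = m * sin (pi * (\<phi> - \<theta>))"
  by (simp add: height_def Re_ray Im_ray sin_diff algebra_simps)

lemma height_add: "height \<theta> (v + w) = height \<theta> v + height \<theta> w"
  by (simp add: height_def algebra_simps)

lemma height_0 [simp]: "height \<theta> 0 = 0"
  by (simp add: height_def)

lemma height_minus: "height \<theta> (- w) = - height \<theta> w"
  by (simp add: height_def)

lemma height_plus_1: "height (\<theta> + 1) w = - height \<theta> w"
  by (simp add: height_def distrib_left)

lemma height_le_cmod: "height \<theta> w \<le> cmod w"
proof -
  have "height \<theta> w = Im (w * cis (- (pi * \<theta>)))" by (simp add: height_def)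
  also have "\<dots> \<le> cmod (w * cis (- (pi * \<theta>)))" using abs_Im_le_cmod[of "w * cis (- (pi * \<theta>))"] by linarith
  finally show ?thesis by (simp add: norm_mult)
qed

lemma sin_pi_pos: "0 < x \<Longrightarrow> x < 1 \<Longrightarrow> 0 < sin (pi * x)"
  by (rule sin_gt_zero) auto

text \<open>
  On the open half-plane above the ray of phase \<open>\<theta>\<close> the phase is well defined in \<open>(\<theta>, \<theta> + 1)\<close>, and the
  sign of the height tells on which side of a given phase it lies. The proof is the Pluecker relation
  for the determinants of four vectors in the plane.
\<close>

lemma height_mono:
  assumes "\<theta> < \<psi>" "\<psi> < \<phi>" "\<phi> < \<theta> + 1" "0 < height \<theta> w" "0 \<le> height \<phi> w"
  shows "0 < height \<psi> w"
proof -
  have s: "sin (pi * (x - y)) = sin (pi * x) * cos (pi * y) - cos (pi * x) * sin (pi * y)" for x y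
    by (simp add: right_diff_distrib sin_diff)
  have "height \<psi> w * sin (pi * (\<phi> - \<theta>)) =
      height \<theta> w * sin (pi * (\<phi> - \<psi>)) + height \<phi> w * sin (pi * (\<psi> - \<theta>))"
    unfolding height_def s by (simp add: algebra_simps)
  also have "\<dots> > 0"
    using assms sin_pi_pos[of "\<phi> - \<psi>"] sin_pi_pos[of "\<psi> - \<theta>"] by (simp add: add_pos_nonneg)
  finally show ?thesis
    using sin_pi_pos[of "\<phi> - \<theta>"] assms by (simp add: zero_less_mult_iff)
qed

lemma height_0_ray:
  assumes "height \<phi> w = 0" "\<theta> < \<phi>" "\<phi> < \<theta> + 1" "0 < height \<theta> w"
  shows "\<exists>m>0. w = ray m \<phi>"
proof -
  define m where "m = Re w * cos (pi * \<phi>) + Im w * sin (pi * \<phi>)"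
  let ?c = "cos (pi * \<phi>)" and ?s = "sin (pi * \<phi>)"
  have one: "?c * ?c + ?s * ?s = 1" using sin_cos_squared_add3 by blast
  have h: "Im w * ?c = Re w * ?s" using assms(1) by (simp add: height_def)
  have "(Im w * ?s) * ?c = (Im w * ?c) * ?s" by simp
  also have "\<dots> = Re w * (?s * ?s)" unfolding h by simp
  finally have 1: "(Im w * ?s) * ?c = Re w * (?s * ?s)" .
  have "m * ?c = Re w * (?c * ?c) + (Im w * ?s) * ?c" by (simp add: m_def distrib_right)
  also have "\<dots> = Re w * (?c * ?c + ?s * ?s)" unfolding 1 by (rule distrib_left[symmetric])
  finally have re: "m * ?c = Re w" unfolding one by simp
  have "(Re w * ?c) * ?s = (Im w * ?c) * ?c" unfolding h by simp
  then have 2: "(Re w * ?c) * ?s = Im w * (?c * ?c)" by simp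
  have "m * ?s = (Re w * ?c) * ?s + Im w * (?s * ?s)" by (simp add: m_def distrib_right)
  also have "\<dots> = Im w * (?c * ?c + ?s * ?s)" unfolding 2 by (rule distrib_left[symmetric])
  finally have "m * ?s = Im w" unfolding one by simp
  with re have w: "w = ray m \<phi>" by (simp add: complex_eq_iff Re_ray Im_ray)
  then have "0 < m * sin (pi * (\<phi> - \<theta>))" using assms(4) height_ray by simp
  then have "m > 0" using sin_pi_pos[of "\<phi> - \<theta>"] assms by (simp add: zero_less_mult_iff)
  then show ?thesis using w by blast
qed

section \<open>Slicings of a triangulated subcategory\<close>

context triangulated_category
begin

text \<open>
  If \<open>E \<rightarrow> Y\<close> vanishes then \<open>Y\<close> is a direct summand of \<open>X[1]\<close>; dually for \<open>X \<rightarrow> E\<close>.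
\<close>

lemma truncation_zero_right:
  assumes "fits_triangle D X E Y" "hom_zero D E Y" "hom_zero D (Sh D 1 X) Y"
  shows "zero_object D Y"
  unfolding zero_object_iff using fits_hom_zero_left[OF fits_rotate[OF assms(1)] assms(2,3)] .

lemma truncation_zero_left:
  assumes "fits_triangle D X E Y" "hom_zero D X E" "hom_zero D X (Sh D (-1) Y)"
  shows "zero_object D X"
  unfolding zero_object_iff using fits_hom_zero_right[OF fits_rotate_back[OF assms(1)] assms(3,2)] .

end

lemma sorted_wrt_less_filter:
  fixes l :: "real list"
  assumes "sorted_wrt (<) l"
  shows "l = filter (\<lambda>x. x \<le> t) l @ filter (\<lambda>x. t < x) l"
  using assms
proof (induct l)
  case (Cons x l)
  show ?case
  proof (cases "x \<le> t")
    case False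
    then have "filter (\<lambda>x. x \<le> t) l = []" "filter (\<lambda>x. t < x) l = l"
      using Cons.prems by (auto simp: filter_empty_conv filter_id_conv)
    then show ?thesis using False by simp
  qed (use Cons in auto)
qed simp

text \<open>
  The slicing of a stability condition on a full triangulated subcategory \<open>S\<close>, with
  morphisms and triangles taken in the ambient category. The constant \<open>\<epsilon>\<close> is the lower bound on \<open>|Z|\<close> of a reasonable
  stability condition.
\<close>

locale slicing_on = triangulated_category D for D :: "('o, 'm) tricat" (structure) +
  fixes S :: "'o set" and P :: "real \<Rightarrow> 'o set" and z :: "'o \<Rightarrow> complex" and \<epsilon> :: real
  assumes S_sub: "triangulated_subcategory D S"
    and P_replete: "replete D (P \<phi>)" and P_S: "P \<phi> \<subseteq> S"
    and P_zero: "\<exists>X\<in>P \<phi>. zero_object D X"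
    and P_Sh: "Sh D 1 ` P \<phi> = P (\<phi> + 1)"
    and P_hom: "\<psi> < \<phi> \<Longrightarrow> A \<in> P \<phi> \<Longrightarrow> B \<in> P \<psi> \<Longrightarrow> hom_zero D A B"
    and P_HN: "E \<in> S \<Longrightarrow> \<exists>l. sorted_wrt (<) l \<and> filtered D P l E"
    and z_additive: "A \<in> S \<Longrightarrow> B \<in> S \<Longrightarrow> C \<in> S \<Longrightarrow> fits_triangle D A B C \<Longrightarrow> z B = z A + z C"
    and z_ray: "E \<in> P \<phi> \<Longrightarrow> \<not> zero_object D E \<Longrightarrow> \<exists>m\<ge>\<epsilon>. z E = ray m \<phi>"
begin

definition phases :: "real set \<Rightarrow> 'o set" where
  "phases I = ext_closure D (\<Union>\<phi>\<in>I. P \<phi>)"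

lemma zero_P: "zero_object D X \<Longrightarrow> X \<in> P \<phi>"
  using replete_zero P_replete P_zero by blast

lemma zero_S: "zero_object D X \<Longrightarrow> X \<in> S"
  using zero_P P_S by blast

lemma P_Sh_back: "A \<in> P \<phi> \<Longrightarrow> Sh D (-1) A \<in> P (\<phi> - 1)"
proof -
  assume "A \<in> P \<phi>"
  then have "A \<in> Sh D 1 ` P (\<phi> - 1)" using P_Sh[of "\<phi> - 1"] by simp
  then obtain B where B: "B \<in> P (\<phi> - 1)" "A = Sh D 1 B" by blast
  then have "B \<in> Obj D" using P_S sub_Obj[OF S_sub] by blast
  then show ?thesis using B by simp
qed

lemma P_Sh_int: "A \<in> P \<phi> \<Longrightarrow> Sh D n A \<in> P (\<phi> + of_int n)"
proof (induct n rule: int_induct[of _ 0])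
  case base
  then have "A \<in> Obj D" using P_S sub_Obj[OF S_sub] by blast
  then show ?case using base Sh_0 by simp
next
  case (step1 n)
  then have A: "A \<in> Obj D" using P_S sub_Obj[OF S_sub] by blast
  have "Sh D 1 (Sh D n A) \<in> P (\<phi> + of_int n + 1)" using step1 P_Sh by blast
  then show ?case using Sh_plus[OF A, of 1 n] by (simp add: add.commute add.left_commute)
next
  case (step2 n)
  then have A: "A \<in> Obj D" using P_S sub_Obj[OF S_sub] by blast
  have "Sh D (-1) (Sh D n A) \<in> P (\<phi> + of_int n - 1)" using step2 P_Sh_back by blast
  then show ?case using Sh_plus[OF A, of "-1" n] by (simp add: algebra_simps)
qed

lemma phases_S: "phases I \<subseteq> S"
  unfolding phases_def
proof (rule ext_closure_minimal)
  show "(\<Union>\<phi>\<in>I. P \<phi>) \<subseteq> S" using P_S by blast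
qed (rule sub_ext_closed[OF S_sub])

lemma phases_ext: "A \<in> phases I \<Longrightarrow> C \<in> phases I \<Longrightarrow> fits_triangle D A B C \<Longrightarrow> B \<in> phases I"
  unfolding phases_def by (rule ext_closure.ext)

lemma phases_mono: "I \<subseteq> J \<Longrightarrow> phases I \<subseteq> phases J"
  unfolding phases_def by (rule ext_closure_mono) blast

lemma phases_replete: "I \<noteq> {} \<Longrightarrow> replete D (phases I)"
  unfolding phases_def
proof (rule ext_closure_replete)
  show "(\<Union>\<phi>\<in>I. P \<phi>) \<subseteq> Obj D" using P_S sub_Obj[OF S_sub] by blast
  assume "I \<noteq> {}"
  then obtain \<phi> where "\<phi> \<in> I" by blast
  then show "\<exists>X\<in>\<Union>\<phi>\<in>I. P \<phi>. zero_object D X" using P_zero[of \<phi>] by blast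
qed

lemma phases_zero: "I \<noteq> {} \<Longrightarrow> zero_object D X \<Longrightarrow> X \<in> phases I"
  unfolding phases_def using zero_P by (auto intro!: ext_closure.base)

lemma phases_hom:
  assumes "A \<in> phases I" "B \<in> phases J" "\<And>\<phi> \<psi>. \<phi> \<in> I \<Longrightarrow> \<psi> \<in> J \<Longrightarrow> \<psi> < \<phi>"
  shows "hom_zero D A B"
  using assms(1,2) unfolding phases_def
  by (rule ext_closure_hom_zero[rotated]) (use assms(3) P_hom in blast)

lemma phases_Sh:
  assumes "E \<in> phases I" "\<And>\<phi>. \<phi> \<in> I \<Longrightarrow> \<phi> + 1 \<in> J" shows "Sh D 1 E \<in> phases J"
  using assms(1) unfolding phases_def
  by (rule ext_closure_Sh) (use assms(2) P_Sh in blast)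

lemma phases_Sh_back:
  assumes "E \<in> phases I" "\<And>\<phi>. \<phi> \<in> I \<Longrightarrow> \<phi> - 1 \<in> J" shows "Sh D (-1) E \<in> phases J"
  using assms(1) unfolding phases_def
  by (rule ext_closure_Sh_back) (use assms(2) P_Sh_back in blast)

lemma filtered_phases:
  assumes "filtered D P l E" "set l \<subseteq> I" "I \<noteq> {}" shows "E \<in> phases I"
  unfolding phases_def using filtered_ext_closure[OF assms] zero_P by blast

lemma filtered_truncation:
  assumes "filtered D P l E" "sorted_wrt (<) l"
  obtains X Y where "fits_triangle D X E Y"
    "filtered D P (filter (\<lambda>x. t < x) l) X" "filtered D P (filter (\<lambda>x. x \<le> t) l) Y"
  using filtered_split assms(1) sorted_wrt_less_filter[OF assms(2), of t] by metis

lemma phases_truncation: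
  assumes "E \<in> S"
  obtains X Y where "X \<in> phases {t<..}" "Y \<in> phases {..t}" "fits_triangle D X E Y"
proof -
  obtain l where l: "sorted_wrt (<) l" "filtered D P l E" using P_HN assms by blast
  obtain X Y where XY: "fits_triangle D X E Y"
    "filtered D P (filter (\<lambda>x. t < x) l) X" "filtered D P (filter (\<lambda>x. x \<le> t) l) Y"
    using filtered_truncation[OF l(2,1)] .
  show thesis
    by (rule that[OF _ _ XY(1)]; rule filtered_phases[OF XY(2)] filtered_phases[OF XY(3)]) auto
qed

lemma phases_bounded:
  assumes "E \<in> S" obtains b where "\<And>t. t \<le> - b \<Longrightarrow> E \<in> phases {t<..}" "\<And>t. b \<le> t \<Longrightarrow> E \<in> phases {..t}"
proof -
  obtain l where l: "filtered D P l E" using P_HN assms by blast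
  define b where "b = Max (insert 0 (abs ` set l)) + 1"
  have b: "\<bar>x\<bar> < b" if "x \<in> set l" for x
  proof -
    have "\<bar>x\<bar> \<le> Max (insert 0 (abs ` set l))" by (rule Max_ge) (use that in auto)
    then show ?thesis by (simp add: b_def)
  qed
  show thesis
  proof (rule that[of b])
    fix t assume t: "t \<le> - b"
    have "x \<in> {t<..}" if "x \<in> set l" for x using b[OF that] t by auto
    then have "set l \<subseteq> {t<..}" by blast
    then show "E \<in> phases {t<..}" by (rule filtered_phases[OF l]) simp
  next
    fix t assume t: "b \<le> t"
    have "x \<in> {..t}" if "x \<in> set l" for x using b[OF that] t by auto
    then have "set l \<subseteq> {..t}" by blast
    then show "E \<in> phases {..t}" by (rule filtered_phases[OF l]) simp
  qed
qed

text \<open>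
  Cutting the Harder-Narasimhan filtration of \<open>E\<close> at \<open>s\<close> and at \<open>t\<close> splits off a quotient with phases at
  most \<open>s\<close> and a subobject with phases above \<open>t\<close>. Both vanish because the maps from or to \<open>E\<close> do.
\<close>

lemma phases_interval:
  assumes "s < t" shows "phases {s<..t} = phases {s<..} \<inter> phases {..t}"
proof
  show "phases {s<..t} \<subseteq> phases {s<..} \<inter> phases {..t}" 
    by (intro Int_greatest phases_mono) auto
  show "phases {s<..} \<inter> phases {..t} \<subseteq> phases {s<..t}"
  proof
    fix E assume E: "E \<in> phases {s<..} \<inter> phases {..t}"
    obtain l where l: "sorted_wrt (<) l" "filtered D P l E" using P_HN E phases_S by blast
    obtain X Y where XY: "fits_triangle D X E Y"
      "filtered D P (filter (\<lambda>x. s < x) l) X" "filtered D P (filter (\<lambda>x. x \<le> s) l) Y"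
      using filtered_truncation[OF l(2,1)] .
    have X: "X \<in> phases {s<..}" and Y: "Y \<in> phases {..s}"
      by (rule filtered_phases[OF XY(2)] filtered_phases[OF XY(3)], auto)+
    have "zero_object D Y"
    proof (rule truncation_zero_right[OF XY(1)])
      show "hom_zero D E Y" by (rule phases_hom[OF IntD1[OF E] Y]) auto
      have "Sh D 1 X \<in> phases {s<..}" using phases_Sh[OF X] by auto
      then show "hom_zero D (Sh D 1 X) Y" by (rule phases_hom[OF _ Y]) auto
    qed
    then have "filtered D P (filter (\<lambda>x. s < x) l) E" using filtered_iso[OF XY(2)] zero_right_iso[OF XY(1)] by blast
    moreover have "sorted_wrt (<) (filter (\<lambda>x. s < x) l)" using l(1) by (rule sorted_wrt_filter)
    ultimately obtain X' Y' where XY': "fits_triangle D X' E Y'"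
      "filtered D P (filter (\<lambda>x. t < x) (filter (\<lambda>x. s < x) l)) X'"
      "filtered D P (filter (\<lambda>x. x \<le> t) (filter (\<lambda>x. s < x) l)) Y'"
      using filtered_truncation by metis
    have X': "X' \<in> phases {t<..}" and Y': "Y' \<in> phases {s<..t}"
      by (rule filtered_phases[OF XY'(2)] filtered_phases[OF XY'(3)], use assms in auto)+
    have "zero_object D X'"
    proof (rule truncation_zero_left[OF XY'(1)])
      show "hom_zero D X' E" by (rule phases_hom[OF X' IntD2[OF E]]) auto
      have "Sh D (-1) Y' \<in> phases {..t}" using phases_Sh_back[OF Y'] by auto
      then show "hom_zero D X' (Sh D (-1) Y')" by (rule phases_hom[OF X']) auto
    qed
    then have "isomorphic D E Y'" using zero_left_iso[OF XY'(1)] by blast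
    then show "E \<in> phases {s<..t}"
      using replete_mem[OF phases_replete Y' isomorphic_sym] assms by auto
  qed
qed

lemma z_zero: assumes "zero_object D X" shows "z X = 0"
proof -
  have "z X = z X + z X"
    using z_additive[OF zero_S zero_S zero_S fits_zero_right[OF zero_objects_isomorphic]] assms by blast
  then show ?thesis by (metis add_cancel_right_right)
qed

lemma z_iso:
  assumes "A \<in> S" "isomorphic D A B" shows "z B = z A"
proof -
  obtain X where X: "zero_object D X" using zero_object_exists by blast
  have "B \<in> S" using S_sub assms replete_mem unfolding triangulated_subcategory_def by blast
  then show ?thesis
    using z_additive[OF assms(1) _ zero_S[OF X] fits_zero_right[OF assms(2) X]] z_zero[OF X] by simp
qed

text \<open>
  A property of complex numbers closed under sums passes from semistable objects to their extensions. It
  will be instantiated with half-plane conditions.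
\<close>

lemma phases_charge:
  assumes "E \<in> phases I" "\<not> zero_object D E"
    and "\<And>v w. Q v \<Longrightarrow> Q w \<Longrightarrow> Q (v + w)" and "\<And>\<phi> m. \<phi> \<in> I \<Longrightarrow> \<epsilon> \<le> m \<Longrightarrow> Q (ray m \<phi>)"
  shows "Q (z E)"
proof -
  have "zero_object D E \<or> Q (z E)"
    using assms(1) unfolding phases_def
  proof induct
    case (base E) then show ?case using z_ray assms(4) by (metis UN_E)
  next
    case (ext A C B)
    have "A \<in> S" "B \<in> S" "C \<in> S"
      using ext phases_S[of I] ext_closure.ext unfolding phases_def by (blast intro: ext_closure.ext)+
    then have zB: "z B = z A + z C" using z_additive ext by blast
    have "zero_object D B" if "zero_object D A" "zero_object D C"
      using zero_object_iso[OF that(2)] isomorphic_sym[OF zero_left_iso[OF ext(5) that(1)]] by blast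
    then show ?case using zB z_zero ext assms(3) by (metis add.left_neutral add.right_neutral)
  qed
  then show ?thesis using assms(2) by blast
qed

end

section \<open>Families of t-structures with narrow gaps\<close>

text \<open>
  A family of t-structures on \<open>D\<close> indexed by cuts: \<open>U i\<close> is the class of objects with phases above \<open>cut i\<close>
  and \<open>V i\<close> its orthogonal, the objects with phases at most \<open>cut i\<close>. Shifting raises the index by two;
  the hearts are therefore \<open>U i \<inter> V (i + 2)\<close>, and each of them is cut into two blocks. The charge of an object
  between two cuts is a sum of vectors of length at least \<open>\<epsilon>\<close> with phases between these cuts; \<open>z_cone\<close> says this
  without mentioning the summands.
\<close>

locale cut_system = triangulated_category D for D :: "('o, 'm) tricat" (structure) +
  fixes U V :: "int \<Rightarrow> 'o set" and cut :: "int \<Rightarrow> real" and z :: "'o \<Rightarrow> complex" and \<epsilon> :: real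
  assumes UV_replete: "replete D (U i)" "replete D (V i)"
    and U_ext: "A \<in> U i \<Longrightarrow> C \<in> U i \<Longrightarrow> fits_triangle D A B C \<Longrightarrow> B \<in> U i"
    and V_ext: "A \<in> V i \<Longrightarrow> C \<in> V i \<Longrightarrow> fits_triangle D A B C \<Longrightarrow> B \<in> V i"
    and U_step: "U (i + 1) \<subseteq> U i" and V_step: "V i \<subseteq> V (i + 1)"
    and U_Sh: "E \<in> U i \<Longrightarrow> Sh D 1 E \<in> U (i + 2)" and U_Sh_back: "E \<in> U i \<Longrightarrow> Sh D (-1) E \<in> U (i - 2)"
    and V_Sh: "E \<in> V i \<Longrightarrow> Sh D 1 E \<in> V (i + 2)" and V_Sh_back: "E \<in> V i \<Longrightarrow> Sh D (-1) E \<in> V (i - 2)"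
    and UV_hom: "A \<in> U i \<Longrightarrow> B \<in> V i \<Longrightarrow> hom_zero D A B"
    and UV_truncation: "E \<in> Obj D \<Longrightarrow> \<exists>A\<in>U i. \<exists>B\<in>V i. fits_triangle D A E B"
    and UV_bounded: "E \<in> Obj D \<Longrightarrow> \<exists>i j. E \<in> U i \<and> E \<in> V j"
    and UV_zero: "zero_object D X \<Longrightarrow> X \<in> U i" "zero_object D X \<Longrightarrow> X \<in> V i"
    and cut_step: "cut i < cut (i + 1)" and cut_period: "cut (i + 2) = cut i + 1"
    and cut_cover: "\<exists>i. cut i < \<phi> \<and> \<phi> \<le> cut (i + 1)"
    and z_additive: "fits_triangle D A B C \<Longrightarrow> z B = z A + z C"
    and z_cone: "E \<in> U i \<Longrightarrow> E \<in> V j \<Longrightarrow> i < j \<Longrightarrow> \<not> zero_object D E \<Longrightarrow>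
      (\<And>v w. Q v \<Longrightarrow> Q w \<Longrightarrow> Q (v + w)) \<Longrightarrow>
      (\<And>\<phi> m. cut i < \<phi> \<Longrightarrow> \<phi> \<le> cut j \<Longrightarrow> \<epsilon> \<le> m \<Longrightarrow> Q (ray m \<phi>)) \<Longrightarrow> Q (z E)"
    and \<epsilon>_pos: "0 < \<epsilon>"
begin

subsection \<open>Blocks\<close>

definition block :: "int \<Rightarrow> 'o set" where
  "block i = U i \<inter> V (i + 1)"

lemma U_antimono: "i \<le> j \<Longrightarrow> U j \<subseteq> U i"
  by (induct j rule: int_ge_induct) (use U_step in blast)+

lemma V_mono: "i \<le> j \<Longrightarrow> V i \<subseteq> V j"
  by (induct j rule: int_ge_induct) (use V_step in blast)+

lemma U_weaken: "E \<in> U j \<Longrightarrow> i \<le> j \<Longrightarrow> E \<in> U i"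
  using U_antimono by blast

lemma V_weaken: "E \<in> V i \<Longrightarrow> i \<le> j \<Longrightarrow> E \<in> V j"
  using V_mono by blast

lemma cut_less: "i < j \<Longrightarrow> cut i < cut j"
  by (induct j rule: int_gr_induct) (use cut_step less_trans in \<open>blast intro: less_trans\<close>)+

lemma cut_le: "i \<le> j \<Longrightarrow> cut i \<le> cut j"
  using cut_less by (cases "i = j") (auto intro: less_imp_le)

lemma cut_block_unique:
  assumes "cut i < \<phi>" "\<phi> \<le> cut (i + 1)" "cut j < \<phi>" "\<phi> \<le> cut (j + 1)" shows "i = j"
proof -
  have "\<not> i + 1 \<le> j" "\<not> j + 1 \<le> i" using cut_le[of "i + 1" j] cut_le[of "j + 1" i] assms by linarith+
  then show ?thesis by linarith
qed

lemma cut_width: "cut (i + 1) < cut i + 1"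
  using cut_step[of "i + 1"] cut_period[of i] by (simp add: add.commute)

lemma block_U: "E \<in> block i \<Longrightarrow> E \<in> U i" and block_V: "E \<in> block i \<Longrightarrow> E \<in> V (i + 1)"
  by (simp_all add: block_def)

lemma blockI: "E \<in> U i \<Longrightarrow> E \<in> V (i + 1) \<Longrightarrow> E \<in> block i"
  by (simp add: block_def)

lemma block_Obj: "E \<in> block i \<Longrightarrow> E \<in> Obj D"
  using UV_replete(1) unfolding block_def replete_def by blast

lemma block_ext: "A \<in> block i \<Longrightarrow> C \<in> block i \<Longrightarrow> fits_triangle D A B C \<Longrightarrow> B \<in> block i"
  using U_ext V_ext unfolding block_def by blast

lemma block_zero: "zero_object D X \<Longrightarrow> X \<in> block i"
  using UV_zero unfolding block_def by blast

lemma block_replete: "replete D (block i)"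
  using UV_replete unfolding block_def replete_def by blast

lemma block_Sh: "E \<in> block i \<Longrightarrow> Sh D 1 E \<in> block (i + 2)"
  using U_Sh V_Sh[of E "i + 1"] unfolding block_def by (simp add: add.commute add.left_commute)

lemma block_Sh_back: "E \<in> block i \<Longrightarrow> Sh D (-1) E \<in> block (i - 2)"
  using U_Sh_back V_Sh_back[of E "i + 1"] unfolding block_def by (simp add: algebra_simps)

lemma block_hom_neg:
  assumes "A \<in> block i" "B \<in> block i"
  shows "hom_zero D (Sh D 1 A) B" "hom_zero D A (Sh D (-1) B)"
proof -
  have "Sh D 1 A \<in> U (i + 1)" using U_weaken[OF U_Sh[OF block_U[OF assms(1)]], of "i + 1"] by simp
  then show 1: "hom_zero D (Sh D 1 A) B" using UV_hom block_V[OF assms(2)] by blast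
  show "hom_zero D A (Sh D (-1) B)" using hom_zero_Sh[OF 1, of "-1"] block_Obj[OF assms(1)] by simp
qed

lemma UV_zero_object: "E \<in> U i \<Longrightarrow> E \<in> V i \<Longrightarrow> zero_object D E"
  unfolding zero_object_iff by (rule UV_hom)

lemma sub_hom_nonzero:
  assumes "X \<in> block i" "C \<in> block i" "fits_triangle D X E C" "hom_zero D X E"
  shows "zero_object D X"
  using truncation_zero_left[OF assms(3,4) block_hom_neg(2)[OF assms(1,2)]] .

lemma quotient_hom_nonzero:
  assumes "K \<in> block i" "Y \<in> block i" "fits_triangle D K E Y" "hom_zero D E Y"
  shows "zero_object D Y"
  using truncation_zero_right[OF assms(3,4) block_hom_neg(1)[OF assms(1,2)]] .

lemma fits_self_zero:
  assumes "E \<in> Obj D" "zero_object D Z" shows "fits_triangle D Z E E" "fits_triangle D E E Z"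
  using fits_zero_left fits_zero_right isomorphic_refl assms by blast+

lemma z_zero: "zero_object D X \<Longrightarrow> z X = 0"
  using z_additive[OF fits_self_zero(1)[of X X]] zero_Obj by (metis add_cancel_right_right)

lemma z_iso: "isomorphic D A B \<Longrightarrow> z B = z A"
  using z_additive[OF fits_zero_right] z_zero zero_object_exists by (metis add.right_neutral)

lemma z_Sh: assumes "E \<in> Obj D" shows "z (Sh D 1 E) = - z E"
proof -
  obtain Z where Z: "zero_object D Z" using zero_object_exists by blast
  have "z Z = z E + z (Sh D 1 E)" using z_additive[OF fits_rotate[OF fits_self_zero(1)[OF assms Z]]]
      z_additive[OF fits_rotate[OF fits_self_zero(2)[OF assms Z]]] z_zero[OF Z]
      z_additive[OF fits_rotate[OF fits_rotate[OF fits_self_zero(1)[OF assms Z]]]]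
      z_zero[OF zero_object_Sh[OF Z]] by simp
  then show ?thesis using z_zero[OF Z] by (simp add: eq_neg_iff_add_eq_0 add.commute)
qed

subsection \<open>Heights of objects between two cuts\<close>

lemma height_pos:
  assumes "E \<in> U i" "E \<in> V j" "i < j" "\<not> zero_object D E" "\<phi> \<le> cut i" "cut j < \<phi> + 1"
  shows "0 < height \<phi> (z E)"
  by (rule z_cone[OF assms(1-4)])
     (use assms(5,6) \<epsilon>_pos in \<open>auto simp: height_add height_ray intro!: mult_pos_pos sin_pi_pos\<close>)

lemma height_nonpos:
  assumes "E \<in> U i" "E \<in> V j" "i < j" "cut j \<le> \<phi>" "\<phi> \<le> cut i + 1"
  shows "height \<phi> (z E) \<le> 0"
proof (cases "zero_object D E")
  case False
  show ?thesis
  proof (rule z_cone[OF assms(1-3) False])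
    fix \<psi> m assume *: "cut i < \<psi>" "\<psi> \<le> cut j" "\<epsilon> \<le> m"
    have "0 \<le> sin (pi * (\<phi> - \<psi>))"
      by (rule sin_ge_zero) (use * assms in \<open>auto intro: mult_left_le\<close>)
    then have "sin (pi * (\<psi> - \<phi>)) \<le> 0"
      using sin_minus[of "pi * (\<phi> - \<psi>)"] by (simp add: algebra_simps)
    then show "height \<phi> (ray m \<psi>) \<le> 0"
      using * \<epsilon>_pos by (simp add: height_ray mult_nonneg_nonpos)
  qed (simp add: height_add)
qed (simp add: z_zero)

text \<open>
  The phase \<open>mid i\<close> is chosen such that the phases of the block lie symmetrically in the open
  half-plane above it. Since the block is narrower than a half-plane, heights above \<open>mid i\<close> are
  bounded below by \<open>gap i\<close>.
\<close>

definition mid :: "int \<Rightarrow> real" where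
  "mid i = (cut i + cut (i + 1) - 1) / 2"

definition gap :: "int \<Rightarrow> real" where
  "gap i = \<epsilon> * cos (pi * ((cut (i + 1) - cut i) / 2))"

lemma gap_pos: "0 < gap i"
proof -
  have "0 < cos (pi * ((cut (i + 1) - cut i) / 2))"
    by (rule cos_gt_zero) (use cut_step[of i] cut_width[of i] in auto)
  then show ?thesis using \<epsilon>_pos by (simp add: gap_def)
qed

lemma gap_period: "gap (i + 2) = gap i"
  using cut_period[of i] cut_period[of "i + 1"] by (simp add: gap_def add.commute add.left_commute)

lemma mid_bounds: "mid i < cut i" "cut (i + 1) < mid i + 1"
  using cut_width[of i] by (simp_all add: mid_def field_simps)

lemma gap_le_height:
  assumes "E \<in> block i" "\<not> zero_object D E" shows "gap i \<le> height (mid i) (z E)"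
proof (rule z_cone[OF block_U[OF assms(1)] block_V[OF assms(1)] _ assms(2)])
  fix v w assume "gap i \<le> height (mid i) v" "gap i \<le> height (mid i) w"
  then show "gap i \<le> height (mid i) (v + w)" using gap_pos[of i] by (simp add: height_add)
next
  fix \<phi> m assume *: "cut i < \<phi>" "\<phi> \<le> cut (i + 1)" "\<epsilon> \<le> m"
  define d where "d = (cut (i + 1) - cut i) / 2"
  define x where "x = \<phi> - mid i - 1 / 2"
  have x: "\<bar>x\<bar> \<le> d" using * by (simp add: x_def d_def mid_def field_simps abs_le_iff)
  have "d \<le> 1" using cut_width[of i] by (simp add: d_def)
  then have "cos (pi * d) \<le> cos (pi * \<bar>x\<bar>)"
    by (intro cos_monotone_0_pi_le) (use x in auto)
  also have "\<dots> = cos (pi * x)" by (simp add: abs_if)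
  also have "\<dots> = sin (pi * (\<phi> - mid i))"
    by (simp add: x_def sin_cos_eq algebra_simps) (metis cos_minus minus_diff_eq)
  finally have 1: "cos (pi * d) \<le> sin (pi * (\<phi> - mid i))" .
  have "0 < cos (pi * d)" using gap_pos[of i] \<epsilon>_pos by (simp add: gap_def d_def zero_less_mult_iff)
  then have "\<epsilon> * cos (pi * d) \<le> m * sin (pi * (\<phi> - mid i))"
    using 1 * \<epsilon>_pos by (intro mult_mono) auto
  then show "gap i \<le> height (mid i) (ray m \<phi>)" by (simp add: height_ray gap_def d_def)
qed simp

lemma phase_exists:
  assumes "E \<in> block i" "\<not> zero_object D E"
  obtains \<phi> where "cut i < \<phi>" "\<phi> \<le> cut (i + 1)" "height \<phi> (z E) = 0"
proof -
  have 1: "0 < height (cut i) (z E)"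
    using height_pos[OF block_U[OF assms(1)] block_V[OF assms(1)] _ assms(2)] cut_width[of i] by simp
  have 2: "height (cut (i + 1)) (z E) \<le> 0"
    using height_nonpos[OF block_U[OF assms(1)] block_V[OF assms(1)]] cut_width[of i] by simp
  have "\<exists>\<phi>\<ge>cut i. \<phi> \<le> cut (i + 1) \<and> height \<phi> (z E) = 0"
    by (rule IVT2) (use 1 2 cut_step[of i] in \<open>auto simp: height_def intro!: continuous_intros\<close>)
  then obtain \<phi> where "cut i \<le> \<phi>" "\<phi> \<le> cut (i + 1)" "height \<phi> (z E) = 0" by blast
  moreover from this have "\<phi> \<noteq> cut i" using 1 by auto
  ultimately show thesis using that[of \<phi>] by simp
qed

subsection \<open>Torsion pairs inside a block\<close>

text \<open>
  For \<open>\<phi>\<close> between the two cuts of a block, the phase of a nonzero object of the block is greater than \<open>\<phi>\<close> if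
  and only if its height above \<open>\<phi>\<close> is positive. So \<open>above i \<phi>\<close> are the objects of the \<open>i\<close>-th block all of whose nonzero quotients in the block have
  phase greater than \<open>\<phi>\<close>, and \<open>below i \<phi>\<close> those all of whose nonzero subobjects have phase at most \<open>\<phi>\<close>.
\<close>

definition above :: "int \<Rightarrow> real \<Rightarrow> 'o \<Rightarrow> bool" where
  "above i \<phi> X \<longleftrightarrow> X \<in> block i \<and> (\<forall>K\<in>block i. \<forall>Q\<in>block i. fits_triangle D K X Q \<longrightarrow>
     \<not> zero_object D Q \<longrightarrow> 0 < height \<phi> (z Q))"

definition below :: "int \<Rightarrow> real \<Rightarrow> 'o \<Rightarrow> bool" where
  "below i \<phi> E \<longleftrightarrow> E \<in> block i \<and> (\<forall>K\<in>block i. \<forall>Q\<in>block i. fits_triangle D K E Q \<longrightarrow>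
     height \<phi> (z K) \<le> 0)"

lemma above_block: "above i \<phi> X \<Longrightarrow> X \<in> block i" and below_block: "below i \<phi> X \<Longrightarrow> X \<in> block i"
  by (simp_all add: above_def below_def)

text \<open>
  Let \<open>I\<close> be the image of \<open>f : X \<rightarrow> E\<close>, a subobject of \<open>E\<close> in the block. The kernel of \<open>X \<rightarrow> I\<close> need not be in the
  block, but only its part \<open>F\<close> below the block matters: dividing \<open>X\<close> by the rest of the kernel gives a
  quotient \<open>G\<close> of \<open>X\<close> in the block with \<open>Z(G) = Z(F) + Z(I)\<close>. Both summands have nonpositive height, so \<open>G\<close>
  vanishes, and then \<open>I = F[1]\<close> is above and in the block, hence zero.
\<close>

lemma above_below_hom:
  assumes "above i \<phi> X" "below i \<phi> E" "cut i < \<phi>" "\<phi> \<le> cut (i + 1)"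
  shows "hom_zero D X E"
proof (rule hom_zeroI)
  note X = above_block[OF assms(1)] and E = below_block[OF assms(2)]
  show "X \<in> Obj D" "E \<in> Obj D" using block_Obj X E by blast+
  fix f assume f: "f \<in> Hom D X E"
  obtain C g h where e: "exact_triangle D X E C f g h" using cone_exists[OF f] .
  note fXE = fitsI[OF e]
  have X1: "Sh D 1 X \<in> U (i + 2)" "Sh D 1 X \<in> V (i + 3)"
    using block_U[OF block_Sh[OF X]] block_V[OF block_Sh[OF X]] by (simp_all add: add.commute)
  have CU: "C \<in> U i"
    using U_ext[OF block_U[OF E] U_weaken[OF X1(1)] fits_rotate[OF fXE]] by simp
  have CV: "C \<in> V (i + 3)"
    using V_ext[OF V_weaken[OF block_V[OF E]] X1(2) fits_rotate[OF fXE]] by simp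
  obtain Y Q where YQ: "Y \<in> U (i + 1)" "Q \<in> V (i + 1)" "fits_triangle D Y C Q"
    using UV_truncation[of C "i + 1"] fits_Obj(3)[OF fXE] by blast
  have Y1: "Sh D 1 Y \<in> U (i + 3)" using U_Sh[OF YQ(1)] by (simp add: add.commute)
  have Q1: "Sh D (-1) Q \<in> V (i - 1)" using V_Sh_back[OF YQ(2)] by (simp add: algebra_simps)
  have YV: "Y \<in> V (i + 3)"
    using V_ext[OF V_weaken[OF Q1] CV fits_rotate_back[OF YQ(3)]] by simp
  have Q: "Q \<in> block i"
    using U_ext[OF CU U_weaken[OF Y1] fits_rotate[OF YQ(3)]] blockI YQ(2) by simp
  obtain I where I: "fits_triangle D X I Y" "fits_triangle D I E Q" "zero_object D I \<Longrightarrow> f = Zro D X E"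
    using fits_factor[OF e YQ(3)] by metis
  have IU: "I \<in> U i" using U_ext[OF block_U[OF X] U_weaken[OF YQ(1)] I(1)] by simp
  have IV: "I \<in> V (i + 1)"
    using V_ext[OF V_weaken[OF Q1] block_V[OF E] fits_rotate_back[OF I(2)]] by simp
  have hI: "height \<phi> (z I) \<le> 0" using assms(2) blockI[OF IU IV] Q I(2) unfolding below_def by blast
  \<comment> \<open>the kernel of \<open>f\<close> lies in the heart \<open>U (i - 1) \<inter> V (i + 1)\<close>; the truncation at \<open>i\<close> separates its
    part \<open>T\<close> in the block from the part \<open>F\<close> below it\<close>
  let ?K = "Sh D (-1) Y"
  have K: "?K \<in> U (i - 1)" "?K \<in> V (i + 1)"
    using U_Sh_back[OF YQ(1)] V_Sh_back[OF YV] by (simp_all add: algebra_simps)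
  obtain T F where TF: "T \<in> U i" "F \<in> V i" "fits_triangle D T ?K F"
    using UV_truncation[of ?K i] fits_Obj(1)[OF YQ(3)] by auto
  have T1: "Sh D 1 T \<in> U (i + 2)" using U_Sh[OF TF(1)] .
  have F1: "Sh D (-1) F \<in> V (i - 2)" using V_Sh_back[OF TF(2)] .
  have T: "T \<in> block i"
    using V_ext[OF V_weaken[OF F1] K(2) fits_rotate_back[OF TF(3)]] blockI TF(1) by simp
  have F: "F \<in> U (i - 1)"
    using U_ext[OF K(1) U_weaken[OF T1] fits_rotate[OF TF(3)]] by simp
  obtain G where G: "fits_triangle D T X G" "fits_triangle D F G I"
    using fits_assoc_left[OF TF(3) fits_rotate_back[OF I(1)]] .
  have GU: "G \<in> U i" using U_ext[OF block_U[OF X] U_weaken[OF T1] fits_rotate[OF G(1)]] by simp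
  have GV: "G \<in> V (i + 1)" using V_ext[OF V_weaken[OF TF(2)] IV G(2)] by simp
  have "height \<phi> (z F) \<le> 0"
    using height_nonpos[OF F TF(2)] cut_period[of "i - 1"] assms(3,4) by (simp add: add.commute)
  then have "height \<phi> (z G) \<le> 0" using hI z_additive[OF G(2)] by (simp add: height_add)
  then have G0: "zero_object D G"
    using assms(1) T blockI[OF GU GV] G(1) unfolding above_def by force
  have "isomorphic D I (Sh D 1 F)" using zero_left_iso[OF fits_rotate[OF G(2)] G0] .
  then have "I \<in> U (i + 1)"
    using replete_mem[OF UV_replete(1) _ isomorphic_sym] U_Sh[OF F] by (simp add: algebra_simps)
  then show "f = Zro D X E" using UV_zero_object IV I(3) by blast
qed

text \<open>
  As long as there is a nonzero quotient of height at most zero, the corresponding subobject has positive height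
  again. It is also shorter, since the height above \<open>mid i\<close> drops by at least \<open>gap i\<close>, so the process stops.
\<close>

lemma above_subobject_exists:
  assumes "E \<in> block i" "0 < height \<phi> (z E)"
  obtains X C where "fits_triangle D X E C" "C \<in> block i" "above i \<phi> X" "\<not> zero_object D X"
proof -
  have "\<exists>X C. fits_triangle D X E C \<and> C \<in> block i \<and> above i \<phi> X \<and> \<not> zero_object D X"
    if "E \<in> block i" "0 < height \<phi> (z E)" "height (mid i) (z E) \<le> real n * gap i" for n E
    using that
  proof (induct n arbitrary: E)
    case 0
    then show ?case using gap_le_height[of E i] gap_pos[of i] z_zero[of E] by force
  next
    case (Suc n)
    have nz: "\<not> zero_object D E" using Suc.prems(2) z_zero by auto
    show ?case
    proof (cases "above i \<phi> E")
      case True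
      obtain Z where Z: "zero_object D Z" using zero_object_exists by blast
      show ?thesis using fits_self_zero(2)[OF block_Obj[OF Suc.prems(1)] Z] True nz block_zero[OF Z] by blast
    next
      case False
      then obtain K Q where KQ: "K \<in> block i" "Q \<in> block i" "fits_triangle D K E Q"
          "\<not> zero_object D Q" "height \<phi> (z Q) \<le> 0"
        using Suc.prems(1) unfolding above_def by force
      have "0 < height \<phi> (z K)" using z_additive[OF KQ(3)] KQ(5) Suc.prems(2) by (simp add: height_add)
      moreover have "height (mid i) (z K) \<le> real n * gap i"
        using z_additive[OF KQ(3)] gap_le_height[OF KQ(2,4)] Suc.prems(3) by (simp add: height_add algebra_simps)
      ultimately obtain X C where X: "fits_triangle D X K C" "C \<in> block i" "above i \<phi> X" "\<not> zero_object D X"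
        using Suc.hyps KQ(1) by blast
      obtain W where W: "fits_triangle D X E W" "fits_triangle D C W Q"
        using fits_assoc_left[OF X(1) KQ(3)] .
      then show ?thesis using X block_ext[OF X(2) KQ(2) W(2)] by blast
    qed
  qed
  moreover obtain n where "height (mid i) (z E) \<le> real n * gap i"
    using reals_Archimedean3[OF gap_pos[of i], rule_format, of "height (mid i) (z E)"] less_imp_le by blast
  ultimately show thesis using that assms by blast
qed

lemma below_quotient_exists:
  assumes "E \<in> block i" "height \<phi> (z E) \<le> 0" "\<not> zero_object D E"
  obtains K Y where "fits_triangle D K E Y" "K \<in> block i" "below i \<phi> Y" "\<not> zero_object D Y"
proof -
  have "\<exists>K Y. fits_triangle D K E Y \<and> K \<in> block i \<and> below i \<phi> Y \<and> \<not> zero_object D Y"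
    if "E \<in> block i" "height \<phi> (z E) \<le> 0" "\<not> zero_object D E" "height (mid i) (z E) \<le> real n * gap i" for n E
    using that
  proof (induct n arbitrary: E)
    case 0
    then show ?case using gap_le_height[of E i] gap_pos[of i] by force
  next
    case (Suc n)
    show ?case
    proof (cases "below i \<phi> E")
      case True
      obtain Z where Z: "zero_object D Z" using zero_object_exists by blast
      show ?thesis
        using fits_self_zero(1)[OF block_Obj[OF Suc.prems(1)] Z] True Suc.prems(3) block_zero[OF Z] by blast
    next
      case False
      then obtain K Q where KQ: "K \<in> block i" "Q \<in> block i" "fits_triangle D K E Q" "0 < height \<phi> (z K)"
        using Suc.prems(1) unfolding below_def by force
      have K: "\<not> zero_object D K" using KQ(4) z_zero by auto
      have "height \<phi> (z Q) < 0" using z_additive[OF KQ(3)] KQ(4) Suc.prems(2) by (simp add: height_add)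
      moreover from this have "\<not> zero_object D Q" using z_zero by auto
      moreover have "height (mid i) (z Q) \<le> real n * gap i"
        using z_additive[OF KQ(3)] gap_le_height[OF KQ(1) K] Suc.prems(4) by (simp add: height_add algebra_simps)
      ultimately obtain K' Y where Y: "fits_triangle D K' Q Y" "K' \<in> block i" "below i \<phi> Y" "\<not> zero_object D Y"
        using Suc.hyps KQ(2) by (meson less_imp_le)
      obtain W where W: "fits_triangle D W E Y" "fits_triangle D K W K'"
        using fits_assoc_right[OF KQ(3) Y(1)] .
      then show ?thesis using Y block_ext[OF KQ(1) Y(2) W(2)] by blast
    qed
  qed
  moreover obtain n where "height (mid i) (z E) \<le> real n * gap i"
    using reals_Archimedean3[OF gap_pos[of i], rule_format, of "height (mid i) (z E)"] less_imp_le by blast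
  ultimately show thesis using that assms by blast
qed

text \<open>
  The two classes are orthogonals of each other. In contrast to the definitions this makes it evident that
  they are closed under extensions.
\<close>

lemma below_iff_hom:
  assumes "E \<in> block i" "cut i < \<phi>" "\<phi> \<le> cut (i + 1)"
  shows "below i \<phi> E \<longleftrightarrow> (\<forall>X. above i \<phi> X \<longrightarrow> hom_zero D X E)"
proof
  assume "below i \<phi> E" then show "\<forall>X. above i \<phi> X \<longrightarrow> hom_zero D X E" using above_below_hom assms by blast
next
  assume *: "\<forall>X. above i \<phi> X \<longrightarrow> hom_zero D X E"
  show "below i \<phi> E" unfolding below_def
  proof (intro conjI ballI impI, rule assms(1), rule ccontr)
    fix K Q assume KQ: "K \<in> block i" "Q \<in> block i" "fits_triangle D K E Q" "\<not> height \<phi> (z K) \<le> 0"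
    then obtain X C where X: "fits_triangle D X K C" "C \<in> block i" "above i \<phi> X" "\<not> zero_object D X"
      using above_subobject_exists[of K i \<phi>] by auto
    obtain W where W: "fits_triangle D X E W" "fits_triangle D C W Q"
      using fits_assoc_left[OF X(1) KQ(3)] .
    show False
      using sub_hom_nonzero[OF above_block[OF X(3)] block_ext[OF X(2) KQ(2) W(2)] W(1)] * X(3,4) by blast
  qed
qed

lemma above_iff_hom:
  assumes "X \<in> block i" "cut i < \<phi>" "\<phi> \<le> cut (i + 1)"
  shows "above i \<phi> X \<longleftrightarrow> (\<forall>E. below i \<phi> E \<longrightarrow> hom_zero D X E)"
proof
  assume "above i \<phi> X" then show "\<forall>E. below i \<phi> E \<longrightarrow> hom_zero D X E" using above_below_hom assms by blast
next
  assume *: "\<forall>E. below i \<phi> E \<longrightarrow> hom_zero D X E"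
  show "above i \<phi> X" unfolding above_def
  proof (intro conjI ballI impI, rule assms(1), rule ccontr)
    fix K Q assume KQ: "K \<in> block i" "Q \<in> block i" "fits_triangle D K X Q" "\<not> zero_object D Q"
      "\<not> 0 < height \<phi> (z Q)"
    then obtain K' Y where Y: "fits_triangle D K' Q Y" "K' \<in> block i" "below i \<phi> Y" "\<not> zero_object D Y"
      using below_quotient_exists[of Q i \<phi>] by auto
    obtain W where W: "fits_triangle D W X Y" "fits_triangle D K W K'"
      using fits_assoc_right[OF KQ(3) Y(1)] .
    show False
      using quotient_hom_nonzero[OF block_ext[OF KQ(1) Y(2) W(2)] below_block[OF Y(3)] W(1)] * Y(3,4) by blast
  qed
qed

lemma below_ext:
  assumes "below i \<phi> A" "below i \<phi> C" "fits_triangle D A E C" "cut i < \<phi>" "\<phi> \<le> cut (i + 1)"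
  shows "below i \<phi> E"
  using assms below_iff_hom block_ext[OF below_block below_block] fits_hom_zero_right[OF assms(3)] below_block by meson

lemma above_ext:
  assumes "above i \<phi> A" "above i \<phi> C" "fits_triangle D A E C" "cut i < \<phi>" "\<phi> \<le> cut (i + 1)"
  shows "above i \<phi> E"
  using assms above_iff_hom block_ext[OF above_block above_block] fits_hom_zero_left[OF assms(3)] above_block by meson

lemma below_sub:
  assumes "below i \<phi> E" "X \<in> block i" "Y \<in> block i" "fits_triangle D X E Y"
  shows "below i \<phi> X"
  unfolding below_def
proof (intro conjI ballI impI)
  fix K Q assume KQ: "K \<in> block i" "Q \<in> block i" "fits_triangle D K X Q"
  obtain W where W: "fits_triangle D K E W" "fits_triangle D Q W Y"
    using fits_assoc_left[OF KQ(3) assms(4)] .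
  then show "height \<phi> (z K) \<le> 0"
    using assms(1) KQ(1) block_ext[OF KQ(2) assms(3) W(2)] unfolding below_def by blast
qed (rule assms(2))

lemma above_quotient:
  assumes "above i \<phi> E" "X \<in> block i" "Y \<in> block i" "fits_triangle D X E Y"
  shows "above i \<phi> Y"
  unfolding above_def
proof (intro conjI ballI impI)
  fix K Q assume KQ: "K \<in> block i" "Q \<in> block i" "fits_triangle D K Y Q" "\<not> zero_object D Q"
  obtain W where W: "fits_triangle D W E Q" "fits_triangle D X W K"
    using fits_assoc_right[OF assms(4) KQ(3)] .
  then show "0 < height \<phi> (z Q)"
    using assms(1) KQ(2,4) block_ext[OF assms(2) KQ(1) W(2)] unfolding above_def by blast
qed (rule assms(3))

lemma above_zero: assumes "zero_object D X" shows "above i \<phi> X"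
  unfolding above_def
proof (intro conjI ballI impI)
  fix K Q assume KQ: "K \<in> block i" "Q \<in> block i" "fits_triangle D K X Q" "\<not> zero_object D Q"
  have "zero_object D Q"
    using quotient_hom_nonzero[OF KQ(1-3)] zero_hom_zero(2)[OF assms block_Obj[OF KQ(2)]] by blast
  then show "0 < height \<phi> (z Q)" using KQ(4) by blast
qed (rule block_zero[OF assms])

lemma below_zero: assumes "zero_object D X" shows "below i \<phi> X"
  unfolding below_def
proof (intro conjI ballI impI)
  fix K Q assume KQ: "K \<in> block i" "Q \<in> block i" "fits_triangle D K X Q"
  have "zero_object D K"
    using sub_hom_nonzero[OF KQ] zero_hom_zero(1)[OF assms block_Obj[OF KQ(1)]] by blast
  then show "height \<phi> (z K) \<le> 0" by (simp add: z_zero)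
qed (rule block_zero[OF assms])

lemma below_iso:
  assumes "below i \<phi> A" "isomorphic D A B" shows "below i \<phi> B"
proof -
  obtain Z where Z: "zero_object D Z" using zero_object_exists by blast
  have "B \<in> block i" using replete_mem[OF block_replete below_block[OF assms(1)] assms(2)] .
  then show ?thesis
    using below_sub[OF assms(1) _ block_zero[OF Z] fits_zero_right[OF isomorphic_sym[OF assms(2)] Z]] by blast
qed

text \<open>
  Subobjects all of whose quotients have phase above \<open>\<phi>\<close> are split off one after the other until none is
  left.
\<close>

lemma torsion_pair:
  assumes "E \<in> block i" "cut i < \<phi>" "\<phi> \<le> cut (i + 1)"
  obtains X Y where "above i \<phi> X" "below i \<phi> Y" "fits_triangle D X E Y"
proof -
  have "\<exists>X Y. above i \<phi> X \<and> below i \<phi> Y \<and> fits_triangle D X E Y"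
    if "E \<in> block i" "height (mid i) (z E) < real n * gap i" for n E
    using that
  proof (induct n arbitrary: E)
    case 0
    then show ?case using gap_le_height[of E i] gap_pos[of i] z_zero[of E] by force
  next
    case (Suc n)
    show ?case
    proof (cases "below i \<phi> E")
      case True
      obtain Z where Z: "zero_object D Z" using zero_object_exists by blast
      show ?thesis using fits_self_zero(1)[OF block_Obj[OF Suc.prems(1)] Z] True above_zero[OF Z] by blast
    next
      case False
      then obtain K Q where KQ: "K \<in> block i" "Q \<in> block i" "fits_triangle D K E Q" "0 < height \<phi> (z K)"
        using Suc.prems(1) unfolding below_def by force
      obtain X' C' where X': "fits_triangle D X' K C'" "C' \<in> block i" "above i \<phi> X'" "\<not> zero_object D X'"
        using above_subobject_exists[OF KQ(1,4)] .
      obtain C where C: "fits_triangle D X' E C" "fits_triangle D C' C Q"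
        using fits_assoc_left[OF X'(1) KQ(3)] .
      have Cb: "C \<in> block i" using block_ext[OF X'(2) KQ(2) C(2)] .
      have "height (mid i) (z C) < real n * gap i"
        using z_additive[OF C(1)] gap_le_height[OF above_block[OF X'(3)] X'(4)] Suc.prems(2)
        by (simp add: height_add algebra_simps)
      then obtain X'' Y where Y: "above i \<phi> X''" "below i \<phi> Y" "fits_triangle D X'' C Y"
        using Suc.hyps Cb by blast
      obtain W where W: "fits_triangle D W E Y" "fits_triangle D X' W X''"
        using fits_assoc_right[OF C(1) Y(3)] .
      then show ?thesis using above_ext[OF X'(3) Y(1) W(2) assms(2,3)] Y(2) by blast
    qed
  qed
  moreover obtain n where "height (mid i) (z E) < real n * gap i"
    using reals_Archimedean3[OF gap_pos[of i], rule_format, of "height (mid i) (z E)"] by blast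
  ultimately show thesis using that assms by blast
qed

subsection \<open>Semistable objects\<close>

text \<open>
  Vanishing height means that the phase is \<open>\<phi>\<close>, in the sense that the charge lies on the ray; the index \<open>i\<close>
  is determined by \<open>\<phi>\<close>. The zero object is included.
\<close>

definition semistable :: "real \<Rightarrow> 'o set" where
  "semistable \<phi> = {E. \<exists>i. cut i < \<phi> \<and> \<phi> \<le> cut (i + 1) \<and> below i \<phi> E \<and> height \<phi> (z E) = 0}"

lemma semistable_iff:
  assumes "cut i < \<phi>" "\<phi> \<le> cut (i + 1)"
  shows "E \<in> semistable \<phi> \<longleftrightarrow> below i \<phi> E \<and> height \<phi> (z E) = 0"
  using assms cut_block_unique[OF assms] unfolding semistable_def by blast

lemma semistableE:
  assumes "E \<in> semistable \<phi>"
  obtains i where "cut i < \<phi>" "\<phi> \<le> cut (i + 1)" "below i \<phi> E" "height \<phi> (z E) = 0"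
  using assms unfolding semistable_def by blast

lemma semistable_Obj: "E \<in> semistable \<phi> \<Longrightarrow> E \<in> Obj D"
  using block_Obj below_block by (meson semistableE)

lemma semistable_replete: "replete D (semistable \<phi>)"
proof -
  have "B \<in> semistable \<phi>" if A: "A \<in> semistable \<phi>" and AB: "isomorphic D A B" for A B
  proof -
    obtain i where i: "cut i < \<phi>" "\<phi> \<le> cut (i + 1)" "below i \<phi> A" "height \<phi> (z A) = 0"
      using semistableE[OF A] .
    then show ?thesis using semistable_iff[OF i(1,2)] below_iso[OF i(3) AB] z_iso[OF AB] by simp
  qed
  then show ?thesis unfolding replete_def using semistable_Obj by blast
qed

lemma semistable_zero: "zero_object D X \<Longrightarrow> X \<in> semistable \<phi>"
  using cut_cover[of \<phi>] below_zero z_zero unfolding semistable_def by force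

lemma semistable_ext:
  assumes "A \<in> semistable \<phi>" "C \<in> semistable \<phi>" "fits_triangle D A E C" shows "E \<in> semistable \<phi>"
proof -
  obtain i where i: "cut i < \<phi>" "\<phi> \<le> cut (i + 1)" using cut_cover by blast
  show ?thesis
    using assms below_ext[OF _ _ assms(3) i] z_additive[OF assms(3)] unfolding semistable_iff[OF i]
    by (simp add: height_add)
qed

lemma semistable_additive: "additive_subcategory D (semistable \<phi>)"
  unfolding additive_subcategory_def
  using semistable_replete semistable_zero zero_object_exists semistable_ext biproduct_fits by blast

lemma height_antimono:
  assumes "E \<in> block i" "\<not> zero_object D E" "cut i < \<psi>" "\<psi> < \<phi>" "\<phi> \<le> cut (i + 1)" "0 \<le> height \<phi> (z E)"
  shows "0 < height \<psi> (z E)"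
proof (rule height_mono[OF _ assms(4) _ _ assms(6)])
  show "mid i < \<psi>" "\<phi> < mid i + 1" using mid_bounds[of i] assms by linarith+
  show "0 < height (mid i) (z E)" using gap_le_height[OF assms(1,2)] gap_pos[of i] by linarith
qed

text \<open>
  For a quotient \<open>Q\<close> of a semistable object, the kernel has nonpositive height above \<open>\<phi>\<close>, hence \<open>Q\<close> has
  nonnegative height.
\<close>

lemma semistable_above:
  assumes "below i \<phi> A" "height \<phi> (z A) = 0" "cut i < \<psi>" "\<psi> < \<phi>" "\<phi> \<le> cut (i + 1)"
  shows "above i \<psi> A"
  unfolding above_def
proof (intro conjI ballI impI)
  fix K Q assume KQ: "K \<in> block i" "Q \<in> block i" "fits_triangle D K A Q" "\<not> zero_object D Q"
  have "height \<phi> (z K) \<le> 0" using assms(1) KQ unfolding below_def by blast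
  then have "0 \<le> height \<phi> (z Q)" using z_additive[OF KQ(3)] assms(2) by (simp add: height_add)
  then show "0 < height \<psi> (z Q)" using height_antimono KQ(2,4) assms(3-5) by blast
qed (rule below_block[OF assms(1)])

lemma semistable_hom:
  assumes "\<psi> < \<phi>" "A \<in> semistable \<phi>" "B \<in> semistable \<psi>" shows "hom_zero D A B"
proof -
  obtain i where i: "cut i < \<phi>" "\<phi> \<le> cut (i + 1)" "below i \<phi> A" "height \<phi> (z A) = 0" using semistableE[OF assms(2)] .
  obtain j where j: "cut j < \<psi>" "\<psi> \<le> cut (j + 1)" "below j \<psi> B" using semistableE[OF assms(3)] by metis
  show ?thesis
  proof (cases "i = j")
    case True
    then have "above i \<psi> A" using semistable_above[OF i(3,4)] j(1) assms(1) i(2) by blast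
    then show ?thesis using above_below_hom j True by blast
  next
    case False
    moreover have "\<not> i < j" using cut_le[of "i + 1" j] i j assms(1) by linarith
    ultimately have "A \<in> U (j + 1)" using U_weaken[OF block_U[OF below_block[OF i(3)]]] by simp
    then show ?thesis using UV_hom block_V[OF below_block[OF j(3)]] by blast
  qed
qed

lemma below_Sh: assumes "below i \<phi> E" shows "below (i + 2) (\<phi> + 1) (Sh D 1 E)"
  unfolding below_def
proof (intro conjI ballI impI)
  show "Sh D 1 E \<in> block (i + 2)" using block_Sh[OF below_block[OF assms]] .
  fix K Q assume KQ: "K \<in> block (i + 2)" "Q \<in> block (i + 2)" "fits_triangle D K (Sh D 1 E) Q"
  have "fits_triangle D (Sh D (-1) K) E (Sh D (-1) Q)"
    using fits_Sh_back[OF KQ(3)] block_Obj[OF below_block[OF assms]] by simp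
  moreover have "Sh D (-1) K \<in> block i" "Sh D (-1) Q \<in> block i"
    using block_Sh_back[OF KQ(1)] block_Sh_back[OF KQ(2)] by simp_all
  ultimately have "height \<phi> (z (Sh D (-1) K)) \<le> 0" using assms unfolding below_def by blast
  moreover have "z K = - z (Sh D (-1) K)"
    using z_Sh[of "Sh D (-1) K"] block_Obj[OF KQ(1)] by simp
  ultimately show "height (\<phi> + 1) (z K) \<le> 0" by (simp add: height_plus_1 height_minus)
qed

lemma below_Sh_back: assumes "below (i + 2) (\<phi> + 1) E" shows "below i \<phi> (Sh D (-1) E)"
  unfolding below_def
proof (intro conjI ballI impI)
  note E = below_block[OF assms]
  show "Sh D (-1) E \<in> block i" using block_Sh_back[OF E] by simp
  fix K Q assume KQ: "K \<in> block i" "Q \<in> block i" "fits_triangle D K (Sh D (-1) E) Q"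
  have "fits_triangle D (Sh D 1 K) E (Sh D 1 Q)"
    using fits_Sh[OF KQ(3)] block_Obj[OF E] by simp
  then have "height (\<phi> + 1) (z (Sh D 1 K)) \<le> 0"
    using assms block_Sh[OF KQ(1)] block_Sh[OF KQ(2)] unfolding below_def by blast
  then show "height \<phi> (z K) \<le> 0"
    using z_Sh[OF block_Obj[OF KQ(1)]] by (simp add: height_plus_1 height_minus)
qed

lemma semistable_Sh: "Sh D 1 ` semistable \<phi> = semistable (\<phi> + 1)"
proof -
  obtain i where i: "cut i < \<phi>" "\<phi> \<le> cut (i + 1)" using cut_cover by blast
  have i2: "cut (i + 2) < \<phi> + 1" "\<phi> + 1 \<le> cut (i + 2 + 1)"
    using i cut_period[of i] cut_period[of "i + 1"] by (simp_all add: add.commute add.left_commute)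
  note iff = semistable_iff[OF i] and iff2 = semistable_iff[OF i2]
  have "Sh D 1 E \<in> semistable (\<phi> + 1)" if "E \<in> semistable \<phi>" for E
    using that below_Sh z_Sh[OF semistable_Obj[OF that]] unfolding iff iff2 by (simp add: height_plus_1 height_minus)
  moreover have "E \<in> Sh D 1 ` semistable \<phi>" if E: "E \<in> semistable (\<phi> + 1)" for E
  proof -
    have "z E = - z (Sh D (-1) E)" using z_Sh[of "Sh D (-1) E"] semistable_Obj[OF E] by simp
    then have "Sh D (-1) E \<in> semistable \<phi>"
      using E below_Sh_back unfolding iff iff2 by (simp add: height_plus_1 height_minus)
    moreover have "Sh D 1 (Sh D (-1) E) = E" using semistable_Obj[OF E] by simp
    ultimately show ?thesis by (metis imageI)
  qed
  ultimately show ?thesis by blast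
qed

text \<open>
  The lower bound does not depend on the block, since \<open>gap\<close> has period two.
\<close>

lemma semistable_ray:
  assumes "E \<in> semistable \<phi>" "\<not> zero_object D E"
  shows "\<exists>m>0. z E = ray m \<phi>" "min (gap 0) (gap 1) \<le> cmod (z E)"
proof -
  obtain i where i: "cut i < \<phi>" "\<phi> \<le> cut (i + 1)" "below i \<phi> E" "height \<phi> (z E) = 0" using semistableE[OF assms(1)] .
  have h: "gap i \<le> height (mid i) (z E)" using gap_le_height[OF below_block[OF i(3)] assms(2)] .
  show "\<exists>m>0. z E = ray m \<phi>"
    by (rule height_0_ray[OF i(4), of "mid i"]) (use h gap_pos[of i] mid_bounds[of i] i in linarith)+
  have "gap (int n) \<in> {gap 0, gap 1} \<and> gap (- int n) \<in> {gap 0, gap 1}" for n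
  proof (induct n rule: less_induct)
    case (less n)
    consider "n = 0" | "n = 1" | m where "n = m + 2" by (metis One_nat_def add_2_eq_Suc' not0_implies_Suc)
    then show ?case
    proof cases
      case 2 then show ?thesis using gap_period[of "-1"] by simp
    next
      case (3 m)
      then show ?thesis using less[of m] gap_period[of "int m"] gap_period[of "- int m - 2"] by (simp add: add.commute)
    qed simp
  qed
  then have "gap i \<in> {gap 0, gap 1}" by (metis int_cases2)
  then show "min (gap 0) (gap 1) \<le> cmod (z E)" using h height_le_cmod[of "mid i" "z E"] by auto
qed

subsection \<open>Harder-Narasimhan filtrations\<close>

text \<open>
  A non-semistable object of the block is cut by the torsion pair at its own phase into two shorter
  objects. The conclusions on \<open>above\<close> and \<open>below\<close> make the phases of the two filtrations fit together.
\<close>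

lemma HN_in_block:
  assumes "E \<in> block i"
  obtains l where "sorted_wrt (<) l" "set l \<subseteq> {cut i<..cut (i + 1)}" "filtered D semistable l E"
proof -
  have "\<exists>l. sorted_wrt (<) l \<and> set l \<subseteq> {cut i<..cut (i + 1)} \<and> filtered D semistable l E \<and>
      (\<forall>\<psi>. cut i < \<psi> \<longrightarrow> \<psi> \<le> cut (i + 1) \<longrightarrow>
        (above i \<psi> E \<longrightarrow> (\<forall>x\<in>set l. \<psi> < x)) \<and> (below i \<psi> E \<longrightarrow> (\<forall>x\<in>set l. x \<le> \<psi>)))"
    if "E \<in> block i" "height (mid i) (z E) < real n * gap i" for n E
    using that
  proof (induct n arbitrary: E)
    case 0
    then have "zero_object D E" using gap_le_height[of E i] gap_pos[of i] by force
    then show ?case by (intro exI[of _ "[]"]) simp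
  next
    case (Suc n)
    note E = Suc.prems(1)
    obtain Z where Z: "zero_object D Z" using zero_object_exists by blast
    note selfz = fits_self_zero[OF block_Obj[OF E] Z]
    show ?case
    proof (cases "zero_object D E")
      case True
      then show ?thesis by (intro exI[of _ "[]"]) simp
    next
      case nz: False
      obtain \<phi> where \<phi>: "cut i < \<phi>" "\<phi> \<le> cut (i + 1)" "height \<phi> (z E) = 0"
        using phase_exists[OF E nz] .
      show ?thesis
      proof (cases "below i \<phi> E")
        case True
        have "filtered D semistable [\<phi>] E" using semistable_iff[OF \<phi>(1,2)] True \<phi>(3) Z selfz(1) by auto
        moreover have "\<psi> < \<phi>" if \<psi>: "cut i < \<psi>" "\<psi> \<le> cut (i + 1)" "above i \<psi> E" for \<psi>
        proof (rule ccontr)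
          assume "\<not> \<psi> < \<phi>"
          moreover have "0 < height \<psi> (z E)"
            using \<psi>(3) E nz selfz(1) block_zero[OF Z] unfolding above_def by blast
          ultimately show False
            using height_antimono[OF E nz \<phi>(1), of \<psi>] \<psi> \<phi>(3) by (cases "\<psi> = \<phi>") auto
        qed
        moreover have "\<phi> \<le> \<psi>" if \<psi>: "cut i < \<psi>" "\<psi> \<le> cut (i + 1)" "below i \<psi> E" for \<psi>
        proof (rule ccontr)
          assume "\<not> \<phi> \<le> \<psi>"
          then have "\<psi> < \<phi>" by simp
          then have "0 < height \<psi> (z E)"
            by (rule height_antimono[OF E nz \<psi>(1) _ \<phi>(2)]) (simp add: \<phi>(3))
          moreover have "height \<psi> (z E) \<le> 0"
            using \<psi>(3) E selfz(2) block_zero[OF Z] unfolding below_def by blast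
          ultimately show False by simp
        qed
        ultimately show ?thesis using \<phi>(1,2) by (intro exI[of _ "[\<phi>]"]) simp
      next
        case nle: False
        obtain X Y where XY: "above i \<phi> X" "below i \<phi> Y" "fits_triangle D X E Y"
          using torsion_pair[OF E \<phi>(1,2)] .
        note X = above_block[OF XY(1)] and Y = below_block[OF XY(2)]
        have Xnz: "\<not> zero_object D X"
          using nle below_iso[OF XY(2) isomorphic_sym[OF zero_left_iso[OF XY(3)]]] by blast
        have Ynz: "\<not> zero_object D Y"
        proof
          assume Y0: "zero_object D Y"
          have "0 < height \<phi> (z X)"
            using XY(1) X Xnz fits_self_zero(1)[OF block_Obj[OF X] Z] block_zero[OF Z] unfolding above_def by blast
          then show False using z_additive[OF XY(3)] z_zero[OF Y0] \<phi>(3) by simp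
        qed
        have hX: "height (mid i) (z X) < real n * gap i" and hY: "height (mid i) (z Y) < real n * gap i"
          using z_additive[OF XY(3)] gap_le_height[OF X Xnz] gap_le_height[OF Y Ynz] Suc.prems(2)
          by (simp_all add: height_add algebra_simps)
        obtain k where
          k: "sorted_wrt (<) k" "set k \<subseteq> {cut i<..cut (i + 1)}" "filtered D semistable k X"
            "\<And>\<psi>. cut i < \<psi> \<Longrightarrow> \<psi> \<le> cut (i + 1) \<Longrightarrow> above i \<psi> X \<Longrightarrow> \<forall>x\<in>set k. \<psi> < x"
            "\<And>\<psi>. cut i < \<psi> \<Longrightarrow> \<psi> \<le> cut (i + 1) \<Longrightarrow> below i \<psi> X \<Longrightarrow> \<forall>x\<in>set k. x \<le> \<psi>"
          using Suc.hyps[OF X hX] by blast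
        obtain l where
          l: "sorted_wrt (<) l" "set l \<subseteq> {cut i<..cut (i + 1)}" "filtered D semistable l Y"
            "\<And>\<psi>. cut i < \<psi> \<Longrightarrow> \<psi> \<le> cut (i + 1) \<Longrightarrow> above i \<psi> Y \<Longrightarrow> \<forall>x\<in>set l. \<psi> < x"
            "\<And>\<psi>. cut i < \<psi> \<Longrightarrow> \<psi> \<le> cut (i + 1) \<Longrightarrow> below i \<psi> Y \<Longrightarrow> \<forall>x\<in>set l. x \<le> \<psi>"
          using Suc.hyps[OF Y hY] by blast
        have k\<phi>: "\<forall>x\<in>set k. \<phi> < x" and l\<phi>: "\<forall>x\<in>set l. x \<le> \<phi>" using k(4) l(5) \<phi> XY by blast+
        obtain x y where xy: "x \<in> set k" "y \<in> set l"
          using k(3) l(3) Xnz Ynz by (metis filtered.simps(1) list.set_intros(1) neq_Nil_conv)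
        have "sorted_wrt (<) (l @ k)"
          using k(1) l(1) k\<phi> l\<phi> by (force simp: sorted_wrt_append)
        moreover have "filtered D semistable (l @ k) E" using filtered_append[OF l(3) k(3) XY(3)] .
        moreover have "\<forall>x\<in>set (l @ k). \<psi> < x" if \<psi>: "cut i < \<psi>" "\<psi> \<le> cut (i + 1)" "above i \<psi> E" for \<psi>
        proof -
          have 1: "\<forall>x\<in>set l. \<psi> < x" using l(4)[OF \<psi>(1,2)] above_quotient[OF \<psi>(3) X Y XY(3)] by blast
          then have "\<psi> < y" "y \<le> \<phi>" using xy l\<phi> by blast+
          then show ?thesis using 1 k\<phi> by force
        qed
        moreover have "\<forall>x\<in>set (l @ k). x \<le> \<psi>" if \<psi>: "cut i < \<psi>" "\<psi> \<le> cut (i + 1)" "below i \<psi> E" for \<psi>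
        proof -
          have 1: "\<forall>x\<in>set k. x \<le> \<psi>" using k(5)[OF \<psi>(1,2)] below_sub[OF \<psi>(3) X Y XY(3)] by blast
          then have "x \<le> \<psi>" "\<phi> < x" using xy k\<phi> by blast+
          then show ?thesis using 1 l\<phi> by force
        qed
        ultimately show ?thesis using k(2) l(2) by (intro exI[of _ "l @ k"]) simp
      qed
    qed
  qed
  moreover obtain n where "height (mid i) (z E) < real n * gap i"
    using reals_Archimedean3[OF gap_pos[of i], rule_format, of "height (mid i) (z E)"] by blast
  ultimately show thesis using that assms by blast
qed

text \<open>
  Truncation at the last cut but one splits off the part in the last block.
\<close>

lemma HN_between_cuts:
  assumes "E \<in> U i" "E \<in> V (i + int n)"
  obtains l where "sorted_wrt (<) l" "set l \<subseteq> {cut i<..cut (i + int n)}" "filtered D semistable l E"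
  using assms
proof (induct n arbitrary: E thesis)
  case 0
  then have "zero_object D E" using UV_zero_object by simp
  then show ?case using 0(1)[of "[]"] by simp
next
  case (Suc n)
  let ?j = "i + int n"
  have EV: "E \<in> V (?j + 1)" using Suc.prems(3) by (simp add: algebra_simps)
  obtain X Y where XY: "X \<in> U ?j" "Y \<in> V ?j" "fits_triangle D X E Y"
    using UV_truncation[of E ?j] UV_replete(1) Suc.prems(2) unfolding replete_def by blast
  have "X \<in> V (?j + 1)"
    using V_ext[OF V_weaken[OF V_Sh_back[OF XY(2)]] EV fits_rotate_back[OF XY(3)]] by simp
  then obtain k where k: "sorted_wrt (<) k" "set k \<subseteq> {cut ?j<..cut (?j + 1)}" "filtered D semistable k X"
    using HN_in_block blockI XY(1) by blast
  have "Y \<in> U i" using U_ext[OF Suc.prems(2) U_weaken[OF U_Sh[OF XY(1)]] fits_rotate[OF XY(3)]] by simp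
  then obtain l where l: "sorted_wrt (<) l" "set l \<subseteq> {cut i<..cut ?j}" "filtered D semistable l Y"
    using Suc.hyps XY(2) by metis
  have c: "cut i \<le> cut ?j" "cut ?j < cut (?j + 1)" using cut_le[of i ?j] cut_step by simp_all
  have lk: "x < y" if "x \<in> set l" "y \<in> set k" for x y
  proof -
    have "x \<le> cut ?j" "cut ?j < y" using subsetD[OF l(2) that(1)] subsetD[OF k(2) that(2)] by simp_all
    then show ?thesis by simp
  qed
  have "sorted_wrt (<) (l @ k)" using k(1) l(1) lk by (simp add: sorted_wrt_append)
  moreover have "x \<in> {cut i<..cut (?j + 1)}" if "x \<in> set (l @ k)" for x
    using that subsetD[OF l(2), of x] subsetD[OF k(2), of x] c by auto
  then have "set (l @ k) \<subseteq> {cut i<..cut (i + int (Suc n))}" by (auto simp: algebra_simps)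
  ultimately show ?case using Suc.prems(1) filtered_append[OF l(3) k(3) XY(3)] by blast
qed

lemma ext_closure_semistable:
  assumes "i < j" shows "ext_closure D (\<Union>\<phi>\<in>{cut i<..cut j}. semistable \<phi>) = U i \<inter> V j"
proof
  show "ext_closure D (\<Union>\<phi>\<in>{cut i<..cut j}. semistable \<phi>) \<subseteq> U i \<inter> V j"
  proof (rule ext_closure_minimal)
    show "(\<Union>\<phi>\<in>{cut i<..cut j}. semistable \<phi>) \<subseteq> U i \<inter> V j"
    proof clarify
      fix \<phi> E assume \<phi>: "\<phi> \<in> {cut i<..cut j}" and E: "E \<in> semistable \<phi>"
      obtain k where k: "cut k < \<phi>" "\<phi> \<le> cut (k + 1)" "below k \<phi> E" using semistableE[OF E] by metis
      have "\<not> k + 1 \<le> i" "\<not> j \<le> k" using cut_le[of "k + 1" i] cut_le[of j k] \<phi> k by force+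
      then have "i \<le> k" "k + 1 \<le> j" by simp_all
      then show "E \<in> U i \<inter> V j"
        using U_weaken[OF block_U[OF below_block[OF k(3)]]] V_weaken[OF block_V[OF below_block[OF k(3)]]] by blast
    qed
  qed (use U_ext V_ext in blast)
  show "U i \<inter> V j \<subseteq> ext_closure D (\<Union>\<phi>\<in>{cut i<..cut j}. semistable \<phi>)"
  proof
    fix E assume E: "E \<in> U i \<inter> V j"
    have j: "j = i + int (nat (j - i))" using assms by simp
    obtain l where l: "set l \<subseteq> {cut i<..cut j}" "filtered D semistable l E"
      using HN_between_cuts[of E i "nat (j - i)"] E j by (metis IntD1 IntD2)
    show "E \<in> ext_closure D (\<Union>\<phi>\<in>{cut i<..cut j}. semistable \<phi>)"
      by (rule filtered_ext_closure[OF l(2,1)]) (use cut_less[OF assms] semistable_zero in auto)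
  qed
qed

lemma HN_exists:
  assumes "E \<in> Obj D" obtains n F A \<phi> where "HN_filtration D semistable E n F A \<phi>"
proof -
  obtain i j where ij: "E \<in> U i" "E \<in> V j" using UV_bounded[OF assms] by blast
  have "E \<in> V (i + int (nat (j - i)))" by (rule V_weaken[OF ij(2)]) simp
  then obtain l where l: "sorted_wrt (<) l" "filtered D semistable l E" using HN_between_cuts[OF ij(1)] by metis
  obtain F A \<phi> where "HN_filtration D semistable E (length l) F A \<phi>"
    using filtered_HN_filtration[OF l(2,1)] by blast
  then show thesis by (rule that)
qed

theorem stability_condition_exists:
  obtains \<sigma> where "stability_condition D \<sigma>" "reasonable D \<sigma>" "slice \<sigma> = semistable"
    "\<And>E. E \<in> Obj D \<Longrightarrow> Z_of D \<sigma> E = z E"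
proof -
  obtain ch where ch: "ch \<in> hom (K0 D) complex_group" "\<And>E. E \<in> Obj D \<Longrightarrow> ch (K0_class D E) = z E"
    using additive_charge_exists z_additive by metis
  let ?\<sigma> = "\<lparr>charge = ch, slice = semistable\<rparr>"
  have Z: "Z_of D ?\<sigma> E = z E" if "E \<in> Obj D" for E using ch(2)[OF that] by (simp add: Z_of_def)
  have ray: "\<exists>m::real. m > 0 \<and> Z_of D ?\<sigma> E = of_real m * exp (\<i> * of_real pi * of_real \<phi>)"
    if "E \<in> semistable \<phi>" "\<not> zero_object D E" for E \<phi>
    using semistable_ray(1)[OF that] Z[OF semistable_Obj[OF that(1)]] unfolding ray_def by simp
  have "stability_condition D ?\<sigma>"
    unfolding stability_condition_def
  proof (intro conjI allI impI ballI)
    show "\<exists>n F A \<phi>. HN_filtration D (slice ?\<sigma>) E n F A \<phi>" if "E \<in> Obj D" for E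
      using HN_exists[OF that] by (metis stab.select_convs(2))
  qed (use ch(1) semistable_additive semistable_Sh semistable_hom ray in simp_all)
  moreover have "reasonable D ?\<sigma>"
  proof -
    let ?A = "{E. \<not> zero_object D E \<and> (\<exists>\<phi>. E \<in> slice ?\<sigma> \<phi>)}"
    have 1: "ereal (min (gap 0) (gap 1)) \<le> (INF E\<in>?A. ereal (cmod (Z_of D ?\<sigma> E)))"
    proof (rule INF_greatest)
      fix E assume "E \<in> ?A"
      then obtain \<phi> where E: "E \<in> semistable \<phi>" "\<not> zero_object D E" by auto
      have "min (gap 0) (gap 1) \<le> cmod (Z_of D ?\<sigma> E)"
        using semistable_ray(2)[OF E] Z[OF semistable_Obj[OF E(1)]] by simp
      then show "ereal (min (gap 0) (gap 1)) \<le> ereal (cmod (Z_of D ?\<sigma> E))"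
        by (simp only: ereal_less_eq(3))
    qed
    have "0 < ereal (min (gap 0) (gap 1))" using gap_pos by simp
    then show ?thesis unfolding reasonable_def using 1 by (rule less_le_trans)
  qed
  ultimately show thesis using that Z by simp
qed

end

section \<open>Gluing two slicings\<close>

text \<open>
  The data of the theorem, for an increasing sequence of cuts with period two. In \<open>cut_hom\<close>, the bound
  \<open>cut i + 1\<close> instead of \<open>cut i\<close> provides the vanishing with a shift by one, as needed to merge truncations.
\<close>

locale gluing = triangulated_category D +
  one: slicing_on D S\<^sub>1 P\<^sub>1 z\<^sub>1 \<epsilon> + two: slicing_on D S\<^sub>2 P\<^sub>2 z\<^sub>2 \<epsilon>
  for D :: "('o, 'm) tricat" (structure) and S\<^sub>1 S\<^sub>2 P\<^sub>1 P\<^sub>2 z\<^sub>1 z\<^sub>2 \<epsilon> +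
  fixes cut :: "int \<Rightarrow> real"
  assumes semiorthogonal: "E\<^sub>2 \<in> S\<^sub>2 \<Longrightarrow> E\<^sub>1 \<in> S\<^sub>1 \<Longrightarrow> hom_zero D E\<^sub>2 E\<^sub>1"
    and decomposition: "E \<in> Obj D \<Longrightarrow> \<exists>E\<^sub>1\<in>S\<^sub>1. \<exists>E\<^sub>2\<in>S\<^sub>2. fits_triangle D E\<^sub>2 E E\<^sub>1"
    and cut_step: "cut i < cut (i + 1)" and cut_period: "cut (i + 2) = cut i + 1"
    and cut_cover: "\<exists>i. cut i < \<phi> \<and> \<phi> \<le> cut (i + 1)"
    and cut_hom: "cut i < \<phi> \<Longrightarrow> \<psi> \<le> cut i + 1 \<Longrightarrow> A \<in> P\<^sub>1 \<phi> \<Longrightarrow> B \<in> P\<^sub>2 \<psi> \<Longrightarrow> hom_zero D A B"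
    and \<epsilon>_pos: "0 < \<epsilon>"
begin

text \<open>
  The heart of the glued stability condition is obtained for the interval \<open>(0, 1]\<close>.
\<close>

definition glued_phases :: "real set \<Rightarrow> 'o set" where
  "glued_phases I = {E. \<exists>E\<^sub>2\<in>two.phases I. \<exists>E\<^sub>1\<in>one.phases I. fits_triangle D E\<^sub>2 E E\<^sub>1}"

definition glued_charge :: "'o \<Rightarrow> complex" where
  "glued_charge E = z\<^sub>1 (lam\<^sub>1 D S\<^sub>1 S\<^sub>2 E) + z\<^sub>2 (rho\<^sub>2 D S\<^sub>1 S\<^sub>2 E)"

subsection \<open>The decomposition triangle\<close>

lemma decomposition_unique:
  assumes "fits_triangle D E\<^sub>2 E E\<^sub>1" "fits_triangle D F\<^sub>2 E F\<^sub>1"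
    "E\<^sub>1 \<in> S\<^sub>1" "F\<^sub>1 \<in> S\<^sub>1" "E\<^sub>2 \<in> S\<^sub>2" "F\<^sub>2 \<in> S\<^sub>2"
  shows "isomorphic D E\<^sub>2 F\<^sub>2" "isomorphic D E\<^sub>1 F\<^sub>1"
  using truncation_unique[OF assms(1,2)] assms semiorthogonal sub_Sh[OF one.S_sub] by blast+

lemma lam_rho:
  assumes "E \<in> Obj D"
  shows "lam\<^sub>1 D S\<^sub>1 S\<^sub>2 E \<in> S\<^sub>1" "\<exists>E\<^sub>2\<in>S\<^sub>2. fits_triangle D E\<^sub>2 E (lam\<^sub>1 D S\<^sub>1 S\<^sub>2 E)"
    "rho\<^sub>2 D S\<^sub>1 S\<^sub>2 E \<in> S\<^sub>2" "\<exists>E\<^sub>1\<in>S\<^sub>1. fits_triangle D (rho\<^sub>2 D S\<^sub>1 S\<^sub>2 E) E E\<^sub>1"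
proof -
  have "lam\<^sub>1 D S\<^sub>1 S\<^sub>2 E \<in> S\<^sub>1 \<and> (\<exists>E\<^sub>2\<in>S\<^sub>2. fits_triangle D E\<^sub>2 E (lam\<^sub>1 D S\<^sub>1 S\<^sub>2 E))"
    unfolding lam\<^sub>1_def by (rule someI_ex) (use decomposition[OF assms] in blast)
  moreover have "rho\<^sub>2 D S\<^sub>1 S\<^sub>2 E \<in> S\<^sub>2 \<and> (\<exists>E\<^sub>1\<in>S\<^sub>1. fits_triangle D (rho\<^sub>2 D S\<^sub>1 S\<^sub>2 E) E E\<^sub>1)"
    unfolding rho\<^sub>2_def by (rule someI_ex) (use decomposition[OF assms] in blast)
  ultimately show "lam\<^sub>1 D S\<^sub>1 S\<^sub>2 E \<in> S\<^sub>1" "\<exists>E\<^sub>2\<in>S\<^sub>2. fits_triangle D E\<^sub>2 E (lam\<^sub>1 D S\<^sub>1 S\<^sub>2 E)"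
    "rho\<^sub>2 D S\<^sub>1 S\<^sub>2 E \<in> S\<^sub>2" "\<exists>E\<^sub>1\<in>S\<^sub>1. fits_triangle D (rho\<^sub>2 D S\<^sub>1 S\<^sub>2 E) E E\<^sub>1" by blast+
qed

lemma lam_rho_iso:
  assumes "fits_triangle D E\<^sub>2 E E\<^sub>1" "E\<^sub>1 \<in> S\<^sub>1" "E\<^sub>2 \<in> S\<^sub>2"
  shows "isomorphic D E\<^sub>1 (lam\<^sub>1 D S\<^sub>1 S\<^sub>2 E)" "isomorphic D E\<^sub>2 (rho\<^sub>2 D S\<^sub>1 S\<^sub>2 E)"
proof -
  note L = lam_rho[OF fits_Obj(2)[OF assms(1)]]
  show "isomorphic D E\<^sub>1 (lam\<^sub>1 D S\<^sub>1 S\<^sub>2 E)" using L(1,2) decomposition_unique(2)[OF assms(1)] assms(2,3) by blast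
  show "isomorphic D E\<^sub>2 (rho\<^sub>2 D S\<^sub>1 S\<^sub>2 E)" using L(3,4) decomposition_unique(1)[OF assms(1)] assms(2,3) by blast
qed

lemma lam_rho_fits:
  assumes "E \<in> Obj D"
  shows "fits_triangle D (rho\<^sub>2 D S\<^sub>1 S\<^sub>2 E) E (lam\<^sub>1 D S\<^sub>1 S\<^sub>2 E)"
proof -
  obtain E\<^sub>1 where E1: "E\<^sub>1 \<in> S\<^sub>1" "fits_triangle D (rho\<^sub>2 D S\<^sub>1 S\<^sub>2 E) E E\<^sub>1" using lam_rho(4)[OF assms] by blast
  note r = lam_rho(3)[OF assms]
  show ?thesis
    using fits_iso[OF E1(2) isomorphic_refl isomorphic_refl lam_rho_iso(1)[OF E1(2,1) r]]
      fits_Obj[OF E1(2)] by blast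
qed

lemma glued_charge_eq:
  assumes "fits_triangle D E\<^sub>2 E E\<^sub>1" "E\<^sub>1 \<in> S\<^sub>1" "E\<^sub>2 \<in> S\<^sub>2"
  shows "glued_charge E = z\<^sub>1 E\<^sub>1 + z\<^sub>2 E\<^sub>2"
  unfolding glued_charge_def
  using one.z_iso[OF assms(2) lam_rho_iso(1)[OF assms]] two.z_iso[OF assms(3) lam_rho_iso(2)[OF assms]] by simp

text \<open>
  The decomposition triangles of the outer terms merge to one of the middle term, since there are no
  morphisms from the second subcategory to the first.
\<close>

lemma decomposition_merge:
  assumes "fits_triangle D A B C" "fits_triangle D A\<^sub>2 A A\<^sub>1" "fits_triangle D C\<^sub>2 C C\<^sub>1"
    "A\<^sub>1 \<in> S\<^sub>1" "C\<^sub>2 \<in> S\<^sub>2"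
  obtains B\<^sub>2 B\<^sub>1 where "fits_triangle D B\<^sub>2 B B\<^sub>1" "fits_triangle D A\<^sub>2 B\<^sub>2 C\<^sub>2" "fits_triangle D A\<^sub>1 B\<^sub>1 C\<^sub>1"
  using fits_merge[OF assms(1-3) semiorthogonal[OF assms(5) sub_Sh[OF one.S_sub assms(4)]]] by blast

lemma glued_charge_additive:
  assumes "fits_triangle D A B C" shows "glued_charge B = glued_charge A + glued_charge C"
proof -
  obtain A\<^sub>1 A\<^sub>2 where A: "A\<^sub>1 \<in> S\<^sub>1" "A\<^sub>2 \<in> S\<^sub>2" "fits_triangle D A\<^sub>2 A A\<^sub>1"
    using decomposition fits_Obj(1)[OF assms] by blast
  obtain C\<^sub>1 C\<^sub>2 where C: "C\<^sub>1 \<in> S\<^sub>1" "C\<^sub>2 \<in> S\<^sub>2" "fits_triangle D C\<^sub>2 C C\<^sub>1"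
    using decomposition fits_Obj(3)[OF assms] by blast
  obtain B\<^sub>2 B\<^sub>1 where B: "fits_triangle D B\<^sub>2 B B\<^sub>1" "fits_triangle D A\<^sub>2 B\<^sub>2 C\<^sub>2" "fits_triangle D A\<^sub>1 B\<^sub>1 C\<^sub>1"
    using decomposition_merge[OF assms A(3) C(3) A(1) C(2)] .
  have B1: "B\<^sub>1 \<in> S\<^sub>1" "B\<^sub>2 \<in> S\<^sub>2"
    using sub_ext_closed[OF one.S_sub A(1) C(1) B(3)] sub_ext_closed[OF two.S_sub A(2) C(2) B(2)] .
  show ?thesis
    using glued_charge_eq[OF A(3,1,2)] glued_charge_eq[OF C(3,1,2)] glued_charge_eq[OF B(1) B1]
      one.z_additive[OF A(1) B1(1) C(1) B(3)] two.z_additive[OF A(2) B1(2) C(2) B(2)] by simp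
qed

subsection \<open>Glued classes of objects\<close>

lemma glued_phasesE:
  assumes "E \<in> glued_phases I"
  obtains E\<^sub>2 E\<^sub>1 where "E\<^sub>2 \<in> two.phases I" "E\<^sub>1 \<in> one.phases I" "fits_triangle D E\<^sub>2 E E\<^sub>1"
    "E\<^sub>1 \<in> S\<^sub>1" "E\<^sub>2 \<in> S\<^sub>2"
  using assms one.phases_S two.phases_S unfolding glued_phases_def by blast

lemma glued_phasesI:
  "E\<^sub>2 \<in> two.phases I \<Longrightarrow> E\<^sub>1 \<in> one.phases I \<Longrightarrow> fits_triangle D E\<^sub>2 E E\<^sub>1 \<Longrightarrow> E \<in> glued_phases I"
  unfolding glued_phases_def by blast

lemma glued_phases_iff:
  assumes "I \<noteq> {}"
  shows "glued_phases I =
    {E \<in> Obj D. lam\<^sub>1 D S\<^sub>1 S\<^sub>2 E \<in> one.phases I \<and> rho\<^sub>2 D S\<^sub>1 S\<^sub>2 E \<in> two.phases I}"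
proof (intro equalityI subsetI)
  fix E assume "E \<in> glued_phases I"
  then obtain E\<^sub>2 E\<^sub>1 where E: "E\<^sub>2 \<in> two.phases I" "E\<^sub>1 \<in> one.phases I" "fits_triangle D E\<^sub>2 E E\<^sub>1"
    "E\<^sub>1 \<in> S\<^sub>1" "E\<^sub>2 \<in> S\<^sub>2" by (rule glued_phasesE)
  show "E \<in> {E \<in> Obj D. lam\<^sub>1 D S\<^sub>1 S\<^sub>2 E \<in> one.phases I \<and> rho\<^sub>2 D S\<^sub>1 S\<^sub>2 E \<in> two.phases I}"
    using replete_mem[OF one.phases_replete[OF assms] E(2) lam_rho_iso(1)[OF E(3-5)]]
      replete_mem[OF two.phases_replete[OF assms] E(1) lam_rho_iso(2)[OF E(3-5)]] fits_Obj(2)[OF E(3)] by blast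
next
  fix E assume "E \<in> {E \<in> Obj D. lam\<^sub>1 D S\<^sub>1 S\<^sub>2 E \<in> one.phases I \<and> rho\<^sub>2 D S\<^sub>1 S\<^sub>2 E \<in> two.phases I}"
  then show "E \<in> glued_phases I" using lam_rho_fits glued_phasesI by blast
qed

lemma glued_phases_mono: "I \<subseteq> J \<Longrightarrow> glued_phases I \<subseteq> glued_phases J"
  using one.phases_mono[of I J] two.phases_mono[of I J] unfolding glued_phases_def by blast

lemma glued_phases_ext:
  assumes "A \<in> glued_phases I" "C \<in> glued_phases I" "fits_triangle D A B C"
  shows "B \<in> glued_phases I"
proof -
  obtain A\<^sub>2 A\<^sub>1 where A: "A\<^sub>2 \<in> two.phases I" "A\<^sub>1 \<in> one.phases I" "fits_triangle D A\<^sub>2 A A\<^sub>1"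
    "A\<^sub>1 \<in> S\<^sub>1" "A\<^sub>2 \<in> S\<^sub>2" by (rule glued_phasesE[OF assms(1)])
  obtain C\<^sub>2 C\<^sub>1 where C: "C\<^sub>2 \<in> two.phases I" "C\<^sub>1 \<in> one.phases I" "fits_triangle D C\<^sub>2 C C\<^sub>1"
    "C\<^sub>1 \<in> S\<^sub>1" "C\<^sub>2 \<in> S\<^sub>2" by (rule glued_phasesE[OF assms(2)])
  obtain B\<^sub>2 B\<^sub>1 where B: "fits_triangle D B\<^sub>2 B B\<^sub>1" "fits_triangle D A\<^sub>2 B\<^sub>2 C\<^sub>2" "fits_triangle D A\<^sub>1 B\<^sub>1 C\<^sub>1"
    using decomposition_merge[OF assms(3) A(3) C(3) A(4) C(5)] .
  show ?thesis
    using glued_phasesI[OF two.phases_ext[OF A(1) C(1) B(2)] one.phases_ext[OF A(2) C(2) B(3)] B(1)] .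
qed

lemma glued_phases_zero: "I \<noteq> {} \<Longrightarrow> zero_object D X \<Longrightarrow> X \<in> glued_phases I"
  using glued_phasesI[OF two.phases_zero one.phases_zero fits_zero_left[OF isomorphic_refl]] zero_Obj by blast

lemma glued_phases_replete: assumes "I \<noteq> {}" shows "replete D (glued_phases I)"
  unfolding replete_def
proof (intro conjI ballI impI)
  show "glued_phases I \<subseteq> Obj D" unfolding glued_phases_def using fits_Obj by blast
  fix A B assume A: "A \<in> glued_phases I" and AB: "isomorphic D A B"
  obtain Z where "zero_object D Z" using zero_object_exists by blast
  then show "B \<in> glued_phases I"
    using glued_phases_ext[OF A glued_phases_zero[OF assms] fits_zero_right[OF AB]] by blast
qed

lemma glued_phases_Sh:
  assumes "E \<in> glued_phases I" "\<And>\<phi>. \<phi> \<in> I \<Longrightarrow> \<phi> + 1 \<in> J" shows "Sh D 1 E \<in> glued_phases J"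
proof -
  obtain E\<^sub>2 E\<^sub>1 where E: "E\<^sub>2 \<in> two.phases I" "E\<^sub>1 \<in> one.phases I" "fits_triangle D E\<^sub>2 E E\<^sub>1"
    by (rule glued_phasesE[OF assms(1)])
  show ?thesis
    using glued_phasesI[OF two.phases_Sh[OF E(1)] one.phases_Sh[OF E(2)] fits_Sh[OF E(3)]] assms(2) by blast
qed

lemma glued_phases_Sh_back:
  assumes "E \<in> glued_phases I" "\<And>\<phi>. \<phi> \<in> I \<Longrightarrow> \<phi> - 1 \<in> J" shows "Sh D (-1) E \<in> glued_phases J"
proof -
  obtain E\<^sub>2 E\<^sub>1 where E: "E\<^sub>2 \<in> two.phases I" "E\<^sub>1 \<in> one.phases I" "fits_triangle D E\<^sub>2 E E\<^sub>1"
    by (rule glued_phasesE[OF assms(1)])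
  show ?thesis
    using glued_phasesI[OF two.phases_Sh_back[OF E(1)] one.phases_Sh_back[OF E(2)] fits_Sh_back[OF E(3)]]
      assms(2) by blast
qed

text \<open>
  The two decompositions of \<open>E\<close> agree by uniqueness, which reduces the claim to the two components.
\<close>

lemma glued_phases_interval:
  assumes "s < t" "E \<in> glued_phases {s<..}" "E \<in> glued_phases {..t}"
  shows "E \<in> glued_phases {s<..t}"
proof -
  obtain E\<^sub>2 E\<^sub>1 where E: "E\<^sub>2 \<in> two.phases {s<..}" "E\<^sub>1 \<in> one.phases {s<..}" "fits_triangle D E\<^sub>2 E E\<^sub>1"
    "E\<^sub>1 \<in> S\<^sub>1" "E\<^sub>2 \<in> S\<^sub>2" by (rule glued_phasesE[OF assms(2)])
  obtain F\<^sub>2 F\<^sub>1 where F: "F\<^sub>2 \<in> two.phases {..t}" "F\<^sub>1 \<in> one.phases {..t}" "fits_triangle D F\<^sub>2 E F\<^sub>1"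
    "F\<^sub>1 \<in> S\<^sub>1" "F\<^sub>2 \<in> S\<^sub>2" by (rule glued_phasesE[OF assms(3)])
  note iso = decomposition_unique[OF F(3) E(3) F(4) E(4) F(5) E(5)]
  have "E\<^sub>2 \<in> two.phases {..t}" "E\<^sub>1 \<in> one.phases {..t}"
    using replete_mem[OF two.phases_replete F(1) iso(1)] replete_mem[OF one.phases_replete F(2) iso(2)] by auto
  then show ?thesis
    using glued_phasesI E(1-3) one.phases_interval[OF assms(1)] two.phases_interval[OF assms(1)] by blast
qed

lemma cut_phases_hom:
  assumes "A \<in> one.phases {cut i<..}" "B \<in> two.phases {..cut i + 1}" shows "hom_zero D A B"
  using assms unfolding one.phases_def two.phases_def
  by (rule ext_closure_hom_zero[rotated]) (use cut_hom in auto)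

lemma glued_hom:
  assumes "A \<in> glued_phases {cut i<..}" "B \<in> glued_phases {..cut i}" shows "hom_zero D A B"
proof -
  obtain A\<^sub>2 A\<^sub>1 where A: "A\<^sub>2 \<in> two.phases {cut i<..}" "A\<^sub>1 \<in> one.phases {cut i<..}" "fits_triangle D A\<^sub>2 A A\<^sub>1"
    "A\<^sub>1 \<in> S\<^sub>1" "A\<^sub>2 \<in> S\<^sub>2" by (rule glued_phasesE[OF assms(1)])
  obtain B\<^sub>2 B\<^sub>1 where B: "B\<^sub>2 \<in> two.phases {..cut i}" "B\<^sub>1 \<in> one.phases {..cut i}" "fits_triangle D B\<^sub>2 B B\<^sub>1"
    "B\<^sub>1 \<in> S\<^sub>1" "B\<^sub>2 \<in> S\<^sub>2" by (rule glued_phasesE[OF assms(2)])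
  have 22: "hom_zero D A\<^sub>2 B\<^sub>2" by (rule two.phases_hom[OF A(1) B(1)]) auto
  have 11: "hom_zero D A\<^sub>1 B\<^sub>1" by (rule one.phases_hom[OF A(2) B(2)]) auto
  have "two.phases {..cut i} \<subseteq> two.phases {..cut i + 1}" by (rule two.phases_mono) auto
  then have 12: "hom_zero D A\<^sub>1 B\<^sub>2" using cut_phases_hom[OF A(2)] B(1) by blast
  have 21: "hom_zero D A\<^sub>2 B\<^sub>1" using semiorthogonal A(5) B(4) by blast
  show ?thesis
    using fits_hom_zero_left[OF A(3)] fits_hom_zero_right[OF B(3)] 22 21 12 11 by blast
qed

text \<open>
  The truncations of the two components merge since there are no morphisms from the upper part of \<open>E\<^sub>1\<close> to
  the shift of the lower part of \<open>E\<^sub>2\<close>.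
\<close>

lemma glued_truncation:
  assumes "E \<in> Obj D"
  shows "\<exists>X\<in>glued_phases {cut i<..}. \<exists>Y\<in>glued_phases {..cut i}. fits_triangle D X E Y"
proof -
  obtain E\<^sub>1 E\<^sub>2 where E: "E\<^sub>1 \<in> S\<^sub>1" "E\<^sub>2 \<in> S\<^sub>2" "fits_triangle D E\<^sub>2 E E\<^sub>1"
    using decomposition[OF assms] by blast
  obtain X\<^sub>2 Y\<^sub>2 where 2: "X\<^sub>2 \<in> two.phases {cut i<..}" "Y\<^sub>2 \<in> two.phases {..cut i}" "fits_triangle D X\<^sub>2 E\<^sub>2 Y\<^sub>2"
    using two.phases_truncation[OF E(2)] .
  obtain X\<^sub>1 Y\<^sub>1 where 1: "X\<^sub>1 \<in> one.phases {cut i<..}" "Y\<^sub>1 \<in> one.phases {..cut i}" "fits_triangle D X\<^sub>1 E\<^sub>1 Y\<^sub>1"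
    using one.phases_truncation[OF E(1)] .
  have "Sh D 1 Y\<^sub>2 \<in> two.phases {..cut i + 1}" by (rule two.phases_Sh[OF 2(2)]) auto
  then have "hom_zero D X\<^sub>1 (Sh D 1 Y\<^sub>2)" using cut_phases_hom 1(1) by blast
  then obtain X Y where "fits_triangle D X E Y" "fits_triangle D X\<^sub>2 X X\<^sub>1" "fits_triangle D Y\<^sub>2 Y Y\<^sub>1"
    using fits_merge[OF E(3) 2(3) 1(3)] by metis
  then show ?thesis using glued_phasesI 1 2 by blast
qed

lemma glued_bounded:
  assumes "E \<in> Obj D" shows "\<exists>i j. E \<in> glued_phases {cut i<..} \<and> E \<in> glued_phases {..cut j}"
proof -
  obtain E\<^sub>1 E\<^sub>2 where E: "E\<^sub>1 \<in> S\<^sub>1" "E\<^sub>2 \<in> S\<^sub>2" "fits_triangle D E\<^sub>2 E E\<^sub>1"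
    using decomposition[OF assms] by blast
  obtain b where b: "\<And>t. t \<le> - b \<Longrightarrow> E\<^sub>1 \<in> one.phases {t<..}" "\<And>t. b \<le> t \<Longrightarrow> E\<^sub>1 \<in> one.phases {..t}"
    using one.phases_bounded[OF E(1)] by metis
  obtain d where d: "\<And>t. t \<le> - d \<Longrightarrow> E\<^sub>2 \<in> two.phases {t<..}" "\<And>t. d \<le> t \<Longrightarrow> E\<^sub>2 \<in> two.phases {..t}"
    using two.phases_bounded[OF E(2)] by metis
  obtain i where i: "cut i < - max b d" using cut_cover by blast
  obtain j where j: "max b d \<le> cut (j + 1)" using cut_cover by blast
  have "E \<in> glued_phases {cut i<..}" by (rule glued_phasesI[OF d(1) b(1) E(3)]) (use i in auto)
  moreover have "E \<in> glued_phases {..cut (j + 1)}" by (rule glued_phasesI[OF d(2) b(2) E(3)]) (use j in auto)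
  ultimately show ?thesis by blast
qed

lemma glued_phases_charge:
  assumes "E \<in> glued_phases I" "\<not> zero_object D E"
    and add: "\<And>v w. Q v \<Longrightarrow> Q w \<Longrightarrow> Q (v + w)" and ray: "\<And>\<phi> m. \<phi> \<in> I \<Longrightarrow> \<epsilon> \<le> m \<Longrightarrow> Q (ray m \<phi>)"
  shows "Q (glued_charge E)"
proof -
  obtain E\<^sub>2 E\<^sub>1 where E: "E\<^sub>2 \<in> two.phases I" "E\<^sub>1 \<in> one.phases I" "fits_triangle D E\<^sub>2 E E\<^sub>1"
    "E\<^sub>1 \<in> S\<^sub>1" "E\<^sub>2 \<in> S\<^sub>2" by (rule glued_phasesE[OF assms(1)])
  have z: "glued_charge E = z\<^sub>1 E\<^sub>1 + z\<^sub>2 E\<^sub>2" using glued_charge_eq[OF E(3-5)] .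
  have 1: "Q (z\<^sub>1 E\<^sub>1)" if "\<not> zero_object D E\<^sub>1" using one.phases_charge[OF E(2) that, of Q] add ray by blast
  have 2: "Q (z\<^sub>2 E\<^sub>2)" if "\<not> zero_object D E\<^sub>2" using two.phases_charge[OF E(1) that, of Q] add ray by blast
  have "\<not> (zero_object D E\<^sub>1 \<and> zero_object D E\<^sub>2)"
    using zero_object_iso[OF _ isomorphic_sym[OF zero_left_iso[OF E(3)]]] assms(2) by blast
  then show ?thesis using 1 2 add z one.z_zero two.z_zero by (metis add.left_neutral add.right_neutral)
qed

sublocale cuts: cut_system D "\<lambda>i. glued_phases {cut i<..}" "\<lambda>i. glued_phases {..cut i}" cut glued_charge \<epsilon>
proof
  fix i j :: int and E A B C X :: 'o and Q :: "complex \<Rightarrow> bool" and \<phi> :: real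
  show "replete D (glued_phases {cut i<..})" "replete D (glued_phases {..cut i})"
    by (rule glued_phases_replete, simp)+
  show "A \<in> glued_phases {cut i<..} \<Longrightarrow> C \<in> glued_phases {cut i<..} \<Longrightarrow> fits_triangle D A B C \<Longrightarrow>
      B \<in> glued_phases {cut i<..}"
    "A \<in> glued_phases {..cut i} \<Longrightarrow> C \<in> glued_phases {..cut i} \<Longrightarrow> fits_triangle D A B C \<Longrightarrow>
      B \<in> glued_phases {..cut i}"
    using glued_phases_ext by blast+
  show "glued_phases {cut (i + 1)<..} \<subseteq> glued_phases {cut i<..}" "glued_phases {..cut i} \<subseteq> glued_phases {..cut (i + 1)}"
    using cut_step[of i] by (auto intro!: glued_phases_mono)
  have c: "cut (i - 2) = cut i - 1" using cut_period[of "i - 2"] by simp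
  show "E \<in> glued_phases {cut i<..} \<Longrightarrow> Sh D 1 E \<in> glued_phases {cut (i + 2)<..}"
    "E \<in> glued_phases {..cut i} \<Longrightarrow> Sh D 1 E \<in> glued_phases {..cut (i + 2)}"
    by (erule glued_phases_Sh, simp add: cut_period)+
  show "E \<in> glued_phases {cut i<..} \<Longrightarrow> Sh D (-1) E \<in> glued_phases {cut (i - 2)<..}"
    "E \<in> glued_phases {..cut i} \<Longrightarrow> Sh D (-1) E \<in> glued_phases {..cut (i - 2)}"
    by (erule glued_phases_Sh_back, simp add: c)+
  show "A \<in> glued_phases {cut i<..} \<Longrightarrow> B \<in> glued_phases {..cut i} \<Longrightarrow> hom_zero D A B" by (rule glued_hom)
  show "E \<in> Obj D \<Longrightarrow> \<exists>A\<in>glued_phases {cut i<..}. \<exists>B\<in>glued_phases {..cut i}. fits_triangle D A E B"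
    by (rule glued_truncation)
  show "E \<in> Obj D \<Longrightarrow> \<exists>i j. E \<in> glued_phases {cut i<..} \<and> E \<in> glued_phases {..cut j}" by (rule glued_bounded)
  show "zero_object D X \<Longrightarrow> X \<in> glued_phases {cut i<..}" "zero_object D X \<Longrightarrow> X \<in> glued_phases {..cut i}"
    by (rule glued_phases_zero, simp, assumption)+
  show "fits_triangle D A B C \<Longrightarrow> glued_charge B = glued_charge A + glued_charge C" by (rule glued_charge_additive)
  show "Q (glued_charge E)" if E: "E \<in> glued_phases {cut i<..}" "E \<in> glued_phases {..cut j}" and "i < j" and
      "\<not> zero_object D E" and "\<And>v w. Q v \<Longrightarrow> Q w \<Longrightarrow> Q (v + w)" and
      "\<And>\<phi> m. cut i < \<phi> \<Longrightarrow> \<phi> \<le> cut j \<Longrightarrow> \<epsilon> \<le> m \<Longrightarrow> Q (ray m \<phi>)"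
  proof -
    have c: "cut i < cut j" using \<open>i < j\<close>
      by (induct j rule: int_gr_induct) (use cut_step less_trans in \<open>blast intro: less_trans\<close>)+
    show ?thesis
      by (rule glued_phases_charge[OF glued_phases_interval[OF c E] that(4), of Q])
        (use that(5,6) in auto)
  qed
qed (rule cut_step cut_period cut_cover \<epsilon>_pos)+

end

section \<open>The glued stability condition\<close>

context triangulated_category
begin

text \<open>
  The lower bound may be decreased, so that two slicings can share one.
\<close>

lemma slicing_on_full_subcat:
  assumes sub: "triangulated_subcategory D S"
    and stab: "stability_condition (full_subcat D S) \<sigma>" and reas: "reasonable (full_subcat D S) \<sigma>"
  obtains \<delta> where "0 < \<delta>"
    "\<And>\<epsilon>. \<epsilon> \<le> \<delta> \<Longrightarrow> slicing_on D S (slice \<sigma>) (Z_of (full_subcat D S) \<sigma>) \<epsilon>"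
proof -
  let ?T = "full_subcat D S"
  note So = sub_Obj[OF sub]
  have ch: "charge \<sigma> \<in> hom (K0 ?T) complex_group"
    and add: "\<And>\<phi>. additive_subcategory ?T (slice \<sigma> \<phi>)"
    and sh: "\<And>\<phi>. Sh D 1 ` slice \<sigma> \<phi> = slice \<sigma> (\<phi> + 1)"
    and hom: "\<And>\<phi> \<psi> A B. \<psi> < \<phi> \<Longrightarrow> A \<in> slice \<sigma> \<phi> \<Longrightarrow> B \<in> slice \<sigma> \<psi> \<Longrightarrow> hom_zero ?T A B"
    and ray: "\<And>\<phi> E. E \<in> slice \<sigma> \<phi> \<Longrightarrow> \<not> zero_object ?T E \<Longrightarrow> \<exists>m>0. Z_of ?T \<sigma> E = ray m \<phi>"
    and HN: "\<And>E. E \<in> S \<Longrightarrow> \<not> zero_object ?T E \<Longrightarrow> \<exists>n F A \<phi>. HN_filtration ?T (slice \<sigma>) E n F A \<phi>"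
    using stab unfolding stability_condition_def ray_def by simp_all
  have rep: "replete ?T (slice \<sigma> \<phi>)" "\<exists>X\<in>slice \<sigma> \<phi>. zero_object ?T X" for \<phi>
    using add[of \<phi>] unfolding additive_subcategory_def by blast+
  have PS: "slice \<sigma> \<phi> \<subseteq> S" for \<phi> using rep(1)[of \<phi>] unfolding replete_def by simp
  have zero: "zero_object ?T X \<longleftrightarrow> X \<in> S \<and> zero_object D X" for X
    using zero_object_full_subcat[OF So] .
  have SR: "replete D S" using sub unfolding triangulated_subcategory_def by blast
  let ?A = "{E. \<not> zero_object ?T E \<and> (\<exists>\<phi>. E \<in> slice \<sigma> \<phi>)}"
  obtain \<delta> where d: "0 < ereal \<delta>" "ereal \<delta> < (INF E\<in>?A. ereal (cmod (Z_of ?T \<sigma> E)))"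
    using reas ereal_dense2 unfolding reasonable_def by blast
  have low: "\<delta> \<le> cmod (Z_of ?T \<sigma> E)" if "E \<in> ?A" for E
    using less_le_trans[OF d(2) INF_lower[OF that]] by simp
  show thesis
  proof (rule that[of \<delta>])
    show "0 < \<delta>" using d(1) by simp
    fix \<epsilon> assume e: "\<epsilon> \<le> \<delta>"
    show "slicing_on D S (slice \<sigma>) (Z_of ?T \<sigma>) \<epsilon>"
    proof unfold_locales
      fix \<phi> \<psi> A B C E
      show "replete D (slice \<sigma> \<phi>)" using replete_full_subcat[OF SR rep(1)] .
      show "\<exists>X\<in>slice \<sigma> \<phi>. zero_object D X" using rep(2)[of \<phi>] zero by blast
      show "hom_zero D A B" if "\<psi> < \<phi>" "A \<in> slice \<sigma> \<phi>" "B \<in> slice \<sigma> \<psi>"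
        using hom[OF that] hom_zero_full_subcat[of A S B] PS that by blast
      show "\<exists>l. sorted_wrt (<) l \<and> filtered D (slice \<sigma>) l E" if E: "E \<in> S"
      proof (cases "zero_object ?T E")
        case True
        then show ?thesis using zero by (intro exI[of _ "[]"]) simp
      next
        case False
        then obtain n F A \<phi> where H: "HN_filtration ?T (slice \<sigma>) E n F A \<phi>" using HN[OF E] by blast
        show ?thesis
          using filtered_full_subcat[OF sub HN_filtration_filtered(1)[OF H]] HN_filtration_filtered(2)[OF H] by blast
      qed
      show "Z_of ?T \<sigma> B = Z_of ?T \<sigma> A + Z_of ?T \<sigma> C"
        if "A \<in> S" "B \<in> S" "C \<in> S" "fits_triangle D A B C"
        by (rule Z_of_additive[OF ch]) (use that fits_full_subcat[OF So] sub_Sh[OF sub] in blast)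
      show "\<exists>m\<ge>\<epsilon>. Z_of ?T \<sigma> E = ray m \<phi>" if E: "E \<in> slice \<sigma> \<phi>" "\<not> zero_object D E"
      proof -
        have nz: "\<not> zero_object ?T E" using E zero by blast
        obtain m where m: "m > 0" "Z_of ?T \<sigma> E = ray m \<phi>" using ray[OF E(1) nz] by blast
        have "\<delta> \<le> cmod (Z_of ?T \<sigma> E)" by (rule low) (use nz E(1) in blast)
        then have "\<epsilon> \<le> m" using m e by (simp add: cmod_ray)
        then show ?thesis using m(2) by blast
      qed
    qed (use sub PS sh in auto)
  qed
qed

end

lemma (in slicing_on) P_interval_phases:
  "P = slice \<sigma> \<Longrightarrow> P_interval (full_subcat D S) \<sigma> I = phases I"
  unfolding P_interval_def phases_def using ext_closure_full_subcat[OF S_sub] P_S by (metis UN_least)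

text \<open>
  Shift \<open>A\<close> by \<open>-m\<close> and \<open>B\<close> by \<open>-n\<close> into the hearts with phases in \<open>(t, t + 1]\<close>. The bounds on \<open>\<phi>\<close> and \<open>\<psi>\<close> say that
  \<open>n \<le> k \<le> m\<close>, so a morphism \<open>A \<rightarrow> B\<close> becomes one of degree \<open>n - m \<le> 0\<close> between the hearts.
\<close>

lemma hom_zero_from_hearts:
  fixes k :: int
  assumes one: "slicing_on D S\<^sub>1 P\<^sub>1 z\<^sub>1 \<epsilon>" and two: "slicing_on D S\<^sub>2 P\<^sub>2 z\<^sub>2 \<epsilon>"
    and hearts: "hom_le_zero D 0 (slicing_on.phases D P\<^sub>1 {t<..t + 1}) (slicing_on.phases D P\<^sub>2 {t<..t + 1})"
    and "t + of_int k < \<phi>" "\<psi> \<le> t + of_int k + 1" "A \<in> P\<^sub>1 \<phi>" "B \<in> P\<^sub>2 \<psi>"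
  shows "hom_zero D A B"
proof -
  interpret one: slicing_on D S\<^sub>1 P\<^sub>1 z\<^sub>1 \<epsilon> by (rule one)
  interpret two: slicing_on D S\<^sub>2 P\<^sub>2 z\<^sub>2 \<epsilon> by (rule two)
  define m where "m = \<lceil>\<phi> - t\<rceil> - 1"
  define n where "n = \<lceil>\<psi> - t\<rceil> - 1"
  have m: "\<phi> + of_int (- m) \<in> {t<..t + 1}" using ceiling_correct[of "\<phi> - t"] by (simp add: m_def) linarith
  have n: "\<psi> + of_int (- n) \<in> {t<..t + 1}" using ceiling_correct[of "\<psi> - t"] by (simp add: n_def) linarith
  have "k < \<lceil>\<phi> - t\<rceil>" "\<lceil>\<psi> - t\<rceil> \<le> k + 1" using assms(4,5) by (simp_all add: less_ceiling_iff ceiling_le_iff)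
  then have "n - m \<le> 0" by (simp add: m_def n_def)
  moreover have "Sh D (- m) A \<in> one.phases {t<..t + 1}" unfolding one.phases_def
    using one.P_Sh_int[OF assms(6), of "- m"] m by (blast intro: ext_closure.base)
  moreover have "Sh D (- n) B \<in> two.phases {t<..t + 1}" unfolding two.phases_def
    using two.P_Sh_int[OF assms(7), of "- n"] n by (blast intro: ext_closure.base)
  ultimately have "hom_zero D (Sh D (- m) A) (Sh D (n - m) (Sh D (- n) B))"
    using hearts unfolding hom_le_zero_def by blast
  then have h: "hom_zero D (Sh D m (Sh D (- m) A)) (Sh D m (Sh D (n - m) (Sh D (- n) B)))"
    by (rule one.hom_zero_Sh)
  have A: "A \<in> Obj D" using one.P_S one.sub_Obj[OF one.S_sub] assms(6) by blast
  have B: "B \<in> Obj D" using two.P_S one.sub_Obj[OF two.S_sub] assms(7) by blast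
  have "Sh D m (Sh D (- m) A) = A" using one.Sh_plus[OF A, of m "- m"] one.Sh_0[OF A] by simp
  moreover have "Sh D m (Sh D (n - m) (Sh D (- n) B)) = B"
    using one.Sh_plus[OF B, of "n - m" "- n"] one.Sh_plus[OF B, of m "- m"] one.Sh_0[OF B] by simp
  ultimately show ?thesis using h by simp
qed

text \<open>The cuts are at the elements of \<open>\<int> \<union> (a + \<int>)\<close>, in increasing order.\<close>

definition gluing_cut :: "real \<Rightarrow> int \<Rightarrow> real" where
  "gluing_cut a i = of_int (i div 2) + (if even i then 0 else a)"

lemma gluing_cut_even: "gluing_cut a (2 * k) = of_int k" and gluing_cut_odd: "gluing_cut a (2 * k + 1) = a + of_int k"
  by (simp_all add: gluing_cut_def)

lemma gluing_cut_step:
  assumes "0 < a" "a < 1" shows "gluing_cut a i < gluing_cut a (i + 1)"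
proof (cases "even i")
  case True
  then obtain k where "i = 2 * k" by blast
  then show ?thesis using assms gluing_cut_even[of a k] gluing_cut_odd[of a k] by simp
next
  case False
  then obtain k where "i = 2 * k + 1" using oddE by blast
  then show ?thesis
    using assms gluing_cut_even[of a "k + 1"] gluing_cut_odd[of a k] by (simp add: add.commute)
qed

lemma gluing_cut_period: "gluing_cut a (i + 2) = gluing_cut a i + 1"
  by (simp add: gluing_cut_def)

lemma gluing_cut_cover: "\<exists>i. gluing_cut a i < \<phi> \<and> \<phi> \<le> gluing_cut a (i + 1)"
proof -
  define k where "k = \<lceil>\<phi>\<rceil> - 1"
  have k: "of_int k < \<phi>" "\<phi> \<le> of_int k + 1" using ceiling_correct[of \<phi>] by (simp_all add: k_def)
  show ?thesis
  proof (cases "\<phi> \<le> a + of_int k")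
    case True
    then show ?thesis using k gluing_cut_even[of a k] gluing_cut_odd[of a k] by (intro exI[of _ "2 * k"]) simp
  next
    case False
    then show ?thesis using k gluing_cut_even[of a "k + 1"] gluing_cut_odd[of a k]
      by (intro exI[of _ "2 * k + 1"]) (simp add: add.commute)
  qed
qed

theorem theorem3p6:
  fixes D :: "('o, 'm) tricat"
    and D\<^sub>1 D\<^sub>2 :: "'o set"
    and \<sigma>\<^sub>1 \<sigma>\<^sub>2 :: "'o stab"
    and a :: real
  assumes "triangulated_category D"
    and "semiorthogonal_decomposition D D\<^sub>1 D\<^sub>2"
    and "stability_condition (full_subcat D D\<^sub>1) \<sigma>\<^sub>1"
    and "reasonable (full_subcat D D\<^sub>1) \<sigma>\<^sub>1"
    and "stability_condition (full_subcat D D\<^sub>2) \<sigma>\<^sub>2"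
    and "reasonable (full_subcat D D\<^sub>2) \<sigma>\<^sub>2"
    and "0 < a" and "a < 1"
    and "hom_le_zero D 0 (P_interval (full_subcat D D\<^sub>1) \<sigma>\<^sub>1 {0<..1})
           (P_interval (full_subcat D D\<^sub>2) \<sigma>\<^sub>2 {0<..1})"
    and "hom_le_zero D 0 (P_interval (full_subcat D D\<^sub>1) \<sigma>\<^sub>1 {a<..a + 1})
           (P_interval (full_subcat D D\<^sub>2) \<sigma>\<^sub>2 {a<..a + 1})"
  shows "\<exists>\<sigma>. stability_condition D \<sigma> \<and> glued D D\<^sub>1 D\<^sub>2 \<sigma>\<^sub>1 \<sigma>\<^sub>2 \<sigma> \<and> reasonable D \<sigma>"
proof -
  interpret triangulated_category D by (rule assms(1))
  let ?z\<^sub>1 = "Z_of (full_subcat D D\<^sub>1) \<sigma>\<^sub>1" and ?z\<^sub>2 = "Z_of (full_subcat D D\<^sub>2) \<sigma>\<^sub>2"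
  have sod: "triangulated_subcategory D D\<^sub>1" "triangulated_subcategory D D\<^sub>2"
    "\<And>E\<^sub>2 E\<^sub>1. E\<^sub>2 \<in> D\<^sub>2 \<Longrightarrow> E\<^sub>1 \<in> D\<^sub>1 \<Longrightarrow> hom_zero D E\<^sub>2 E\<^sub>1"
    "\<And>E. E \<in> Obj D \<Longrightarrow> \<exists>E\<^sub>1\<in>D\<^sub>1. \<exists>E\<^sub>2\<in>D\<^sub>2. fits_triangle D E\<^sub>2 E E\<^sub>1"
    using assms(2) unfolding semiorthogonal_decomposition_def by blast+
  obtain \<delta>\<^sub>1 where d1: "0 < \<delta>\<^sub>1" "\<And>\<epsilon>. \<epsilon> \<le> \<delta>\<^sub>1 \<Longrightarrow> slicing_on D D\<^sub>1 (slice \<sigma>\<^sub>1) ?z\<^sub>1 \<epsilon>"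
    using slicing_on_full_subcat[OF sod(1) assms(3,4)] by blast
  obtain \<delta>\<^sub>2 where d2: "0 < \<delta>\<^sub>2" "\<And>\<epsilon>. \<epsilon> \<le> \<delta>\<^sub>2 \<Longrightarrow> slicing_on D D\<^sub>2 (slice \<sigma>\<^sub>2) ?z\<^sub>2 \<epsilon>"
    using slicing_on_full_subcat[OF sod(2) assms(5,6)] by blast
  define \<epsilon> where "\<epsilon> = min \<delta>\<^sub>1 \<delta>\<^sub>2"
  interpret one: slicing_on D D\<^sub>1 "slice \<sigma>\<^sub>1" ?z\<^sub>1 \<epsilon> by (rule d1(2)) (simp add: \<epsilon>_def)
  interpret two: slicing_on D D\<^sub>2 "slice \<sigma>\<^sub>2" ?z\<^sub>2 \<epsilon> by (rule d2(2)) (simp add: \<epsilon>_def)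
  note PI = one.P_interval_phases[OF refl] two.P_interval_phases[OF refl]
  have cut_hom: "hom_zero D A B" if "gluing_cut a i < \<phi>" "\<psi> \<le> gluing_cut a i + 1"
      "A \<in> slice \<sigma>\<^sub>1 \<phi>" "B \<in> slice \<sigma>\<^sub>2 \<psi>" for i \<phi> \<psi> A B
  proof (cases "even i")
    case True
    then obtain k where k: "i = 2 * k" by blast
    show ?thesis
      by (rule hom_zero_from_hearts[OF one.slicing_on_axioms two.slicing_on_axioms, of 0 k \<phi> \<psi>])
         (use assms(9) that k gluing_cut_even[of a k] PI in simp_all)
  next
    case False
    then obtain k where k: "i = 2 * k + 1" using oddE by blast
    show ?thesis
      by (rule hom_zero_from_hearts[OF one.slicing_on_axioms two.slicing_on_axioms, of a k \<phi> \<psi>])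
         (use assms(10) that k gluing_cut_odd[of a k] PI in simp_all)
  qed
  interpret gluing D D\<^sub>1 D\<^sub>2 "slice \<sigma>\<^sub>1" "slice \<sigma>\<^sub>2" ?z\<^sub>1 ?z\<^sub>2 \<epsilon> "gluing_cut a"
  proof unfold_locales
    show "0 < \<epsilon>" using d1(1) d2(1) by (simp add: \<epsilon>_def)
  qed (rule sod(3,4) gluing_cut_step[OF assms(7,8)] gluing_cut_period gluing_cut_cover cut_hom; assumption?)+
  obtain \<sigma> where \<sigma>: "stability_condition D \<sigma>" "reasonable D \<sigma>" "slice \<sigma> = cuts.semistable"
    "\<And>E. E \<in> Obj D \<Longrightarrow> Z_of D \<sigma> E = glued_charge E"
    using cuts.stability_condition_exists by metis
  have c: "gluing_cut a 0 = 0" "gluing_cut a 2 = 1" by (simp_all add: gluing_cut_def)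
  have "heart D \<sigma> = glued_phases {0<..} \<inter> glued_phases {..1}"
    unfolding heart_def P_interval_def \<sigma>(3) using cuts.ext_closure_semistable[of 0 2] c by simp
  also have "\<dots> = glued_phases {0<..1}"
  proof
    show "glued_phases {0<..} \<inter> glued_phases {..1} \<subseteq> glued_phases {0<..1}"
      using glued_phases_interval[of 0 1] by auto
    show "glued_phases {0<..1} \<subseteq> glued_phases {0<..} \<inter> glued_phases {..1}"
      by (intro Int_greatest glued_phases_mono) auto
  qed
  also have "\<dots> = {E \<in> Obj D. lam\<^sub>1 D D\<^sub>1 D\<^sub>2 E \<in> heart (full_subcat D D\<^sub>1) \<sigma>\<^sub>1 \<and>
      rho\<^sub>2 D D\<^sub>1 D\<^sub>2 E \<in> heart (full_subcat D D\<^sub>2) \<sigma>\<^sub>2}"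
    unfolding heart_def PI by (rule glued_phases_iff) simp
  finally have "glued D D\<^sub>1 D\<^sub>2 \<sigma>\<^sub>1 \<sigma>\<^sub>2 \<sigma>"
    using assms(9) \<sigma>(4) unfolding glued_def Let_def heart_def glued_charge_def by simp
  then show ?thesis using \<sigma>(1,2) by blast
qed

end
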